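(* Let $r\ge 1$ and let $K$ be an $r$-dimensional finite simplicial complex. Then for every integer $\ell\ge 1$, \[ \sum_{i=1}^{\ell}\lambda_{r-1,i}(K)\le \frac{r+1}{2}\,f_r(K)+\frac{f_{r-2}(K)}{r}\binom{\ell+1}{2}. \]
   Context: A (finite abstract) simplicial complex $K$ on a finite vertex set $V$ is a collection of subsets of $V$ closed under inclusion. An element of cardinality $i+1$ is an $i$-face; the dimension of $K$ is the maximum dimension of its faces. $S_i(K)$ is the set of $i$-faces and $f_i(K)=|S_i(K)|$, with $S_{-1}(K)=\{\emptyset\}$ and $f_{-1}(K)=1$. Fix a linear order on $V$ and orient every face by the increasing order of its vertices. The $i$-th boundary map $\partial_i:C_i(K;\mathbb R)\to C_{i-1}(K;\mathbb R)$ between real chain spaces (with bases the oriented faces) is $\partial_i[v_0,\dots,v_i]=\sum_{j=0}^i(-1)^j[v_0,\dots,\widehat{v_j},\dots,v_i]$, and $B_i(K)\in\mathbb R^{f_{i-1}(K)\times f_i(K)}$ is its matrix. The $i$-dimensional up-Laplacian is $L_i^{\mathrm{up}}(K)=B_{i+1}(K)B_{i+1}(K)^\top$. $\lambda_{i,1}(K)\ge\lambda_{i,2}(K)\ge\cdots\ge\lambda_{i,f_i(K)}(K)$ denote its eigenvalues with multiplicity, and $\lambda_{i,j}(K)=0$ for $j>f_i(K)$. *)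

theory Defs
  imports Complex_Main "HOL-Computational_Algebra.Polynomial" "Jordan_Normal_Form.Char_Poly"
begin

text \<open>Abstract complexes in the convention where the empty set is always a face, so that
  there is exactly one face of dimension \<open>-1\<close>. For \<open>v \<in> V\<close>, \<open>{v}\<close> need not be a face.\<close>

definition abstract_simplicial_complex :: "'a set \<Rightarrow> 'a set set \<Rightarrow> bool" where
  "abstract_simplicial_complex V K \<longleftrightarrow>
     finite V \<and> K \<subseteq> Pow V \<and> {} \<in> K \<and> (\<forall>\<sigma>\<in>K. \<forall>\<tau>. \<tau> \<subseteq> \<sigma> \<longrightarrow> \<tau> \<in> K)"

text \<open>Dimensions are integers, as the values \<open>-1\<close> and \<open>r - 2\<close> occur.\<close>

definition complex_dim :: "'a set set \<Rightarrow> int" where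
  "complex_dim K = Max ((\<lambda>\<sigma>. int (card \<sigma>) - 1) ` K)"

definition faces :: "int \<Rightarrow> 'a set set \<Rightarrow> 'a set set" where
  "faces i K = {\<sigma> \<in> K. int (card \<sigma>) = i + 1}"

definition num_faces :: "int \<Rightarrow> 'a set set \<Rightarrow> nat" where
  "num_faces i K = card (faces i K)"

text \<open>The coefficient of \<open>\<tau>\<close> in the boundary of \<open>\<sigma>\<close>, both oriented by the increasing order of
  their vertices; \<open>sorted_list_of_set \<sigma> ! j\<close> is the vertex \<open>v\<^sub>j\<close> of \<open>\<sigma> = [v\<^sub>0, \<dots>, v\<^sub>i]\<close>.\<close>

definition boundary_coeff :: "'a::linorder set \<Rightarrow> 'a set \<Rightarrow> real" where
  "boundary_coeff \<sigma> \<tau> =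
     (\<Sum>j<card \<sigma>. (-1) ^ j * of_bool (\<tau> = \<sigma> - {sorted_list_of_set \<sigma> ! j}))"

text \<open>An enumeration of the \<open>i\<close>-faces, used to index rows and columns. The choice is immaterial:
  another one conjugates the Laplacian by a permutation matrix.\<close>

definition face_list :: "int \<Rightarrow> 'a set set \<Rightarrow> 'a set list" where
  "face_list i K = (SOME xs. distinct xs \<and> set xs = faces i K)"

definition boundary_matrix :: "int \<Rightarrow> 'a::linorder set set \<Rightarrow> real mat" where
  "boundary_matrix i K =
     mat (num_faces (i - 1) K) (num_faces i K)
       (\<lambda>(a, b). boundary_coeff (face_list i K ! b) (face_list (i - 1) K ! a))"

definition up_laplacian :: "int \<Rightarrow> 'a::linorder set set \<Rightarrow> real mat" where
  "up_laplacian i K = boundary_matrix (i + 1) K * transpose_mat (boundary_matrix (i + 1) K)"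

text \<open>Real eigenvalues with algebraic multiplicity, in decreasing order. For symmetric matrices,
  such as the up-Laplacians, the characteristic polynomial splits over the reals, so the list
  has full length.\<close>

definition eigenvalues_desc :: "real mat \<Rightarrow> real list" where
  "eigenvalues_desc A = rev (sorted_list_of_multiset (proots (char_poly A)))"

text \<open>\<open>up_eigenvalue i j K\<close> is \<open>\<lambda>\<^sub>i\<^sub>,\<^sub>j(K)\<close>. The index \<open>j\<close> starts at \<open>1\<close>.\<close>

definition up_eigenvalue :: "int \<Rightarrow> nat \<Rightarrow> 'a::linorder set set \<Rightarrow> real" where
  "up_eigenvalue i j K =
     (if 1 \<le> j \<and> j \<le> num_faces i K then eigenvalues_desc (up_laplacian i K) ! (j - 1) else 0)"

end

theory Submission
  imports Defs "Jordan_Normal_Form.Spectral_Radius"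
begin

text \<open>For \<open>r = 1\<close> this is Brouwer's conjecture on graph Laplacians. Let \<open>u\<^sub>1, \<dots>, u\<^sub>k\<close> be orthonormal
  eigenvectors for positive eigenvalues, and map the vertex \<open>i\<close> to \<open>p\<^sub>i = (u\<^sub>1(i), \<dots>, u\<^sub>k(i))\<close>. Let \<open>r\<^sub>i\<close>
  be the gradient with respect to \<open>p\<^sub>i\<close> of the logarithm of the volume of the convex hull. Invariance of the
  volume under translations and its behaviour under linear maps give \<open>\<Sum>\<^sub>i r\<^sub>i = 0\<close> and
  \<open>\<Sum>\<^sub>i r\<^sub>i \<otimes> p\<^sub>i = 1\<close>, and \<open>W\<^sub>i\<^sub>j = \<langle>r\<^sub>i, p\<^sub>i - p\<^sub>j\<rangle>\<close> is the fraction of the volume taken by the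
  pyramids from \<open>p\<^sub>j\<close> over the facets at \<open>p\<^sub>i\<close>, so it is in \<open>[0, 1]\<close>. These identities imply that
  \<open>W\<^sub>i\<^sub>j + W\<^sub>j\<^sub>i\<close> summed over the edges is the sum of the \<open>k\<close> eigenvalues, and that \<open>W\<^sub>i\<^sub>j W\<^sub>j\<^sub>i\<close> summed over
  all pairs is \<open>k (k + 1) / 2\<close>. The claim follows by adding the inequalities \<open>0 \<le> W\<^sub>i\<^sub>j W\<^sub>j\<^sub>i\<close> for the non-edges
  and \<open>0 \<le> (1 - W\<^sub>i\<^sub>j) (1 - W\<^sub>j\<^sub>i)\<close> for the edges. If the \<open>p\<^sub>i\<close> are not in general position, they are
  perturbed.

  For \<open>r \<ge> 2\<close> let \<open>w\<^sub>\<sigma>\<close> be the projection of the normalised boundary of the \<open>r\<close>-face \<open>\<sigma>\<close> to the span of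
  the \<open>l\<close> eigenvectors. Then \<open>\<Sum>\<^sub>\<sigma> (2 |w\<^sub>\<sigma>|\<^sup>2 - 1) \<le> \<Sum>\<^sub>\<sigma> |w\<^sub>\<sigma>|\<^sup>4\<close>, and the right-hand side is the trace of the
  Gram operator of the tensors \<open>w\<^sub>\<sigma> \<otimes> w\<^sub>\<sigma>\<close> in a space of dimension \<open>l (l + 1) / 2\<close>, whose norm is at most the
  largest row sum of the squared inner products of the normalised boundaries.\<close>

subsection \<open>Determinants of lists of vectors\<close>

definition bracket :: "nat \<Rightarrow> (nat \<Rightarrow> real) list \<Rightarrow> real" where
  "bracket d vs = det (mat d d (\<lambda>(i, j). (vs ! i) j))"

lemma bracket_move_front:
  assumes "length (xs @ a # ys) = d"
  shows "bracket d (xs @ a # ys) = (-1) ^ length xs * bracket d (a # xs @ ys)"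
proof -
  let ?A = "mat d d (\<lambda>(i, j). ((xs @ a # ys) ! i) j)"
  have A: "?A \<in> carrier_mat d d" by simp
  have le: "length xs + 1 \<le> d" using assms by simp
  have "det ?A = (-1) ^ (length xs * 1) * det (mat d d (\<lambda>(i, j). ?A $$ (if i < 1 then i + length xs else if i < length xs + 1 then i - 1 else i, j)))"
    by (rule det_swap_initial_rows[OF A le])
  also have "mat d d (\<lambda>(i, j). ?A $$ (if i < 1 then i + length xs else if i < length xs + 1 then i - 1 else i, j))
      = mat d d (\<lambda>(i, j). ((a # xs @ ys) ! i) j)"
    using assms by (intro eq_matI) (auto simp: nth_append nth_Cons' split: if_splits)
  finally show ?thesis by (simp add: bracket_def)
qed

lemma bracket_repeated:
  assumes "i < d" "j < d" "i \<noteq> j" "vs ! i = vs ! j"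
  shows "bracket d vs = 0"
  unfolding bracket_def
  by (rule det_identical_rows[of _ d i j]) (use assms in \<open>auto intro!: eq_vecI\<close>)

lemma bracket_swap:
  assumes "length ys + 2 = d"
  shows "bracket d (a # b # ys) = - bracket d (b # a # ys)"
  using bracket_move_front[of "[a]" b ys d] assms by simp

lemma bracket_move_second:
  assumes "length xs + length ys + 2 = d"
  shows "bracket d (b # xs @ a # ys) = (-1) ^ length xs * bracket d (b # a # xs @ ys)"
  using bracket_move_front[of "b # xs" a ys d] bracket_swap[of "xs @ ys" d a b] assms by simp

lemma bracket_linear_head:
  assumes "d > 0"
  obtains K where "\<And>v. bracket d (v # vs) = (\<Sum>s<d. v s * K s)"
proof -
  define M where "M v = mat d d (\<lambda>(i, j). ((v # vs) ! i) j)" for v :: "nat \<Rightarrow> real"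
  \<comment> \<open>The head occupies row 0 only, so the minors along that row are independent of
    it; the zero vector stands in for every head.\<close>
  have del: "mat_delete (M v) 0 j = mat_delete (M (\<lambda>_. 0)) 0 j" if "j < d" for v j
    unfolding mat_delete_def M_def using that by (intro eq_matI) auto
  have "bracket d (v # vs) = (\<Sum>s<d. v s * cofactor (M (\<lambda>_. 0)) 0 s)" for v
  proof -
    have "bracket d (v # vs) = (\<Sum>j<d. M v $$ (0, j) * cofactor (M v) 0 j)"
      unfolding bracket_def M_def[symmetric]
      by (rule laplace_expansion_row) (use assms in \<open>auto simp: M_def\<close>)
    also have "\<dots> = (\<Sum>s<d. v s * cofactor (M (\<lambda>_. 0)) 0 s)"
    proof (rule sum.cong[OF refl])
      fix j assume "j \<in> {..<d}"
      then have j: "j < d" by simp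
      have "cofactor (M v) 0 j = cofactor (M (\<lambda>_. 0)) 0 j"
        unfolding cofactor_def del[OF j, of v] ..
      moreover have "M v $$ (0, j) = v j" using j by (simp add: M_def)
      ultimately show "M v $$ (0, j) * cofactor (M v) 0 j = v j * cofactor (M (\<lambda>_. 0)) 0 j"
        by simp
    qed
    finally show ?thesis .
  qed
  then show ?thesis using that by blast
qed

definition list_delete :: "nat \<Rightarrow> 'b list \<Rightarrow> 'b list" where
  "list_delete a xs = take a xs @ drop (Suc a) xs"

text \<open>Bordering the matrix of the \<open>d + 1\<close> vectors with a copy of its column
  \<open>s\<close> gives a singular square matrix; the sum is the Laplace expansion of its
  determinant along the copy.\<close>

lemma bracket_cramer:
  assumes "length vs = Suc d" "s < d"
  shows "(\<Sum>a\<le>d. (-1) ^ a * (vs ! a) s * bracket d (list_delete a vs)) = 0"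
proof -
  define M where "M = mat (Suc d) (Suc d) (\<lambda>(i, j). if j = 0 then (vs ! i) s else (vs ! i) (j - 1))"
  have M: "M \<in> carrier_mat (Suc d) (Suc d)" by (simp add: M_def)
  have "det M = 0"
    by (rule det_identical_columns[OF M, of 0 "Suc s"])
      (use assms in \<open>auto simp: M_def col_def intro!: eq_vecI\<close>)
  moreover have "det M = (\<Sum>i<Suc d. M $$ (i, 0) * cofactor M i 0)"
    by (rule laplace_expansion_column[OF M]) simp
  moreover have "M $$ (i, 0) * cofactor M i 0 = (-1) ^ i * (vs ! i) s * bracket d (list_delete i vs)"
    if "i < Suc d" for i
  proof -
    have "mat_delete M i 0 = mat d d (\<lambda>(i', j). (list_delete i vs ! i') j)"
      using that assms
      by (intro eq_matI) (auto simp: M_def mat_delete_def list_delete_def nth_append min_def)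
    then show ?thesis using that by (simp add: cofactor_def bracket_def M_def)
  qed
  ultimately show ?thesis by (simp add: lessThan_Suc_atMost[symmetric])
qed

text \<open>The linear functional \<open>v \<mapsto> bracket d (v # us)\<close> is applied to the
  vector relation \<open>bracket_cramer\<close>.\<close>

lemma bracket_pluecker:
  assumes "length vs = Suc d" "length us = d - 1" "d > 0"
  shows "(\<Sum>a\<le>d. (-1) ^ a * bracket d (vs ! a # us) * bracket d (list_delete a vs)) = 0"
proof -
  obtain K where 1: "\<And>v. bracket d (v # us) = (\<Sum>s<d. v s * K s)"
    using bracket_linear_head[OF assms(3)] by blast
  have "(\<Sum>a\<le>d. (-1) ^ a * bracket d (vs ! a # us) * bracket d (list_delete a vs))
     = (\<Sum>a\<le>d. \<Sum>s<d. K s * ((-1) ^ a * (vs ! a) s * bracket d (list_delete a vs)))"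
    by (simp add: 1 sum_distrib_left sum_distrib_right mult_ac)
  also have "\<dots> = (\<Sum>s<d. K s * (\<Sum>a\<le>d. (-1) ^ a * (vs ! a) s * bracket d (list_delete a vs)))"
    by (subst sum.swap) (simp add: sum_distrib_left)
  also have "\<dots> = 0" using bracket_cramer[OF assms(1)] by simp
  finally show ?thesis .
qed

subsection \<open>Convex hulls of points in general position\<close>

text \<open>In the next two lemmas \<open>B x y\<close> plays the role of \<open>det (x, y)\<close> for vectors in the plane, and \<open>three\<close> is
  the three-term Pluecker relation. If all vectors lie on one side of the line through one of them, then
  the cone they span has exactly two extreme rays, of opposite orientation.\<close>

lemma planar_extreme:
  fixes B :: "'b \<Rightarrow> 'b \<Rightarrow> real"
  assumes "finite J" "m \<in> J" "J - {m} \<noteq> {}"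
    and anti: "\<And>x y. x \<in> J \<Longrightarrow> y \<in> J \<Longrightarrow> B x y = - B y x"
    and nz: "\<And>x y. x \<in> J \<Longrightarrow> y \<in> J \<Longrightarrow> x \<noteq> y \<Longrightarrow> B x y \<noteq> 0"
    and three: "\<And>x y z w. x \<in> J \<Longrightarrow> y \<in> J \<Longrightarrow> z \<in> J \<Longrightarrow> w \<in> J \<Longrightarrow>
      B x w * B y z - B y w * B x z + B z w * B x y = 0"
    and m: "\<And>j. j \<in> J - {m} \<Longrightarrow> B j m > 0"
  shows "\<exists>a\<in>J - {m}. \<forall>j\<in>J - {a}. B j a < 0"
proof -
  \<comment> \<open>The three-term relation with fourth vector \<open>m\<close> writes
    \<open>B y m * B x z\<close> as a sum of two positive products, so positivity of
    \<open>B\<close> is transitive off \<open>m\<close>.\<close>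
  have tr: "B x z > 0" if "x \<in> J - {m}" "y \<in> J - {m}" "z \<in> J - {m}" "B x y > 0" "B y z > 0" for x y z
  proof -
    have "B y m * B x z = B x m * B y z + B z m * B x y"
      using three[of x y z m] that assms(2) by auto
    moreover have "B x m * B y z > 0" "B z m * B x y > 0" using m that by auto
    ultimately have "B y m * B x z > 0" by simp
    then show ?thesis using m[of y] that by (simp add: zero_less_mult_iff)
  qed
  \<comment> \<open>A finite transitive tournament has a first element.\<close>
  have "\<exists>a\<in>S. \<forall>b\<in>S - {a}. B a b > 0" if "finite S" "S \<noteq> {}" "S \<subseteq> J - {m}" for S
    using that
  proof (induction S rule: finite_ne_induct)
    case (singleton x)
    then show ?case by auto
  next
    case (insert x F)
    then obtain a where a: "a \<in> F" "\<forall>b\<in>F - {a}. B a b > 0" by auto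
    have ax: "a \<noteq> x" "a \<in> J" "x \<in> J" using insert a by auto
    show ?case
    proof (cases "B a x > 0")
      case True
      then show ?thesis using a by (intro bexI[of _ a]) auto
    next
      case False
      then have xa: "B x a > 0" using anti[OF ax(2,3)] nz[OF ax(2,3,1)] by auto
      have "B x b > 0" if "b \<in> F" for b
      proof (cases "b = a")
        case False
        then show ?thesis using tr[of x a b] a xa that insert.prems by auto
      qed (use xa in simp)
      then show ?thesis by (intro bexI[of _ x]) auto
    qed
  qed
  from this[of "J - {m}"] assms(1,3) obtain a where a: "a \<in> J - {m}" "\<forall>b\<in>J - {m} - {a}. B a b > 0"
    by auto
  have "B j a < 0" if "j \<in> J - {a}" for j
  proof (cases "j = m")
    case True
    then show ?thesis using m[of a] a anti[of a m] assms(2) by auto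
  next
    case False
    then show ?thesis using a that anti[of j a] by auto
  qed
  then show ?thesis using a by blast
qed

lemma planar_balance:
  fixes B :: "'b \<Rightarrow> 'b \<Rightarrow> real"
  assumes fin: "finite J" and card: "card J \<ge> 2"
    and anti: "\<And>x y. x \<in> J \<Longrightarrow> y \<in> J \<Longrightarrow> B x y = - B y x"
    and nz: "\<And>x y. x \<in> J \<Longrightarrow> y \<in> J \<Longrightarrow> x \<noteq> y \<Longrightarrow> B x y \<noteq> 0"
    and three: "\<And>x y z w. x \<in> J \<Longrightarrow> y \<in> J \<Longrightarrow> z \<in> J \<Longrightarrow> w \<in> J \<Longrightarrow>
      B x w * B y z - B y w * B x z + B z w * B x y = 0"
  shows "(\<Sum>a\<in>J. if \<forall>j\<in>J - {a}. B j a > 0 then 1 else if \<forall>j\<in>J - {a}. B j a < 0 then - 1 else 0 :: real) = 0"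
proof -
  define Pos where "Pos = {a \<in> J. \<forall>j\<in>J - {a}. B j a > 0}"
  define Neg where "Neg = {a \<in> J. \<forall>j\<in>J - {a}. B j a < 0}"
  have ne: "J - {a} \<noteq> {}" for a
  proof
    assume "J - {a} = {}"
    then have "J \<subseteq> {a}" by auto
    then have "card J \<le> 1" using card_mono[of "{a}" J] by simp
    then show False using card by simp
  qed
  have disj: "a \<notin> Neg" if "a \<in> Pos" for a
  proof -
    obtain j where "j \<in> J - {a}" using ne[of a] by blast
    then show ?thesis using that unfolding Pos_def Neg_def by force
  qed
  have PN: "Neg \<noteq> {}" if "Pos \<noteq> {}"
  proof -
    from that obtain m where "m \<in> Pos" by blast
    then have "\<exists>a\<in>J - {m}. \<forall>j\<in>J - {a}. B j a < 0"
      by (intro planar_extreme fin ne anti nz three) (auto simp: Pos_def)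
    then show ?thesis unfolding Neg_def by blast
  qed
  \<comment> \<open>Replacing \<open>B\<close> by its negative preserves the hypotheses and
    exchanges \<open>Pos\<close> and \<open>Neg\<close>.\<close>
  have NP: "Pos \<noteq> {}" if "Neg \<noteq> {}"
  proof -
    from that obtain m where m: "m \<in> Neg" by blast
    have "\<exists>a\<in>J - {m}. \<forall>j\<in>J - {a}. - B j a < 0"
    proof (rule planar_extreme[where B = "\<lambda>x y. - B x y"])
      show "- B x y = - (- B y x)" if "x \<in> J" "y \<in> J" for x y
        using anti[OF that] by linarith
      show "(- B x w) * (- B y z) - (- B y w) * (- B x z) + (- B z w) * (- B x y) = 0"
        if "x \<in> J" "y \<in> J" "z \<in> J" "w \<in> J" for x y z w
        using three[OF that] by simp
    qed (use m fin ne nz in \<open>auto simp: Neg_def\<close>)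
    then show ?thesis unfolding Pos_def by fastforce
  qed
  \<comment> \<open>Two distinct members would give \<open>B a b\<close> and \<open>B b a\<close>
    the same sign, against antisymmetry. The same holds for \<open>Neg\<close>.\<close>
  have "card Pos \<le> 1"
  proof (rule ccontr)
    assume "\<not> card Pos \<le> 1"
    then obtain a b where "a \<in> Pos" "b \<in> Pos" "a \<noteq> b" by (metis card_le_Suc0_iff_eq card.infinite One_nat_def zero_le)
    then have "a \<in> J" "b \<in> J" "B b a * B a b > 0" unfolding Pos_def by (auto intro: mult_pos_pos mult_neg_neg)
    then show False using anti[of a b] by (auto simp: zero_less_mult_iff)
  qed
  moreover have "card Neg \<le> 1"
  proof (rule ccontr)
    assume "\<not> card Neg \<le> 1"
    then obtain a b where "a \<in> Neg" "b \<in> Neg" "a \<noteq> b" by (metis card_le_Suc0_iff_eq card.infinite One_nat_def zero_le)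
    then have "a \<in> J" "b \<in> J" "B b a * B a b > 0" unfolding Neg_def by (auto intro: mult_pos_pos mult_neg_neg)
    then show False using anti[of a b] by (auto simp: zero_less_mult_iff)
  qed
  moreover have fP: "finite Pos" "finite Neg" using fin by (auto simp: Pos_def Neg_def)
  ultimately have eq: "card Pos = card Neg"
    using PN NP by (metis One_nat_def card_0_eq le_antisym not_less_eq_eq le_zero_eq)
  have "(\<Sum>a\<in>J. if \<forall>j\<in>J - {a}. B j a > 0 then 1 else if \<forall>j\<in>J - {a}. B j a < 0 then - 1 else 0 :: real)
    = (\<Sum>a\<in>J. of_bool (a \<in> Pos) - of_bool (a \<in> Neg))"
    by (rule sum.cong[OF refl]) (use disj in \<open>auto simp: Pos_def Neg_def\<close>)
  also have "\<dots> = real (card (J \<inter> Pos)) - real (card (J \<inter> Neg))"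
    using fin by (simp add: sum_subtractf of_bool_def sum.If_cases Collect_mem_eq)
  also have "J \<inter> Pos = Pos" by (auto simp: Pos_def)
  also have "J \<inter> Neg = Neg" by (auto simp: Neg_def)
  finally show ?thesis using eq by simp
qed

section \<open>Insertion and deletion in lists, and sums over tuples\<close>

definition list_insert :: "nat \<Rightarrow> 'b \<Rightarrow> 'b list \<Rightarrow> 'b list" where
  "list_insert l a ys = take l ys @ a # drop l ys"

lemma length_list_insert [simp]: "length (list_insert l a ys) = Suc (length ys)"
  by (simp add: list_insert_def)

lemma nth_list_insert [simp]: "l \<le> length ys \<Longrightarrow> list_insert l a ys ! l = a"
  by (simp add: list_insert_def nth_append)

lemma list_delete_insert [simp]: "l \<le> length ys \<Longrightarrow> list_delete l (list_insert l a ys) = ys"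
  by (simp add: list_insert_def list_delete_def)

lemma list_insert_delete: "l < length xs \<Longrightarrow> list_insert l (xs ! l) (list_delete l xs) = xs"
  by (simp add: list_insert_def list_delete_def id_take_nth_drop[symmetric])

lemma set_list_insert [simp]: "set (list_insert l a ys) = insert a (set ys)"
  by (simp add: list_insert_def) (metis append_take_drop_id set_append)

lemma distinct_list_insert [simp]: "distinct (list_insert l a ys) \<longleftrightarrow> a \<notin> set ys \<and> distinct ys"
proof -
  have "distinct (us @ a # vs) \<longleftrightarrow> distinct (a # us @ vs)" for us vs by auto
  then have "distinct (list_insert l a ys) \<longleftrightarrow> distinct (a # take l ys @ drop l ys)"
    unfolding list_insert_def .
  then show ?thesis by simp
qed

lemma map_list_delete: "map f (list_delete l xs) = list_delete l (map f xs)"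
  by (simp add: list_delete_def take_map drop_map)

lemma set_list_delete: "set (list_delete l xs) \<subseteq> set xs"
  by (auto simp: list_delete_def dest: in_set_takeD in_set_dropD)

lemma length_list_delete: "l < length xs \<Longrightarrow> length (list_delete l xs) = length xs - 1"
  by (simp add: list_delete_def)

definition tuples :: "nat \<Rightarrow> nat \<Rightarrow> nat list set" where
  "tuples n m = {xs. set xs \<subseteq> {..<n} \<and> length xs = m}"

lemma finite_tuples [simp]: "finite (tuples n m)"
  unfolding tuples_def by (rule finite_lists_length_eq) simp

text \<open>Splitting off the entry at position \<open>l\<close> is a bijection. It is used for
  every \<open>l\<close>, to compare the positions at which a vertex can stand in a facet.\<close>

lemma sum_tuples_insert:
  assumes "l \<le> m"
  shows "(\<Sum>xs\<in>tuples n (Suc m). F xs) = (\<Sum>ys\<in>tuples n m. \<Sum>a<n. F (list_insert l a ys))"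
proof -
  have "(\<Sum>xs\<in>tuples n (Suc m). F xs) = (\<Sum>p\<in>tuples n m \<times> {..<n}. F (list_insert l (snd p) (fst p)))"
  proof (rule sum.reindex_bij_witness[of _ "\<lambda>p. list_insert l (snd p) (fst p)" "\<lambda>xs. (list_delete l xs, xs ! l)"])
    fix xs assume "xs \<in> tuples n (Suc m)"
    then have xs: "set xs \<subseteq> {..<n}" "l < length xs" "length xs = Suc m" using assms by (auto simp: tuples_def)
    then show "list_insert l (snd (list_delete l xs, xs ! l)) (fst (list_delete l xs, xs ! l)) = xs"
      by (simp add: list_insert_delete)
    then show "F (list_insert l (snd (list_delete l xs, xs ! l)) (fst (list_delete l xs, xs ! l))) = F xs" by simp
    show "(list_delete l xs, xs ! l) \<in> tuples n m \<times> {..<n}"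
    proof -
      have "xs ! l \<in> {..<n}" using xs nth_mem by blast
      then show ?thesis using xs set_list_delete[of l xs] by (auto simp: tuples_def length_list_delete)
    qed
  next
    fix p assume "p \<in> tuples n m \<times> {..<n}"
    then show "list_insert l (snd p) (fst p) \<in> tuples n (Suc m)"
      "(list_delete l (list_insert l (snd p) (fst p)), list_insert l (snd p) (fst p) ! l) = p"
      using assms by (auto simp: tuples_def)
  qed
  then show ?thesis by (simp add: sum.cartesian_product split_def)
qed

text \<open>The first two terms of \<open>bracket_cramer\<close> for \<open>w # w' # xs\<close> are
  split off; shifting the index of the others by two preserves their signs.\<close>

lemma bracket_cramer2:
  assumes "length xs = k" "s < Suc k"
  shows "w s * bracket (Suc k) (w' # xs) - w' s * bracket (Suc k) (w # xs)
    + (\<Sum>l<k. (-1) ^ l * (xs ! l) s * bracket (Suc k) (w # w' # list_delete l xs)) = 0"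
proof -
  have "(\<Sum>a\<le>Suc k. (-1) ^ a * ((w # w' # xs) ! a) s * bracket (Suc k) (list_delete a (w # w' # xs))) = 0"
    by (rule bracket_cramer) (use assms in auto)
  then show ?thesis
    unfolding sum.atMost_Suc_shift
    by (cases k) (simp_all add: list_delete_def sum.atMost_Suc_shift lessThan_Suc_atMost del: sum.atMost_Suc)
qed

text \<open>The first \<open>n\<close> vectors are points of a \<open>k\<close>-dimensional space in
  homogeneous coordinates: coordinate 0 is the common height, coordinates 1 to \<open>k\<close> are
  the point. The \<open>k\<close> vectors after them are not points of the hull; they only provide
  the starting hyperplane of \<open>exchange\<close>.\<close>

locale generic_points =
  fixes k n :: nat and X :: "nat \<Rightarrow> nat \<Rightarrow> real" and h :: real
  assumes k: "k \<ge> 1" and kn: "k < n" and h: "h > 0"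
    and height: "\<And>i. i < n \<Longrightarrow> X i 0 = h"
    and generic: "\<And>xs. distinct xs \<Longrightarrow> length xs = Suc k \<Longrightarrow> set xs \<subseteq> {..<n + k} \<Longrightarrow>
      bracket (Suc k) (map X xs) \<noteq> 0"
    and aux: "\<And>j. j < n \<Longrightarrow> bracket (Suc k) (map X (j # [n..<n + k])) > 0"
begin

section \<open>The oriented boundary of the hull\<close>

abbreviation D :: "(nat \<Rightarrow> real) list \<Rightarrow> real" where "D \<equiv> bracket (Suc k)"

text \<open>\<open>side\<close> is the oriented boundary of the convex hull of the points: the list \<open>xs\<close> has coefficient
  \<open>\<plusminus>1\<close> if all other points lie strictly on one side of the hyperplane spanned by \<open>xs\<close>.\<close>

definition side :: "nat list \<Rightarrow> real" where
  "side xs = (if \<not> distinct xs then 0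
     else if \<forall>j\<in>{..<n} - set xs. D (map X (j # xs)) > 0 then 1
     else if \<forall>j\<in>{..<n} - set xs. D (map X (j # xs)) < 0 then - 1 else 0)"

lemma D_repeat: "i < Suc k \<Longrightarrow> j < Suc k \<Longrightarrow> i \<noteq> j \<Longrightarrow> vs ! i = vs ! j \<Longrightarrow> D vs = 0"
  by (rule bracket_repeated)

lemma D_head_repeat:
  assumes "length ys = k" "v \<in> set ys"
  shows "D (v # ys) = 0"
proof -
  from assms obtain i where "i < k" "ys ! i = v" by (auto simp: in_set_conv_nth)
  then show ?thesis using D_repeat[of 0 "Suc i" "v # ys"] by simp
qed

text \<open>In the Pluecker relation of \<open>x # y # z # R\<close> against \<open>w # R\<close>,
  every term that picks a vector of \<open>R\<close> has a repeated vector, so only three terms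
  survive.\<close>

lemma three_term:
  assumes "length R = k - 1"
  shows "D (x # w # R) * D (y # z # R) - D (y # w # R) * D (x # z # R) + D (z # w # R) * D (x # y # R) = 0"
proof -
  let ?vs = "x # y # z # R"
  let ?t = "\<lambda>a. (-1) ^ a * D (?vs ! a # (w # R)) * D (list_delete a ?vs)"
  have len: "length ?vs = Suc (Suc k)" using assms k by simp
  have "(\<Sum>a\<le>Suc k. ?t a) = 0"
    by (rule bracket_pluecker) (use assms k in auto)
  moreover have "(\<Sum>a\<le>Suc k. ?t a) = (\<Sum>a\<in>{0, 1, 2}. ?t a)"
  proof (rule sum.mono_neutral_right)
    show "\<forall>a\<in>{..Suc k} - {0, 1, 2}. ?t a = 0"
    proof
      fix a assume a: "a \<in> {..Suc k} - {0, 1, 2}"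
      then have "a \<ge> 3" by auto
      then have "?vs ! a = R ! (a - 3)" by (simp add: nth_Cons' numeral_3_eq_3)
      moreover have "a - 3 < length R" using a \<open>a \<ge> 3\<close> assms k by auto
      ultimately have "?vs ! a \<in> set (w # R)" by auto
      then show "?t a = 0" using D_head_repeat[of "w # R"] assms k by simp
    qed
  qed (use k in auto)
  ultimately show ?thesis by (simp add: list_delete_def)
qed

lemma D_swap: "length R = k - 1 \<Longrightarrow> D (x # y # R) = - D (y # x # R)"
  using bracket_swap[of R "Suc k" x y] k by simp

text \<open>Modulo the span of \<open>ys\<close> the remaining points are vectors in a plane, and by
  \<open>planar_balance\<close> the ridge \<open>ys\<close> lies on no facet or on two of opposite
  orientation. So \<open>side\<close> is a cycle.\<close>

lemma side_cycle:
  assumes "ys \<in> tuples n (k - 1)"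
  shows "(\<Sum>a<n. side (a # ys)) = 0"
proof (cases "distinct ys")
  case False
  then show ?thesis by (simp add: side_def)
next
  case True
  define J where "J = {..<n} - set ys"
  define B where "B j a = D (map X (j # a # ys))" for j a
  have len: "length ys = k - 1" and sub: "set ys \<subseteq> {..<n}" using assms by (auto simp: tuples_def)
  have cJ: "card J = n - (k - 1)"
    unfolding J_def using sub True len by (simp add: card_Diff_subset distinct_card)
  have "(\<Sum>a<n. side (a # ys)) = (\<Sum>a\<in>J. side (a # ys))"
    by (rule sum.mono_neutral_right) (auto simp: J_def side_def)
  also have "\<dots> = (\<Sum>a\<in>J. if \<forall>j\<in>J - {a}. B j a > 0 then 1 else if \<forall>j\<in>J - {a}. B j a < 0 then - 1 else 0)"
  proof (rule sum.cong[OF refl])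
    fix a assume a: "a \<in> J"
    have "{..<n} - set (a # ys) = J - {a}" by (auto simp: J_def)
    then show "side (a # ys) = (if \<forall>j\<in>J - {a}. B j a > 0 then 1 else if \<forall>j\<in>J - {a}. B j a < 0 then - 1 else 0)"
      unfolding side_def B_def using a True by (auto simp: J_def)
  qed
  also have "\<dots> = 0"
  proof (rule planar_balance)
    show "finite J" "2 \<le> card J" using cJ k kn by (auto simp: J_def)
    show "B x y = - B y x" for x y
      unfolding B_def list.map by (rule D_swap) (simp add: len)
    show "B x w * B y z - B y w * B x z + B z w * B x y = 0" for x y z w
      unfolding B_def using three_term[of "map X ys" "X x" "X w" "X y" "X z"] len by simp
    show "B x y \<noteq> 0" if "x \<in> J" "y \<in> J" "x \<noteq> y" for x y
      unfolding B_def by (rule generic) (use that True len sub k in \<open>auto simp: J_def\<close>)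
  qed
  finally show ?thesis .
qed

lemma D_insert:
  assumes "length ys = k - 1" "l \<le> k - 1"
  shows "D (v # map X (list_insert l a ys)) = (-1) ^ l * D (v # X a # map X ys)"
proof -
  have len: "length (take l (map X ys)) = l" using assms by auto
  have "D (v # take l (map X ys) @ X a # drop l (map X ys))
    = (-1) ^ length (take l (map X ys)) * D (v # X a # take l (map X ys) @ drop l (map X ys))"
    by (rule bracket_move_second) (use assms k in auto)
  moreover have "map X (list_insert l a ys) = take l (map X ys) @ X a # drop l (map X ys)"
    by (simp add: list_insert_def take_map drop_map)
  ultimately show ?thesis unfolding len by (simp only: append_take_drop_id)
qed

text \<open>Each transposition of vertices changes the sign of all the determinants in
  \<open>side\<close>, which exchanges its two tests; so \<open>side\<close> is alternating.\<close>

lemma side_insert: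
  assumes "length ys = k - 1" "l \<le> k - 1"
  shows "side (list_insert l a ys) = (-1) ^ l * side (a # ys)"
proof -
  have 1: "(\<forall>j\<in>S. D (map X (j # list_insert l a ys)) > 0) \<longleftrightarrow> (\<forall>j\<in>S. D (map X (j # a # ys)) > 0)"
    "(\<forall>j\<in>S. D (map X (j # list_insert l a ys)) < 0) \<longleftrightarrow> (\<forall>j\<in>S. D (map X (j # a # ys)) < 0)"
    if "even l" for S
    using that D_insert[OF assms, of _ a] by auto
  have 2: "(\<forall>j\<in>S. D (map X (j # list_insert l a ys)) > 0) \<longleftrightarrow> (\<forall>j\<in>S. D (map X (j # a # ys)) < 0)"
    "(\<forall>j\<in>S. D (map X (j # list_insert l a ys)) < 0) \<longleftrightarrow> (\<forall>j\<in>S. D (map X (j # a # ys)) > 0)"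
    if "odd l" for S
    using that D_insert[OF assms, of _ a] by auto
  \<comment> \<open>\<open>side\<close> tries the positive test first, so exchanging the tests
    negates it only if they cannot both hold. For that some point must lie off the facet, which
    \<open>k < n\<close> ensures.\<close>
  have no: "\<not> ((\<forall>j\<in>S. P j > (0::real)) \<and> (\<forall>j\<in>S. P j < 0))" if "S \<noteq> {}" for S :: "nat set" and P
    using that by fastforce
  have ne: "{..<n} - insert a (set ys) \<noteq> {}" 
  proof
    assume "{..<n} - insert a (set ys) = {}"
    then have "card {..<n} \<le> card (insert a (set ys))" by (intro card_mono) auto
    also have "\<dots> \<le> Suc (length ys)" using card_length[of "a # ys"] by simp
    finally show False using assms kn k by simp
  qed
  show ?thesis
  proof (cases "even l")
    case True
    then show ?thesis unfolding side_def using 1[OF True] by simp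
  next
    case False
    then show ?thesis unfolding side_def using 2[OF False] no[OF ne, of "\<lambda>j. D (map X (j # a # ys))"] by auto
  qed
qed

lemma side_insert_Suc:
  assumes "length zs = k - 2" "l \<le> k - 2" "k \<ge> 2"
  shows "side (i # list_insert l b zs) = (-1) ^ Suc l * side (b # i # zs)"
proof -
  have "i # list_insert l b zs = list_insert (Suc l) b (i # zs)" by (simp add: list_insert_def)
  then show ?thesis using side_insert[of "i # zs" "Suc l" b] assms by simp
qed

text \<open>A facet carries the common sign of \<open>D\<close> at the points off it, and
  \<open>D\<close> vanishes at its own vertices.\<close>

lemma side_nonneg:
  assumes "xs \<in> tuples n k" "j < n"
  shows "side xs * D (map X (j # xs)) \<ge> 0"
proof (cases "j \<in> set xs")
  case True
  then have "D (X j # map X xs) = 0"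
    using D_head_repeat[of "map X xs" "X j"] assms by (auto simp: tuples_def)
  then show ?thesis by simp
next
  case False
  then have "j \<in> {..<n} - set xs" using assms by auto
  then show ?thesis unfolding side_def by (auto intro: less_imp_le)
qed

text \<open>Up to a constant, \<open>hull_form (X j)\<close> is the volume of the convex hull, decomposed into the pyramids
  from \<open>X j\<close> over the facets, and \<open>star_form i (X j)\<close> is the part contributed by the facets containing \<open>X i\<close>.\<close>

definition hull_form :: "(nat \<Rightarrow> real) \<Rightarrow> real" where
  "hull_form w = (\<Sum>xs\<in>tuples n k. side xs * D (w # map X xs))"

text \<open>The facets at vertex \<open>i\<close> with that vertex removed, as an alternating form
  in two free vectors; \<open>star_form\<close> puts the vertex back into the second slot.\<close>

definition link_form :: "nat \<Rightarrow> (nat \<Rightarrow> real) \<Rightarrow> (nat \<Rightarrow> real) \<Rightarrow> real" where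
  "link_form i w y = (\<Sum>ys\<in>tuples n (k - 1). side (i # ys) * D (w # y # map X ys))"

definition star_form :: "nat \<Rightarrow> (nat \<Rightarrow> real) \<Rightarrow> real" where
  "star_form i z = link_form i z (X i)"

text \<open>As \<open>side\<close> is alternating, bringing the entry at position \<open>l\<close>
  to the front costs exactly the sign on the left. The right-hand side no longer depends on
  \<open>l\<close>, which is the source of the factor \<open>k\<close> in
  \<open>hull_form_cramer\<close>.\<close>

lemma sum_side_insert:
  assumes "l < k"
  shows "(\<Sum>xs\<in>tuples n k. side xs * (-1) ^ l * G (xs ! l) (list_delete l xs))
    = (\<Sum>i<n. \<Sum>ys\<in>tuples n (k - 1). side (i # ys) * G i ys)"
proof -
  have "(\<Sum>xs\<in>tuples n (Suc (k - 1)). side xs * (-1) ^ l * G (xs ! l) (list_delete l xs))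
    = (\<Sum>ys\<in>tuples n (k - 1). \<Sum>i<n. side (list_insert l i ys) * (-1) ^ l
        * G (list_insert l i ys ! l) (list_delete l (list_insert l i ys)))"
    by (rule sum_tuples_insert) (use assms in simp)
  also have "\<dots> = (\<Sum>ys\<in>tuples n (k - 1). \<Sum>i<n. side (i # ys) * G i ys)"
  proof (intro sum.cong refl)
    fix ys i assume "ys \<in> tuples n (k - 1)"
    then have len: "length ys = k - 1" by (simp add: tuples_def)
    then show "side (list_insert l i ys) * (-1) ^ l * G (list_insert l i ys ! l) (list_delete l (list_insert l i ys))
        = side (i # ys) * G i ys"
      using assms side_insert[OF len, of l i] by (simp add: power_mult_distrib[symmetric] mult.assoc mult.left_commute[of "(-1) ^ l"])
  qed
  finally show ?thesis using k by (simp add: sum.swap[of _ "{..<n}"])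
qed

section \<open>Identities for the volume and its pieces\<close>

lemma nth_height:
  assumes "xs \<in> tuples n m" "l < m"
  shows "X (xs ! l) 0 = h"
proof (rule height)
  have "xs ! l \<in> {..<n}" using assms nth_mem[of l xs] unfolding tuples_def by blast
  then show "xs ! l < n" by simp
qed

text \<open>The relation \<open>bracket_cramer2\<close> for \<open>w\<close>, \<open>y\<close> and a
  facet is weighted by \<open>side\<close> and summed over all facets.\<close>

lemma hull_form_cramer:
  assumes "s < Suc k"
  shows "w s * hull_form y - y s * hull_form w + real k * (\<Sum>i<n. X i s * link_form i w y) = 0"
proof -
  let ?R = "\<lambda>xs. \<Sum>l<k. (-1) ^ l * X (xs ! l) s * D (w # y # map X (list_delete l xs))"
  have "0 = (\<Sum>xs\<in>tuples n k. side xs * (w s * D (y # map X xs) - y s * D (w # map X xs) + ?R xs))"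
  proof (rule sum.neutral[symmetric], rule ballI)
    fix xs assume "xs \<in> tuples n k"
    then have len: "length xs = k" by (simp add: tuples_def)
    have "w s * D (y # map X xs) - y s * D (w # map X xs) + ?R xs = 0"
      using bracket_cramer2[of "map X xs" k s w y] assms len by (simp add: map_list_delete)
    then show "side xs * (w s * D (y # map X xs) - y s * D (w # map X xs) + ?R xs) = 0" by simp
  qed
  also have "\<dots> = w s * hull_form y - y s * hull_form w + (\<Sum>xs\<in>tuples n k. side xs * ?R xs)"
    unfolding hull_form_def by (simp add: algebra_simps sum.distrib sum_subtractf sum_distrib_left)
  also have "(\<Sum>xs\<in>tuples n k. side xs * ?R xs)
    = (\<Sum>l<k. \<Sum>xs\<in>tuples n k. side xs * (-1) ^ l * (X (xs ! l) s * D (w # y # map X (list_delete l xs))))"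
    unfolding sum_distrib_left by (subst sum.swap) (simp add: mult_ac)
  also have "\<dots> = (\<Sum>l<k. \<Sum>i<n. \<Sum>ys\<in>tuples n (k - 1). side (i # ys) * (X i s * D (w # y # map X ys)))"
    by (rule sum.cong[OF refl], rule sum_side_insert) simp
  also have "\<dots> = real k * (\<Sum>i<n. X i s * link_form i w y)"
    by (simp add: link_form_def sum_distrib_left mult_ac)
  finally show ?thesis by simp
qed

lemma sum_link_form: "(\<Sum>i<n. link_form i w y) = 0"
proof -
  have "(\<Sum>i<n. link_form i w y) = (\<Sum>ys\<in>tuples n (k - 1). (\<Sum>i<n. side (i # ys)) * D (w # y # map X ys))"
    unfolding link_form_def by (subst sum.swap) (simp add: sum_distrib_right)
  then show ?thesis using side_cycle by simp
qed

text \<open>In coordinate 0 all points have the entry \<open>h\<close>, so the last sum of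
  \<open>hull_form_cramer\<close> is a multiple of \<open>sum_link_form\<close> and vanishes. For
  vectors of equal height this says that the volume does not depend on the apex of the pyramids; for
  a direction, of height 0, the form vanishes.\<close>

lemma hull_form_shift: "w 0 * hull_form y = y 0 * hull_form w"
proof -
  have "(\<Sum>i<n. X i 0 * link_form i w y) = h * (\<Sum>i<n. link_form i w y)"
    by (simp add: height sum_distrib_left)
  then show ?thesis using hull_form_cramer[of 0 w y] sum_link_form by simp
qed

text \<open>The link of a vertex is a cycle too, so the argument of \<open>hull_form_shift\<close>
  applies to it once the second slot holds a direction.\<close>

lemma link_form_shift:
  assumes i: "i < n" and y: "y 0 = 0"
  shows "w 0 * link_form i w' y = w' 0 * link_form i w y"
proof -
  let ?R = "\<lambda>ys. \<Sum>l<k - 1. (-1) ^ Suc l * X (ys ! l) 0 * D (w # w' # y # map X (list_delete l ys))"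
  \<comment> \<open>The determinant does not see the deleted entry, so summing over that entry alone
    gives zero by \<open>side_cycle\<close>.\<close>
  have z: "(\<Sum>ys\<in>tuples n (k - 1). side (i # ys) * (-1) ^ Suc l * D (w # w' # y # map X (list_delete l ys))) = 0"
    if l: "l < k - 1" for l
  proof -
    have "k \<ge> 2" using l by simp
    have "(\<Sum>ys\<in>tuples n (Suc (k - 2)). side (i # ys) * (-1) ^ Suc l * D (w # w' # y # map X (list_delete l ys)))
      = (\<Sum>zs\<in>tuples n (k - 2). \<Sum>b<n. side (i # list_insert l b zs) * (-1) ^ Suc l
          * D (w # w' # y # map X (list_delete l (list_insert l b zs))))"
      by (rule sum_tuples_insert) (use l in simp)
    also have "\<dots> = (\<Sum>zs\<in>tuples n (k - 2). (\<Sum>b<n. side (b # i # zs)) * D (w # w' # y # map X zs))"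
    proof (rule sum.cong[OF refl])
      fix zs assume "zs \<in> tuples n (k - 2)"
      then have len: "length zs = k - 2" by (simp add: tuples_def)
      have "side (i # list_insert l b zs) * (-1) ^ Suc l = side (b # i # zs)" for b
        using side_insert_Suc[OF len, of l i b] l \<open>k \<ge> 2\<close> by (simp add: power_mult_distrib[symmetric])
      then show "(\<Sum>b<n. side (i # list_insert l b zs) * (-1) ^ Suc l * D (w # w' # y # map X (list_delete l (list_insert l b zs))))
        = (\<Sum>b<n. side (b # i # zs)) * D (w # w' # y # map X zs)"
        using len l by (simp only: sum_distrib_right list_delete_insert)
    qed
    also have "\<dots> = 0"
    proof (rule sum.neutral, rule ballI)
      fix zs assume "zs \<in> tuples n (k - 2)"
      then have "i # zs \<in> tuples n (k - 1)" using i \<open>k \<ge> 2\<close> by (auto simp: tuples_def)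
      then show "(\<Sum>b<n. side (b # i # zs)) * D (w # w' # y # map X zs) = 0" using side_cycle by simp
    qed
    also have "Suc (k - 2) = k - 1" using \<open>k \<ge> 2\<close> by simp
    finally show ?thesis .
  qed
  have "0 = (\<Sum>ys\<in>tuples n (k - 1). side (i # ys) * (w 0 * D (w' # y # map X ys) - w' 0 * D (w # y # map X ys) + ?R ys))"
  proof (rule sum.neutral[symmetric], rule ballI)
    fix ys assume "ys \<in> tuples n (k - 1)"
    then have len: "length ys = k - 1" by (simp add: tuples_def)
    \<comment> \<open>The term of index 0 belongs to \<open>y\<close> and drops out because
      \<open>y 0 = 0\<close>.\<close>
    have "(\<Sum>l<Suc (k - 1). (-1) ^ l * ((y # map X ys) ! l) 0 * D (w # w' # list_delete l (y # map X ys))) = ?R ys"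
      unfolding sum.lessThan_Suc_shift using len y by (simp add: list_delete_def take_map drop_map)
    then have "w 0 * D (w' # y # map X ys) - w' 0 * D (w # y # map X ys) + ?R ys = 0"
      using bracket_cramer2[of "y # map X ys" k 0 w w'] len k by simp
    then show "side (i # ys) * (w 0 * D (w' # y # map X ys) - w' 0 * D (w # y # map X ys) + ?R ys) = 0" by simp
  qed
  also have "\<dots> = w 0 * link_form i w' y - w' 0 * link_form i w y + (\<Sum>ys\<in>tuples n (k - 1). side (i # ys) * ?R ys)"
    unfolding link_form_def by (simp add: algebra_simps sum.distrib sum_subtractf sum_distrib_left)
  also have "(\<Sum>ys\<in>tuples n (k - 1). side (i # ys) * ?R ys)
    = (\<Sum>l<k - 1. h * (\<Sum>ys\<in>tuples n (k - 1). side (i # ys) * (-1) ^ Suc l * D (w # w' # y # map X (list_delete l ys))))"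
    unfolding sum_distrib_left
    by (subst sum.swap, intro sum.cong refl) (auto simp: nth_height)
  also have "\<dots> = 0" using z by simp
  finally show ?thesis by simp
qed

lemma link_form_self: "link_form i (X i) y = - star_form i y"
proof -
  have "side (i # ys) * D (X i # y # map X ys) = - (side (i # ys) * D (y # X i # map X ys))"
    if "ys \<in> tuples n (k - 1)" for ys
    using D_swap[of "map X ys" "X i" y] that by (simp add: tuples_def)
  then show ?thesis unfolding star_form_def link_form_def by (simp add: sum_negf[symmetric])
qed

lemma star_form_self: "star_form i (X i) = 0"
  using link_form_self[of i "X i"] by (simp add: star_form_def)

text \<open>For a direction \<open>y\<close> the term \<open>hull_form y\<close> of
  \<open>hull_form_cramer\<close> vanishes, and by \<open>link_form_shift\<close> each link form may
  be evaluated at its own vertex. After normalisation this becomes the duality between points and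
  gradients.\<close>

lemma hull_form_star_form:
  assumes "y 0 = 0" "j < n" "s < Suc k"
  shows "y s * hull_form (X j) = - real k * (\<Sum>i<n. X i s * star_form i y)"
proof -
  have "h * hull_form y = 0" using hull_form_shift[of "X j" y] assms by (simp add: height)
  then have "hull_form y = 0" using h by simp
  moreover have "link_form i (X j) y = - star_form i y" if "i < n" for i
  proof -
    have "h * link_form i (X j) y = h * link_form i (X i) y"
      using link_form_shift[of i y "X i" "X j"] that assms by (simp add: height)
    then have "h * link_form i (X j) y = h * (- star_form i y)" unfolding link_form_self .
    then show ?thesis by (metis h less_irrefl mult_cancel_left)
  qed
  ultimately show ?thesis using hull_form_cramer[OF assms(3), of "X j" y] by (simp add: sum_negf)
qed

lemma star_form_nonneg:
  assumes "i < n" "j < n"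
  shows "star_form i (X j) \<ge> 0"
  unfolding star_form_def link_form_def
proof (rule sum_nonneg)
  fix ys assume "ys \<in> tuples n (k - 1)"
  then have "i # ys \<in> tuples n k" using assms k by (auto simp: tuples_def)
  then show "side (i # ys) * D (X j # X i # map X ys) \<ge> 0" using side_nonneg[of "i # ys" j] assms by simp
qed

text \<open>By \<open>S\<close>, the left-hand side counts the facets having \<open>i\<close> at
  position \<open>l\<close>, for each of the \<open>k\<close> positions. A list without repetitions
  has \<open>i\<close> at most once, and all terms are nonnegative.\<close>

lemma star_form_le_hull_form:
  assumes "i < n" "j < n"
  shows "real k * star_form i (X j) \<le> hull_form (X j)"
proof -
  let ?F = "\<lambda>xs. side xs * D (map X (j # xs))"
  have S: "star_form i (X j) = (\<Sum>xs\<in>tuples n k. of_bool (xs ! l = i) * ?F xs)" if l: "l < k" for l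
  proof -
    have "(\<Sum>xs\<in>tuples n (Suc (k - 1)). of_bool (xs ! l = i) * ?F xs)
      = (\<Sum>ys\<in>tuples n (k - 1). \<Sum>a<n. of_bool (list_insert l a ys ! l = i) * ?F (list_insert l a ys))"
      by (rule sum_tuples_insert) (use l in simp)
    also have "\<dots> = (\<Sum>ys\<in>tuples n (k - 1). ?F (i # ys))"
    proof (rule sum.cong[OF refl])
      fix ys assume "ys \<in> tuples n (k - 1)"
      then have len: "length ys = k - 1" by (simp add: tuples_def)
      have F: "?F (list_insert l i ys) = ?F (i # ys)"
        using side_insert[OF len, of l i] D_insert[OF len, of l "X j" i] l
        by (simp add: power_mult_distrib[symmetric])
      have "(\<Sum>a<n. of_bool (list_insert l a ys ! l = i) * ?F (list_insert l a ys))
        = (\<Sum>a<n. if a = i then ?F (list_insert l a ys) else 0)"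
        by (rule sum.cong) (use len l in auto)
      then show "(\<Sum>a<n. of_bool (list_insert l a ys ! l = i) * ?F (list_insert l a ys)) = ?F (i # ys)"
        using assms F by simp
    qed
    finally show ?thesis using k by (simp add: star_form_def link_form_def)
  qed
  have "real k * star_form i (X j) = (\<Sum>l<k. star_form i (X j))" by simp
  also have "\<dots> = (\<Sum>l<k. \<Sum>xs\<in>tuples n k. of_bool (xs ! l = i) * ?F xs)"
    by (rule sum.cong[OF refl], rule S) simp
  also have "\<dots> = (\<Sum>xs\<in>tuples n k. (\<Sum>l<k. of_bool (xs ! l = i)) * ?F xs)"
    by (subst sum.swap) (simp add: sum_distrib_right)
  also have "\<dots> \<le> (\<Sum>xs\<in>tuples n k. ?F xs)"
  proof (rule sum_mono)
    fix xs assume xs: "xs \<in> tuples n k"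
    then have len: "length xs = k" by (simp add: tuples_def)
    show "(\<Sum>l<k. of_bool (xs ! l = i)) * ?F xs \<le> ?F xs"
    proof (cases "distinct xs")
      case False
      then show ?thesis by (simp add: side_def)
    next
      case True
      have "(\<Sum>l<k. of_bool (xs ! l = i)) = real (card {l. l < k \<and> xs ! l = i})"
        by (simp add: of_bool_def sum.If_cases lessThan_def Collect_conj_eq[symmetric] conj_commute)
      also have "card {l. l < k \<and> xs ! l = i} \<le> 1"
        using True len by (auto simp: card_le_Suc0_iff_eq nth_eq_iff_index_eq)
      finally have "(\<Sum>l<k. of_bool (xs ! l = i)) \<le> (1::real)" by simp
      from mult_right_mono[OF this side_nonneg[OF xs assms(2)]] show ?thesis by (simp only: mult_1)
    qed
  qed
  also have "\<dots> = hull_form (X j)" by (simp add: hull_form_def)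
  finally show ?thesis .
qed

text \<open>Existence of a facet: the auxiliary vectors \<open>X n, \<dots>, X (n + k - 1)\<close> form a facet at infinity, and
  they are exchanged for points one after the other.\<close>

lemma exchange:
  assumes "t \<le> k"
  shows "\<exists>xs \<sigma>. distinct xs \<and> set xs \<subseteq> {..<n} \<and> length xs = t \<and>
    (\<forall>j\<in>{..<n} - set xs. \<sigma> * D (map X (j # xs @ [n + t..<n + k])) > 0)"
  using assms
proof (induction t)
  case 0
  show ?case by (rule exI[of _ "[]"], rule exI[of _ 1]) (use aux in auto)
next
  case (Suc t)
  then obtain xs \<sigma> where xs: "distinct xs" "set xs \<subseteq> {..<n}" "length xs = t"
    and pos: "\<And>j. j \<in> {..<n} - set xs \<Longrightarrow> \<sigma> * D (map X (j # xs @ [n + t..<n + k])) > 0"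
    by auto
  define rest where "rest = [n + Suc t..<n + k]"
  define R where "R = xs @ rest"
  define J where "J = {..<n} - set xs"
  \<comment> \<open>Modulo the span of \<open>R\<close>, which is the current hyperplane without the
    auxiliary vector \<open>X (n + t)\<close>, everything lies in a plane. The power of -1 accounts
    for moving that vector past \<open>xs\<close>, so that the induction hypothesis reads
    \<open>B j (n + t) > 0\<close>.\<close>
  define B where "B x y = \<sigma> * (-1) ^ t * D (map X (x # y # R))" for x y
  have upt: "[n + t..<n + k] = (n + t) # rest"
    unfolding rest_def using Suc.prems by (simp add: upt_conv_Cons)
  have lenR: "length R = k - 1" using xs Suc.prems by (simp add: R_def rest_def)
  have "card J = n - t" unfolding J_def using xs by (simp add: card_Diff_subset distinct_card)
  then have "card J > 0" using Suc.prems kn by simp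
  then have J: "J \<noteq> {}" "finite J" by (simp_all add: card_gt_0_iff)
  have \<sigma>: "\<sigma> \<noteq> 0" using pos J unfolding J_def by fastforce
  have "\<exists>a\<in>insert (n + t) J - {n + t}. \<forall>j\<in>insert (n + t) J - {a}. B j a < 0"
  proof (rule planar_extreme)
    show "insert (n + t) J - {n + t} \<noteq> {}" using J by (auto simp: J_def)
    show "B x y = - B y x" for x y
      using D_swap[of "map X R" "X x" "X y"] lenR unfolding B_def by simp
    show "B x w * B y z - B y w * B x z + B z w * B x y = 0" for x y z w
    proof -
      have "B x w * B y z - B y w * B x z + B z w * B x y = (\<sigma> * (-1) ^ t) ^ 2 *
        (D (X x # X w # map X R) * D (X y # X z # map X R) - D (X y # X w # map X R) * D (X x # X z # map X R)
         + D (X z # X w # map X R) * D (X x # X y # map X R))"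
        unfolding B_def by (simp add: algebra_simps power2_eq_square)
      then show ?thesis using three_term[of "map X R" "X x" "X w" "X y" "X z"] lenR by simp
    qed
    show "B x y \<noteq> 0" if "x \<in> insert (n + t) J" "y \<in> insert (n + t) J" "x \<noteq> y" for x y
    proof -
      have "D (map X (x # y # R)) \<noteq> 0"
        by (rule generic) (use that lenR k kn xs Suc.prems in \<open>auto simp: J_def R_def rest_def\<close>)
      then show ?thesis using \<sigma> by (simp add: B_def)
    qed
    show "B j (n + t) > 0" if "j \<in> insert (n + t) J - {n + t}" for j
    proof -
      have "D (X j # map X xs @ X (n + t) # map X rest)
        = (-1) ^ length (map X xs) * D (X j # X (n + t) # map X xs @ map X rest)"
        by (rule bracket_move_second) (use xs lenR k in \<open>auto simp: R_def\<close>)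
      then show ?thesis using pos[of j] that xs unfolding upt B_def J_def R_def by (auto simp: mult.assoc)
    qed
  qed (use J in auto)
  \<comment> \<open>The other extreme ray replaces the auxiliary vector. All remaining points are on
    its negative side, hence the additional minus in the new sign below.\<close>
  then obtain a where a: "a \<in> J" and neg: "\<And>j. j \<in> J - {a} \<Longrightarrow> B j a < 0" by auto
  show ?case
  proof (intro exI conjI ballI)
    show "distinct (a # xs)" "set (a # xs) \<subseteq> {..<n}" "length (a # xs) = Suc t"
      using a xs by (auto simp: J_def)
    fix j assume "j \<in> {..<n} - set (a # xs)"
    then have "B j a < 0" by (intro neg) (auto simp: J_def)
    then show "(- (\<sigma> * (-1) ^ t)) * D (map X (j # (a # xs) @ [n + Suc t..<n + k])) > 0"
      by (simp add: B_def R_def rest_def)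
  qed
qed

text \<open>The facet from \<open>exchange\<close> contributes a positive term at a point
  \<open>X i\<close> off it, and no term is negative. The facet may contain \<open>X j\<close>, so
  the result is carried over by \<open>hull_form_shift\<close>.\<close>

lemma hull_form_pos:
  assumes "j < n"
  shows "hull_form (X j) > 0"
proof -
  obtain xs \<sigma> where xs: "distinct xs" "set xs \<subseteq> {..<n}" "length xs = k"
    and pos: "\<And>j. j \<in> {..<n} - set xs \<Longrightarrow> \<sigma> * D (map X (j # xs)) > 0"
    using exchange[of k] by auto
  have "card ({..<n} - set xs) = n - k" using xs by (simp add: card_Diff_subset distinct_card)
  then have "card ({..<n} - set xs) > 0" using kn by simp
  then have "{..<n} - set xs \<noteq> {}" by (rule card_gt_0_iff[THEN iffD1, THEN conjunct1])
  then obtain i where i: "i \<in> {..<n} - set xs" by blast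
  have "side xs * D (map X (i # xs)) > 0"
  proof (cases "\<sigma> > 0")
    case True
    then have "\<forall>j\<in>{..<n} - set xs. D (map X (j # xs)) > 0" using pos by (auto simp: zero_less_mult_iff)
    then show ?thesis using xs i by (simp add: side_def)
  next
    case False
    then have neg: "\<forall>j\<in>{..<n} - set xs. D (map X (j # xs)) < 0"
      using pos by (fastforce simp: zero_less_mult_iff)
    then have "D (map X (i # xs)) < 0" using i by blast
    then have "\<not> (\<forall>j\<in>{..<n} - set xs. D (map X (j # xs)) > 0)" using i less_asym by blast
    then have "side xs = -1" unfolding side_def using xs neg by simp
    then show ?thesis using neg i by simp
  qed
  also have "side xs * D (map X (i # xs)) \<le> hull_form (X i)"
    unfolding hull_form_def
  proof -
    have "(\<lambda>xs. side xs * D (X i # map X xs)) xs \<le> (\<Sum>xs\<in>tuples n k. side xs * D (X i # map X xs))"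
    proof (rule member_le_sum)
      show "0 \<le> side ys * D (X i # map X ys)" if "ys \<in> tuples n k - {xs}" for ys
        using side_nonneg[of ys i] that i by simp
    qed (use xs in \<open>simp_all add: tuples_def finite_lists_length_eq\<close>)
    then show "side xs * D (map X (i # xs)) \<le> (\<Sum>xs\<in>tuples n k. side xs * D (X i # map X xs))" by simp
  qed
  also have "hull_form (X i) = hull_form (X j)"
    using hull_form_shift[of "X i" "X j"] i assms h by (simp add: height)
  finally show ?thesis .
qed

section \<open>The gradients of the logarithm of the volume\<close>

abbreviation unit_fun :: "nat \<Rightarrow> nat \<Rightarrow> real" where "unit_fun s \<equiv> \<lambda>t. of_bool (t = s)"

lemma D_expand: "D (z # vs) = (\<Sum>s<Suc k. z s * D (unit_fun s # vs))"
proof -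
  obtain K where K: "\<And>v. D (v # vs) = (\<Sum>s<Suc k. v s * K s)"
    using bracket_linear_head[of "Suc k" vs] by blast
  have "D (unit_fun s # vs) = K s" if "s < Suc k" for s
  proof -
    have "D (unit_fun s # vs) = (\<Sum>t<Suc k. if t = s then K t else 0)"
      unfolding K by (rule sum.cong) auto
    then show ?thesis using that by (simp add: sum.delta del: sum.lessThan_Suc)
  qed
  then show ?thesis unfolding K[of z] by simp
qed

lemma star_form_expand: "star_form i z = (\<Sum>s<Suc k. z s * star_form i (unit_fun s))"
proof -
  have "star_form i z = (\<Sum>ys\<in>tuples n (k - 1). \<Sum>s<Suc k. z s * (side (i # ys) * D (unit_fun s # X i # map X ys)))"
    unfolding star_form_def link_form_def by (subst D_expand) (simp add: sum_distrib_left mult_ac del: sum.lessThan_Suc)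
  also have "\<dots> = (\<Sum>s<Suc k. z s * star_form i (unit_fun s))"
    by (subst sum.swap) (simp add: star_form_def link_form_def sum_distrib_left del: sum.lessThan_Suc)
  finally show ?thesis .
qed

text \<open>\<open>r i\<close> is the gradient of the logarithm of the volume of the convex hull with respect to \<open>X i\<close>.
  The last two properties say that the fraction of the volume taken by the pyramids from \<open>X j\<close> over the
  facets at \<open>X i\<close> is in \<open>[0, 1]\<close>.\<close>

lemma dual_vectors:
  obtains r :: "nat \<Rightarrow> nat \<Rightarrow> real" where
    "\<And>s s'. s \<in> {1..k} \<Longrightarrow> s' \<in> {1..k} \<Longrightarrow> (\<Sum>i<n. X i s * r i s') = of_bool (s = s')"
    "\<And>s. s \<in> {1..k} \<Longrightarrow> (\<Sum>i<n. r i s) = 0"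
    "\<And>i j. i < n \<Longrightarrow> j < n \<Longrightarrow> 0 \<le> (\<Sum>s=1..k. r i s * (X i s - X j s))"
    "\<And>i j. i < n \<Longrightarrow> j < n \<Longrightarrow> (\<Sum>s=1..k. r i s * (X i s - X j s)) \<le> 1"
proof -
  define V where "V = hull_form (X 0)"
  have V: "hull_form (X j) = V" if "j < n" for j
    using hull_form_shift[of "X 0" "X j"] that kn h by (simp add: height V_def)
  have Vpos: "V > 0" using hull_form_pos[of 0] kn by (simp add: V_def)
  define r where "r i s = - (real k / V) * star_form i (unit_fun s)" for i s
  \<comment> \<open>The factor in \<open>r\<close> normalises \<open>hull_form_star_form\<close>.
    The case \<open>s = 0\<close> is included because there every point has the entry
    \<open>h\<close>, which makes the sum of the \<open>r i s'\<close> vanish.\<close>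
  have main: "(\<Sum>i<n. X i s * r i s') = of_bool (s = s')" if "s < Suc k" "s' \<in> {1..k}" for s s'
  proof -
    have "of_bool (s = s') * V = - real k * (\<Sum>i<n. X i s * star_form i (unit_fun s'))"
      using hull_form_star_form[of "unit_fun s'" 0 s] that kn V[of 0] by simp
    moreover have "(\<Sum>i<n. X i s * r i s') = (- real k * (\<Sum>i<n. X i s * star_form i (unit_fun s'))) / V"
      unfolding r_def by (simp add: sum_distrib_left sum_divide_distrib sum_negf[symmetric] mult_ac)
    ultimately have "(\<Sum>i<n. X i s * r i s') = of_bool (s = s') * V / V" by (simp only:)
    then show ?thesis using Vpos by simp
  qed
  have W: "(\<Sum>s=1..k. r i s * (X i s - X j s)) = real k * star_form i (X j) / V" if "i < n" "j < n" for i j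
  proof -
    have "star_form i (X j) = star_form i (X j) - star_form i (X i)" by (simp add: star_form_self)
    also have "\<dots> = (\<Sum>s<Suc k. (X j s - X i s) * star_form i (unit_fun s))"
      by (subst (1 2) star_form_expand) (simp add: sum_subtractf algebra_simps del: sum.lessThan_Suc)
    \<comment> \<open>Coordinate 0 drops out because all points have the same height.\<close>
    also have "\<dots> = (\<Sum>s=1..k. (X j s - X i s) * star_form i (unit_fun s))"
      by (rule sum.mono_neutral_right) (use that height in \<open>auto simp: not_less_eq_eq\<close>)
    finally show ?thesis
      by (simp add: r_def sum_distrib_left sum_divide_distrib algebra_simps)
        (simp add: sum_subtractf diff_divide_distrib)
  qed
  show ?thesis
  proof (rule that[of r])
    show "(\<Sum>i<n. X i s * r i s') = of_bool (s = s')" if "s \<in> {1..k}" "s' \<in> {1..k}" for s s'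
      using main[of s s'] that by simp
    show "(\<Sum>i<n. r i s) = 0" if "s \<in> {1..k}" for s
    proof -
      have "h * (\<Sum>i<n. r i s) = (\<Sum>i<n. X i 0 * r i s)" by (simp add: height sum_distrib_left)
      also have "\<dots> = 0" using main[of 0 s] that by simp
      finally show ?thesis using h by simp
    qed
    fix i j assume ij: "i < n" "j < n"
    show "0 \<le> (\<Sum>s=1..k. r i s * (X i s - X j s))"
      unfolding W[OF ij] using star_form_nonneg[OF ij] Vpos by simp
    show "(\<Sum>s=1..k. r i s * (X i s - X j s)) \<le> 1"
      unfolding W[OF ij] using star_form_le_hull_form[OF ij] V[OF ij(2)] Vpos by simp
  qed
qed

end

text \<open>All sums run over ordered pairs, so both terms on the right are twice those of the sum
  over unordered pairs.\<close>

lemma dual_vectors_adjacency: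
  fixes x r :: "nat \<Rightarrow> nat \<Rightarrow> real" and adj :: "nat \<Rightarrow> nat \<Rightarrow> bool"
  assumes dual: "\<And>s s'. s \<in> {1..k} \<Longrightarrow> s' \<in> {1..k} \<Longrightarrow> (\<Sum>i<n. x i s * r i s') = of_bool (s = s')"
    and sum0: "\<And>s. s \<in> {1..k} \<Longrightarrow> (\<Sum>i<n. r i s) = 0"
    and W: "\<And>i j. W i j = (\<Sum>s=1..k. r i s * (x i s - x j s))"
    and W01: "\<And>i j. i < n \<Longrightarrow> j < n \<Longrightarrow> 0 \<le> W i j" "\<And>i j. i < n \<Longrightarrow> j < n \<Longrightarrow> W i j \<le> 1"
    and sym: "\<And>i j. adj i j \<longleftrightarrow> adj j i"
  shows "2 * (\<Sum>i<n. \<Sum>j<n. of_bool (adj i j) * W i j)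
    \<le> (\<Sum>i<n. \<Sum>j<n. of_bool (adj i j)) + real (k * (k + 1))"
proof -
  \<comment> \<open>By \<open>dual\<close>, this matrix is a projection of rank \<open>k\<close>, in
    general not orthogonal. So its trace and the trace of its square are both \<open>k\<close>, and
    \<open>sum0\<close> makes its row sums vanish.\<close>
  define P where "P j i = (\<Sum>s=1..k. r i s * x j s)" for i j
  have WP: "W i j = P i i - P j i" for i j
    unfolding W P_def by (simp add: algebra_simps sum_subtractf)
  have P0: "(\<Sum>i<n. P j i) = 0" for j
    unfolding P_def by (subst sum.swap) (simp add: sum_distrib_right[symmetric] sum0)
  have trP: "(\<Sum>i<n. P i i) = real k"
  proof -
    have "(\<Sum>i<n. P i i) = (\<Sum>s=1..k. \<Sum>i<n. x i s * r i s)"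
      unfolding P_def by (subst sum.swap) (simp add: mult_ac)
    then show ?thesis using dual by simp
  qed
  have PP: "(\<Sum>i<n. \<Sum>j<n. P j i * P i j) = real k"
  proof -
    have "(\<Sum>i<n. \<Sum>j<n. P j i * P i j) = (\<Sum>i<n. \<Sum>j<n. \<Sum>s=1..k. \<Sum>s'=1..k. (x i s' * r i s) * (x j s * r j s'))"
      unfolding P_def by (simp add: sum_product mult_ac)
    also have "\<dots> = (\<Sum>s=1..k. \<Sum>s'=1..k. \<Sum>i<n. \<Sum>j<n. (x i s' * r i s) * (x j s * r j s'))"
      (is "?L = ?R")
    proof -
      have "?L = (\<Sum>i<n. \<Sum>s=1..k. \<Sum>j<n. \<Sum>s'=1..k. (x i s' * r i s) * (x j s * r j s'))"
        by (rule sum.cong[OF refl], rule sum.swap)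
      also have "\<dots> = (\<Sum>s=1..k. \<Sum>i<n. \<Sum>j<n. \<Sum>s'=1..k. (x i s' * r i s) * (x j s * r j s'))"
        by (rule sum.swap)
      also have "\<dots> = (\<Sum>s=1..k. \<Sum>i<n. \<Sum>s'=1..k. \<Sum>j<n. (x i s' * r i s) * (x j s * r j s'))"
        by (rule sum.cong[OF refl], rule sum.cong[OF refl], rule sum.swap)
      also have "\<dots> = ?R"
        by (rule sum.cong[OF refl], rule sum.swap)
      finally show ?thesis .
    qed
    also have "\<dots> = (\<Sum>s=1..k. \<Sum>s'=1..k. (\<Sum>i<n. x i s' * r i s) * (\<Sum>j<n. x j s * r j s'))"
      by (simp add: sum_product)
    also have "\<dots> = (\<Sum>s=1..k. \<Sum>s'=1..k. of_bool (s' = s) * of_bool (s = s'))"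
      by (intro sum.cong refl) (simp only: dual)
    also have "\<dots> = (\<Sum>s=1..k. \<Sum>s'=1..k. if s' = s then 1 else 0)"
      by (intro sum.cong refl) auto
    also have "\<dots> = real k" by simp
    finally show ?thesis .
  qed
  have WW: "(\<Sum>i<n. \<Sum>j<n. W i j * W j i) = real (k * (k + 1))"
  proof -
    have "W i j * W j i = P i i * P j j - P i i * P i j - P j j * P j i + P j i * P i j" for i j
      unfolding WP by (simp add: algebra_simps)
    then have "(\<Sum>i<n. \<Sum>j<n. W i j * W j i) = (\<Sum>i<n. \<Sum>j<n. P i i * P j j) - (\<Sum>i<n. \<Sum>j<n. P i i * P i j)
      - (\<Sum>i<n. \<Sum>j<n. P j j * P j i) + (\<Sum>i<n. \<Sum>j<n. P j i * P i j)"
      by (simp add: sum.distrib sum_subtractf)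
    moreover have "(\<Sum>i<n. \<Sum>j<n. P i i * P i j) = 0" by (simp add: sum_distrib_left[symmetric] P0)
    moreover have "(\<Sum>i<n. \<Sum>j<n. P j j * P j i) = 0"
      by (subst sum.swap) (simp add: sum_distrib_left[symmetric] P0)
    moreover have "(\<Sum>i<n. \<Sum>j<n. P i i * P j j) = real k * real k"
      by (simp add: sum_product[symmetric] trP)
    ultimately show ?thesis using PP by (simp add: algebra_simps)
  qed
  have "0 \<le> (\<Sum>i<n. \<Sum>j<n. if adj i j then (1 - W i j) * (1 - W j i) else W i j * W j i)"
    using W01 by (intro sum_nonneg) auto
  also have "\<dots> = (\<Sum>i<n. \<Sum>j<n. W i j * W j i + of_bool (adj i j) - of_bool (adj i j) * W i j - of_bool (adj j i) * W j i)"
    using sym by (intro sum.cong refl) (auto simp: algebra_simps)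
  also have "\<dots> = (\<Sum>i<n. \<Sum>j<n. W i j * W j i) + (\<Sum>i<n. \<Sum>j<n. of_bool (adj i j))
    - (\<Sum>i<n. \<Sum>j<n. of_bool (adj i j) * W i j) - (\<Sum>i<n. \<Sum>j<n. of_bool (adj j i) * W j i)"
    by (simp add: sum.distrib sum_subtractf)
  also have "(\<Sum>i<n. \<Sum>j<n. of_bool (adj j i) * W j i) = (\<Sum>i<n. \<Sum>j<n. of_bool (adj i j) * W i j)"
    by (rule sum.swap)
  finally show ?thesis using WW by simp
qed

subsection \<open>Sums of graph Laplacian eigenvalues\<close>

text \<open>With \<open>C\<close> the inverse of \<open>B\<close>, a singular \<open>A + e B\<close>
  makes \<open>- e\<close> an eigenvalue of \<open>C * A\<close>, and there are finitely many of
  these.\<close>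

lemma finite_singular_pencil:
  fixes A B :: "real mat"
  assumes A: "A \<in> carrier_mat d d" and B: "B \<in> carrier_mat d d" and "det B \<noteq> 0"
  shows "finite {e. det (A + e \<cdot>\<^sub>m B) = 0}"
proof -
  obtain C where C: "C \<in> carrier_mat d d" and CB: "C * B = 1\<^sub>m d"
    using det_non_zero_imp_unit[OF B \<open>det B \<noteq> 0\<close>]
    by (auto simp: Units_def ring_mat_def)
  have CA: "C * A \<in> carrier_mat d d" using A C by simp
  have "- e \<in> spectrum (C * A)" if e: "det (A + e \<cdot>\<^sub>m B) = 0" for e
  proof -
    have AB: "A + e \<cdot>\<^sub>m B \<in> carrier_mat d d" using A B by simp
    then obtain v where v: "v \<in> carrier_vec d" "v \<noteq> 0\<^sub>v d" and z: "(A + e \<cdot>\<^sub>m B) *\<^sub>v v = 0\<^sub>v d"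
      using det_0_iff_vec_prod_zero_field[OF AB] e by auto
    have "(C * A) *\<^sub>v v + e \<cdot>\<^sub>v v = C *\<^sub>v ((A + e \<cdot>\<^sub>m B) *\<^sub>v v)"
    proof -
      have "(e \<cdot>\<^sub>m B) *\<^sub>v v = e \<cdot>\<^sub>v (B *\<^sub>v v)"
        by (rule eq_vecI) (use B v in auto)
      then have "C *\<^sub>v ((A + e \<cdot>\<^sub>m B) *\<^sub>v v) = C *\<^sub>v (A *\<^sub>v v + e \<cdot>\<^sub>v (B *\<^sub>v v))"
        using A B v by (simp add: add_mult_distrib_mat_vec[of _ d d])
      also have "\<dots> = C *\<^sub>v (A *\<^sub>v v) + e \<cdot>\<^sub>v (C *\<^sub>v (B *\<^sub>v v))"
        using A B C v by (simp add: mult_add_distrib_mat_vec[of _ d d] mult_mat_vec[of _ d d])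
      also have "C *\<^sub>v (B *\<^sub>v v) = v"
        using B C v CB assoc_mult_mat_vec[of C d d B d v] by simp
      also have "C *\<^sub>v (A *\<^sub>v v) = (C * A) *\<^sub>v v"
        using A C v assoc_mult_mat_vec[of C d d A d v] by simp
      finally show ?thesis by simp
    qed
    also have "\<dots> = 0\<^sub>v d" unfolding z using C by (intro eq_vecI) auto
    finally have eq: "(C * A) *\<^sub>v v + e \<cdot>\<^sub>v v = 0\<^sub>v d" .
    have "(C * A) *\<^sub>v v = (- e) \<cdot>\<^sub>v v"
    proof (rule eq_vecI)
      fix i assume i: "i < dim_vec ((- e) \<cdot>\<^sub>v v)"
      have "((C * A) *\<^sub>v v + e \<cdot>\<^sub>v v) $ i = 0" using eq i v by simp
      moreover have "((C * A) *\<^sub>v v + e \<cdot>\<^sub>v v) $ i = ((C * A) *\<^sub>v v) $ i + e * v $ i"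
        using i v CA by (simp del: index_mult_mat_vec)
      ultimately show "((C * A) *\<^sub>v v) $ i = ((- e) \<cdot>\<^sub>v v) $ i" using i by (simp del: index_mult_mat_vec)
    qed (use v CA in auto)
    then have "eigenvector (C * A) v (- e)" using v CA C unfolding eigenvector_def by auto
    then show ?thesis unfolding spectrum_def eigenvalue_def by auto
  qed
  then have "{e. det (A + e \<cdot>\<^sub>m B) = 0} \<subseteq> uminus ` spectrum (C * A)" by force
  moreover have "finite (uminus ` spectrum (C * A))" using card_finite_spectrum(1)[OF CA] by simp
  ultimately show ?thesis by (rule finite_subset)
qed

text \<open>A kernel vector would be the coefficients of a nonzero polynomial of degree below
  \<open>d\<close> with \<open>d\<close> distinct roots.\<close>

lemma vandermonde_nonzero:
  fixes a :: "nat \<Rightarrow> real"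
  assumes "inj_on a {..<d}"
  shows "det (mat d d (\<lambda>(i, j). a i ^ j)) \<noteq> 0"
proof
  let ?B = "mat d d (\<lambda>(i, j). a i ^ j)"
  assume "det ?B = 0"
  then obtain v where v: "v \<in> carrier_vec d" "v \<noteq> 0\<^sub>v d" and z: "?B *\<^sub>v v = 0\<^sub>v d"
    using det_0_iff_vec_prod_zero_field[of ?B d] by auto
  define p where "p = (\<Sum>j<d. monom (v $ j) j)"
  have coeff: "coeff p j = v $ j" if "j < d" for j
    unfolding p_def using that by (simp add: coeff_sum if_distrib sum.delta cong: if_cong)
  have p0: "p \<noteq> 0"
  proof
    assume "p = 0"
    then have "v = 0\<^sub>v d" using coeff v by (intro eq_vecI) auto
    then show False using v by simp
  qed
  have d: "d > 0" using v by (cases d) auto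
  have deg: "degree p < d"
  proof -
    have "degree p \<le> d - 1" unfolding p_def
      by (rule degree_sum_le) (auto intro: order_trans[OF degree_monom_le])
    then show ?thesis using d by simp
  qed
  have "poly p (a i) = 0" if "i < d" for i
  proof -
    have "(?B *\<^sub>v v) $ i = (\<Sum>j<d. a i ^ j * v $ j)"
      using that v by (simp add: scalar_prod_def lessThan_atLeast0)
    then show ?thesis using z that by (simp add: p_def poly_sum poly_monom mult.commute)
  qed
  then have "a ` {..<d} \<subseteq> {x. poly p x = 0}" by auto
  then have "card (a ` {..<d}) \<le> card {x. poly p x = 0}"
    using poly_roots_finite[OF p0] by (intro card_mono)
  then have "d \<le> degree p"
    using card_poly_roots_bound[OF p0] card_image[OF assms] by simp
  then show False using deg by simp
qed

text \<open>Moving the points along the moment curve brings them into general position.\<close>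

lemma finite_degenerate_perturbation:
  fixes Y :: "nat \<Rightarrow> nat \<Rightarrow> real"
  assumes "distinct xs" "length xs = d"
  shows "finite {e. bracket d (map (\<lambda>i s. Y i s + e * real i ^ s) xs) = 0}"
proof -
  let ?A = "mat d d (\<lambda>(i, j). Y (xs ! i) j)" and ?B = "mat d d (\<lambda>(i, j). real (xs ! i) ^ j)"
  have "bracket d (map (\<lambda>i s. Y i s + e * real i ^ s) xs) = det (?A + e \<cdot>\<^sub>m ?B)" for e
    unfolding bracket_def by (rule arg_cong[of _ _ det], rule eq_matI) (use assms in auto)
  moreover have "det ?B \<noteq> 0"
    by (rule vandermonde_nonzero) (use assms in \<open>auto simp: inj_on_def nth_eq_iff_index_eq\<close>)
  ultimately show ?thesis using finite_singular_pencil[of ?A d ?B] by simp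
qed

lemma tendsto_bracket:
  assumes "\<And>i s. i < d \<Longrightarrow> s < d \<Longrightarrow> ((\<lambda>e. (vs e ! i) s) \<longlongrightarrow> (ws ! i) s) F"
  shows "((\<lambda>e. bracket d (vs e)) \<longlongrightarrow> bracket d ws) F"
  unfolding bracket_def det_def'[OF mat_carrier]
  by (intro tendsto_sum tendsto_mult tendsto_const tendsto_prod)
    (use assms in \<open>auto dest: permutes_in_image\<close>)

text \<open>Together with the normalised constant vector there are \<open>k + 1\<close> orthonormal
  vectors. Bessel's inequality for each standard basis vector, summed over the basis, gives
  \<open>k + 1 \<le> n\<close>.\<close>

lemma orthonormal_card_less:
  fixes u :: "nat \<Rightarrow> nat \<Rightarrow> real"
  assumes orth: "\<And>s s'. s \<in> {1..k} \<Longrightarrow> s' \<in> {1..k} \<Longrightarrow> (\<Sum>i<n. u i s * u i s') = of_bool (s = s')"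
    and zero: "\<And>s. s \<in> {1..k} \<Longrightarrow> (\<Sum>i<n. u i s) = 0"
    and k: "k \<ge> 1"
  shows "k < n"
proof -
  have "n \<noteq> 0"
  proof
    assume "n = 0"
    then show False using orth[of 1 1] k by simp
  qed
  then have n: "real n > 0" by simp
  have bessel: "(\<Sum>s=1..k. (u i s)\<^sup>2) + 1 / n \<le> 1" if i: "i < n" for i
  proof -
    define p where "p j = (\<Sum>s=1..k. u i s * u j s)" for j
    have p0: "(\<Sum>j<n. p j) = 0"
      unfolding p_def by (subst sum.swap) (simp add: sum_distrib_left[symmetric] zero)
    have pp: "(\<Sum>j<n. p j * p j) = (\<Sum>s=1..k. (u i s)\<^sup>2)"
    proof -
      have "(\<Sum>j<n. p j * p j) = (\<Sum>j<n. \<Sum>s=1..k. \<Sum>s'=1..k. u i s * u i s' * (u j s * u j s'))"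
        unfolding p_def by (simp add: sum_product mult_ac)
      also have "\<dots> = (\<Sum>s=1..k. \<Sum>j<n. \<Sum>s'=1..k. u i s * u i s' * (u j s * u j s'))"
        by (rule sum.swap)
      also have "\<dots> = (\<Sum>s=1..k. \<Sum>s'=1..k. \<Sum>j<n. u i s * u i s' * (u j s * u j s'))"
        by (rule sum.cong[OF refl], rule sum.swap)
      also have "\<dots> = (\<Sum>s=1..k. \<Sum>s'=1..k. u i s * u i s' * of_bool (s = s'))"
        by (intro sum.cong refl) (simp only: sum_distrib_left[symmetric] orth)
      also have "\<dots> = (\<Sum>s=1..k. \<Sum>s'=1..k. if s = s' then u i s * u i s' else 0)"
        by (intro sum.cong refl) auto
      also have "\<dots> = (\<Sum>s=1..k. (u i s)\<^sup>2)"
        by (intro sum.cong refl) (simp add: power2_eq_square)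
      finally show ?thesis .
    qed
    \<comment> \<open>This is the squared distance of the \<open>i\<close>-th basis vector from its
      projection: \<open>p\<close> is the part in the span of the \<open>u\<close>,
      \<open>1 / n\<close> the constant part.\<close>
    have "0 \<le> (\<Sum>j<n. (of_bool (j = i) - p j - 1 / n)\<^sup>2)" by (intro sum_nonneg) simp
    also have "\<dots> = (\<Sum>j<n. (if j = i then 1 - 2 * p j - 2 / n else 0) + p j * p j + 2 / n * p j + 1 / n * (1 / n))"
      by (intro sum.cong refl) (auto simp: power2_eq_square algebra_simps)
    also have "\<dots> = 1 - 2 * p i - 2 / n + (\<Sum>j<n. p j * p j) + 2 / n * (\<Sum>j<n. p j) + 1 / n"
      using i n by (simp add: sum.distrib sum_distrib_left)
    also have "\<dots> = 1 - p i - 1 / n" using p0 pp by (simp add: p_def power2_eq_square)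
    finally show ?thesis by (simp add: p_def power2_eq_square)
  qed
  have "real k + 1 = (\<Sum>s=1..k. \<Sum>i<n. (u i s)\<^sup>2) + (\<Sum>i<n. 1 / n)"
    using orth n by (simp add: power2_eq_square)
  also have "\<dots> = (\<Sum>i<n. (\<Sum>s=1..k. (u i s)\<^sup>2) + 1 / n)"
    by (subst sum.swap) (simp add: sum.distrib)
  also have "\<dots> \<le> (\<Sum>i<n. 1)" by (intro sum_mono bessel) simp
  finally show ?thesis by simp
qed

text \<open>Eigenvectors are numbered from 1, which leaves coordinate 0 free for the homogenising
  entry.\<close>

locale graph_eigenvectors =
  fixes k n :: nat and u :: "nat \<Rightarrow> nat \<Rightarrow> real" and adj :: "nat \<Rightarrow> nat \<Rightarrow> bool" and lam :: "nat \<Rightarrow> real"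
  assumes k: "k \<ge> 1"
    and orth: "\<And>s s'. s \<in> {1..k} \<Longrightarrow> s' \<in> {1..k} \<Longrightarrow> (\<Sum>i<n. u i s * u i s') = of_bool (s = s')"
    and zero: "\<And>s. s \<in> {1..k} \<Longrightarrow> (\<Sum>i<n. u i s) = 0"
    and sym: "\<And>i j. adj i j \<longleftrightarrow> adj j i"
    and eigen: "\<And>i s. i < n \<Longrightarrow> s \<in> {1..k} \<Longrightarrow> (\<Sum>j<n. of_bool (adj i j) * (u i s - u j s)) = lam s * u i s"
begin

section \<open>Perturbed eigenvector coordinates\<close>

lemma kn: "k < n"
  using orthonormal_card_less[OF orth zero k] .

text \<open>Below \<open>n\<close> these are the points in homogeneous coordinates; from
  \<open>n\<close> on they are the unit vectors of the coordinates 1, 2, and so on, which span the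
  hyperplane at infinity.\<close>

definition Y :: "nat \<Rightarrow> nat \<Rightarrow> real" where
  "Y i s = (if i < n then if s = 0 then 1 else u i s else of_bool (s = Suc (i - n)))"

text \<open>Coordinate 0 of the moment curve is constantly 1, so the perturbed points still have a
  common height, \<open>1 + e\<close>.\<close>

definition X :: "real \<Rightarrow> nat \<Rightarrow> nat \<Rightarrow> real" where
  "X e i s = Y i s + e * real i ^ s"

definition bound :: real where "bound = real n ^ k"

text \<open>The defect of the moment curve in the eigenvalue equation: the perturbed coordinates
  satisfy that equation up to \<open>e * err\<close>.\<close>

definition err :: "nat \<Rightarrow> nat \<Rightarrow> real" where
  "err i s = (\<Sum>j<n. of_bool (adj i j) * (real i ^ s - real j ^ s)) - lam s * real i ^ s"

lemma u_le_1:
  assumes "i < n" "s \<in> {1..k}"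
  shows "\<bar>u i s\<bar> \<le> 1"
proof -
  have "u i s * u i s \<le> (\<Sum>i<n. u i s * u i s)"
    by (rule member_le_sum[where f = "\<lambda>i. u i s * u i s"]) (use assms in auto)
  then have "(u i s)\<^sup>2 \<le> 1" using orth[of s s] assms by (simp add: power2_eq_square)
  then show ?thesis by (simp add: abs_square_le_1)
qed

lemma power_le_bound:
  assumes "i < n" "s \<le> k"
  shows "real i ^ s \<le> bound"
proof -
  have "real i ^ s \<le> real n ^ s" using assms by (intro power_mono) auto
  also have "\<dots> \<le> real n ^ k" using assms by (intro power_increasing) auto
  finally show ?thesis by (simp add: bound_def)
qed

text \<open>The first row starts with 1 and the others are unit vectors, so the matrix is upper
  triangular with unit diagonal.\<close>

lemma aux_bracket:
  assumes "j < n"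
  shows "bracket (Suc k) (map Y (j # [n..<n + k])) = 1"
proof -
  let ?A = "mat (Suc k) (Suc k) (\<lambda>(a, b). (map Y (j # [n..<n + k]) ! a) b)"
  have "det ?A = prod_list (diag_mat ?A)"
    by (rule det_upper_triangular[of _ "Suc k"]) (use assms in \<open>auto simp: Y_def nth_Cons'\<close>)
  also have "diag_mat ?A = replicate (Suc k) 1"
    unfolding diag_mat_def by (rule nth_equalityI) (use assms in \<open>auto simp: Y_def nth_Cons' simp del: upt_Suc\<close>)
  finally show ?thesis by (simp add: bracket_def)
qed

lemma eventually_aux: "\<forall>\<^sub>F e in at_right 0. \<forall>j\<in>{..<n}. bracket (Suc k) (map (X e) (j # [n..<n + k])) > 0"
proof (rule eventually_ball_finite, simp, rule ballI)
  fix j assume "j \<in> {..<n}"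
  then have "j < n" by simp
  have "((\<lambda>e. bracket (Suc k) (map (X e) (j # [n..<n + k]))) \<longlongrightarrow> bracket (Suc k) (map Y (j # [n..<n + k]))) (at_right 0)"
  proof (rule tendsto_bracket)
    fix i s assume i: "i < Suc k"
    have "((\<lambda>e. Y t s + e * real t ^ s) \<longlongrightarrow> Y t s + 0 * real t ^ s) (at_right 0)" for t
      by (intro tendsto_intros)
    then have "((\<lambda>e. X e t s) \<longlongrightarrow> Y t s) (at_right 0)" for t by (simp add: X_def)
    then show "((\<lambda>e. (map (X e) (j # [n..<n + k]) ! i) s) \<longlongrightarrow> (map Y (j # [n..<n + k]) ! i) s) (at_right 0)"
      using i by (simp del: list.map)
  qed
  then show "\<forall>\<^sub>F e in at_right 0. bracket (Suc k) (map (X e) (j # [n..<n + k])) > 0"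
    by (rule order_tendstoD) (simp add: aux_bracket[OF \<open>j < n\<close>] del: list.map)
qed

definition degenerate :: "real set" where
  "degenerate = (\<Union>xs\<in>{xs. set xs \<subseteq> {..<n + k} \<and> length xs = Suc k \<and> distinct xs}. {e. bracket (Suc k) (map (X e) xs) = 0})"

lemma finite_degenerate: "finite degenerate"
  unfolding degenerate_def
proof (rule finite_UN_I)
  show "finite {xs. set xs \<subseteq> {..<n + k} \<and> length xs = Suc k \<and> distinct xs}"
    by (rule finite_subset[OF _ finite_lists_length_eq[of "{..<n + k}" "Suc k"]]) auto
  fix xs assume "xs \<in> {xs. set xs \<subseteq> {..<n + k} \<and> length xs = Suc k \<and> distinct xs}"
  then show "finite {e. bracket (Suc k) (map (X e) xs) = 0}"
    using finite_degenerate_perturbation[of xs "Suc k" Y] by (simp add: X_def[abs_def])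
qed

text \<open>The only loss against the unperturbed inequality is \<open>e\<close> times the pairing
  of \<open>r\<close> with \<open>err\<close>, and \<open>r\<close> is bounded independently of
  \<open>e\<close>.\<close>

lemma perturbed_bound:
  assumes e: "e > 0" "e \<notin> degenerate"
    and aux: "\<forall>j\<in>{..<n}. bracket (Suc k) (map (X e) (j # [n..<n + k])) > 0"
    and small: "4 * e * real n * real k * bound \<le> 1"
  shows "2 * (\<Sum>s=1..k. lam s) \<le> (\<Sum>i<n. \<Sum>j<n. of_bool (adj i j)) + real (k * (k + 1))
    + e * (4 * real n * (\<Sum>s=1..k. \<Sum>i<n. \<bar>err i s\<bar>))"
proof -
  interpret generic_points k n "X e" "1 + e"
  proof
    show "bracket (Suc k) (map (X e) xs) \<noteq> 0"
      if "distinct xs" "length xs = Suc k" "set xs \<subseteq> {..<n + k}" for xs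
      using e(2) that unfolding degenerate_def by auto
  qed (use k kn e aux in \<open>auto simp: X_def Y_def\<close>)
  obtain r where r: "\<And>s s'. s \<in> {1..k} \<Longrightarrow> s' \<in> {1..k} \<Longrightarrow> (\<Sum>i<n. X e i s * r i s') = of_bool (s = s')"
    "\<And>s. s \<in> {1..k} \<Longrightarrow> (\<Sum>i<n. r i s) = 0"
    and W0: "\<And>i j. i < n \<Longrightarrow> j < n \<Longrightarrow> 0 \<le> (\<Sum>s=1..k. r i s * (X e i s - X e j s))"
    and W1: "\<And>i j. i < n \<Longrightarrow> j < n \<Longrightarrow> (\<Sum>s=1..k. r i s * (X e i s - X e j s)) \<le> 1"
    by (rule dual_vectors) blast
  define W where "W i j = (\<Sum>s=1..k. r i s * (X e i s - X e j s))" for i j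
  have Xu: "X e i s = u i s + e * real i ^ s" if "i < n" "s \<in> {1..k}" for i s
    using that by (simp add: X_def Y_def)
  \<comment> \<open>The numbers \<open>W\<close> lie in [0, 1] and determine \<open>r\<close>
    through the orthonormal \<open>u\<close>, up to a perturbation term proportional to the largest
    entry \<open>R\<close>. Smallness of \<open>e\<close> bounds that term by \<open>R / 2\<close>,
    so it can be absorbed on the left.\<close>
  have rbound: "\<bar>r i s\<bar> \<le> 2 * real n" if i: "i < n" and s: "s \<in> {1..k}" for i s
  proof -
    define R where "R = Max ((\<lambda>s. \<bar>r i s\<bar>) ` {1..k})"
    have Rge: "\<bar>r i s'\<bar> \<le> R" if "s' \<in> {1..k}" for s' unfolding R_def using that by (intro Max_ge) auto
    have R0: "R \<ge> 0" using Rge[OF s] by linarith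
    have "\<bar>r i t\<bar> \<le> real n * (1 + e * (real k * (R * (2 * bound))))" if t: "t \<in> {1..k}" for t
    proof -
      let ?g = "\<lambda>a. \<Sum>s'=1..k. r i s' * (u a s' - u i s')"
      \<comment> \<open>As the columns of \<open>u\<close> are orthonormal with zero sum, pairing
        the differences \<open>?g\<close> with column \<open>t\<close> recovers
        \<open>r i t\<close>.\<close>
      have "(\<Sum>a<n. u a t * ?g a) = (\<Sum>a<n. \<Sum>s'=1..k. r i s' * (u a t * u a s') - r i s' * u i s' * u a t)"
        by (simp add: sum_distrib_left algebra_simps)
      also have "\<dots> = (\<Sum>s'=1..k. \<Sum>a<n. r i s' * (u a t * u a s') - r i s' * u i s' * u a t)"
        by (rule sum.swap)
      also have "\<dots> = (\<Sum>s'=1..k. r i s' * (\<Sum>a<n. u a t * u a s') - r i s' * u i s' * (\<Sum>a<n. u a t))"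
        by (simp add: sum_subtractf sum_distrib_left)
      also have "\<dots> = (\<Sum>s'=1..k. if t = s' then r i s' else 0)"
        by (intro sum.cong refl) (use t orth zero in auto)
      also have "\<dots> = r i t" using t by simp
      finally have req: "r i t = (\<Sum>a<n. u a t * ?g a)" by simp
      have g: "\<bar>?g a\<bar> \<le> 1 + e * (real k * (R * (2 * bound)))" if a: "a < n" for a
      proof -
        let ?q = "\<Sum>s'=1..k. r i s' * (real i ^ s' - real a ^ s')"
        have "W i a = (\<Sum>s'=1..k. e * (r i s' * (real i ^ s' - real a ^ s')) - r i s' * (u a s' - u i s'))"
          unfolding W_def by (intro sum.cong refl) (simp add: Xu i a algebra_simps)
        then have eq: "?g a = e * ?q - W i a"
          by (simp add: sum_subtractf sum_distrib_left)
        have "\<bar>?q\<bar> \<le> (\<Sum>s'=1..k. R * (2 * bound))"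
        proof (rule order_trans[OF sum_abs], rule sum_mono)
          fix s' assume s': "s' \<in> {1..k}"
          have "\<bar>real i ^ s' - real a ^ s'\<bar> \<le> 2 * bound"
          proof -
            have "real i ^ s' \<le> bound" "real a ^ s' \<le> bound" using power_le_bound i a s' by auto
            moreover have "0 \<le> real i ^ s'" "0 \<le> real a ^ s'" by simp_all
            ultimately show ?thesis unfolding abs_le_iff by linarith
          qed
          then show "\<bar>r i s' * (real i ^ s' - real a ^ s')\<bar> \<le> R * (2 * bound)"
            unfolding abs_mult using Rge[OF s'] R0 by (intro mult_mono) auto
        qed
        then have "\<bar>e * ?q\<bar> \<le> e * (real k * (R * (2 * bound)))"
          using e by (simp add: abs_mult)
        moreover have "0 \<le> W i a" "W i a \<le> 1" using W0 W1 i a by (auto simp: W_def)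
        ultimately show ?thesis unfolding eq by linarith
      qed
      have "\<bar>r i t\<bar> \<le> (\<Sum>a<n. \<bar>u a t * ?g a\<bar>)" unfolding req by (rule sum_abs)
      also have "\<dots> \<le> (\<Sum>a<n. 1 + e * (real k * (R * (2 * bound))))"
      proof (rule sum_mono)
        fix a assume "a \<in> {..<n}"
        then have a: "a < n" by simp
        have "\<bar>u a t * ?g a\<bar> \<le> 1 * (1 + e * (real k * (R * (2 * bound))))"
          unfolding abs_mult by (rule mult_mono[OF u_le_1[OF a t] g[OF a]]) auto
        then show "\<bar>u a t * ?g a\<bar> \<le> 1 + e * (real k * (R * (2 * bound)))" by simp
      qed
      finally show ?thesis by simp
    qed
    moreover have "R \<in> (\<lambda>s. \<bar>r i s\<bar>) ` {1..k}" unfolding R_def using k by (intro Max_in) auto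
    ultimately have "R \<le> real n * (1 + e * (real k * (R * (2 * bound))))" by auto
    also have "\<dots> = real n + (4 * e * real n * real k * bound) * R / 2" by (simp add: algebra_simps)
    also have "\<dots> \<le> real n + R / 2" using mult_right_mono[OF small R0] by linarith
    finally have "R \<le> 2 * real n" by simp
    then show ?thesis using Rge[OF s] by linarith
  qed
  have "2 * (\<Sum>i<n. \<Sum>j<n. of_bool (adj i j) * W i j)
    \<le> (\<Sum>i<n. \<Sum>j<n. of_bool (adj i j)) + real (k * (k + 1))"
    by (rule dual_vectors_adjacency[where x = "X e" and r = r])
      (use r W0 W1 sym in \<open>auto simp: W_def\<close>)
  \<comment> \<open>Summing over \<open>j\<close> first applies the graph Laplacian to the
    coordinates, which multiplies them by \<open>lam s\<close> up to the defect; the dual pairing of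
    \<open>X e\<close> with \<open>r\<close> then leaves exactly the sum of the eigenvalues.\<close>
  moreover have "(\<Sum>i<n. \<Sum>j<n. of_bool (adj i j) * W i j) = (\<Sum>s=1..k. lam s) + e * (\<Sum>s=1..k. \<Sum>i<n. r i s * err i s)"
  proof -
    have "(\<Sum>j<n. of_bool (adj i j) * W i j) = (\<Sum>s=1..k. r i s * (\<Sum>j<n. of_bool (adj i j) * (X e i s - X e j s)))" for i
      unfolding W_def sum_distrib_left by (subst sum.swap) (simp add: mult_ac)
    then have "(\<Sum>i<n. \<Sum>j<n. of_bool (adj i j) * W i j)
      = (\<Sum>i<n. \<Sum>s=1..k. r i s * (\<Sum>j<n. of_bool (adj i j) * (X e i s - X e j s)))"
      by (simp only:)
    also have "\<dots> = (\<Sum>s=1..k. \<Sum>i<n. r i s * (\<Sum>j<n. of_bool (adj i j) * (X e i s - X e j s)))"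
      by (rule sum.swap)
    also have "\<dots> = (\<Sum>s=1..k. \<Sum>i<n. lam s * (X e i s * r i s) + e * (r i s * err i s))"
    proof (intro sum.cong refl)
      fix s i assume s: "s \<in> {1..k}" and "i \<in> {..<n}"
      then have i: "i < n" by simp
      have "(\<Sum>j<n. of_bool (adj i j) * (X e i s - X e j s))
        = (\<Sum>j<n. of_bool (adj i j) * (u i s - u j s) + e * (of_bool (adj i j) * (real i ^ s - real j ^ s)))"
        by (intro sum.cong refl) (auto simp: Xu[OF i s] Xu[OF _ s] algebra_simps)
      also have "\<dots> = lam s * u i s + e * (err i s + lam s * real i ^ s)"
        unfolding sum.distrib sum_distrib_left[symmetric] eigen[OF i s] err_def by simp
      also have "\<dots> = lam s * X e i s + e * err i s" using Xu[OF i s] by (simp add: algebra_simps)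
      finally show "r i s * (\<Sum>j<n. of_bool (adj i j) * (X e i s - X e j s))
        = lam s * (X e i s * r i s) + e * (r i s * err i s)" by (simp add: algebra_simps)
    qed
    also have "\<dots> = (\<Sum>s=1..k. lam s * (\<Sum>i<n. X e i s * r i s)) + e * (\<Sum>s=1..k. \<Sum>i<n. r i s * err i s)"
      by (simp add: sum.distrib sum_distrib_left)
    also have "(\<Sum>s=1..k. lam s * (\<Sum>i<n. X e i s * r i s)) = (\<Sum>s=1..k. lam s)"
      by (intro sum.cong refl) (simp add: r)
    finally show ?thesis .
  qed
  moreover have "- (e * (\<Sum>s=1..k. \<Sum>i<n. r i s * err i s)) \<le> e * (2 * real n * (\<Sum>s=1..k. \<Sum>i<n. \<bar>err i s\<bar>))"
  proof -
    have "- (\<Sum>s=1..k. \<Sum>i<n. r i s * err i s) \<le> (\<Sum>s=1..k. \<Sum>i<n. 2 * real n * \<bar>err i s\<bar>)"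
      unfolding sum_negf[symmetric]
    proof (intro sum_mono)
      fix s i assume "s \<in> {1..k}" "i \<in> {..<n}"
      then have "\<bar>r i s\<bar> * \<bar>err i s\<bar> \<le> 2 * real n * \<bar>err i s\<bar>"
        by (intro mult_right_mono rbound) auto
      then show "- (r i s * err i s) \<le> 2 * real n * \<bar>err i s\<bar>"
        using abs_ge_minus_self[of "r i s * err i s"] by (simp add: abs_mult)
    qed
    then show ?thesis using e by (simp add: sum_distrib_left[symmetric] mult_left_mono flip: mult_minus_right)
  qed
  ultimately show ?thesis by (simp add: algebra_simps)
qed

lemma eigenvalue_sum_bound:
  "2 * (\<Sum>s=1..k. lam s) \<le> (\<Sum>i<n. \<Sum>j<n. of_bool (adj i j)) + real (k * (k + 1))"
proof (rule field_le_epsilon)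
  fix \<epsilon> :: real assume \<epsilon>: "\<epsilon> > 0"
  define C where "C = 4 * real n * (\<Sum>s=1..k. \<Sum>i<n. \<bar>err i s\<bar>)"
  have C: "C \<ge> 0" unfolding C_def by (intro mult_nonneg_nonneg sum_nonneg) auto
  define b where "b = 4 * real n * real k * bound"
  have b: "b \<ge> 0" unfolding b_def bound_def by auto
  obtain \<delta> where \<delta>: "\<delta> > 0" "\<And>e. 0 < e \<Longrightarrow> e < \<delta> \<Longrightarrow> \<forall>j\<in>{..<n}. bracket (Suc k) (map (X e) (j # [n..<n + k])) > 0"
    using eventually_aux by (auto simp: eventually_at_right_field simp del: list.map)
  \<comment> \<open>The three bounds ensure orientation of the auxiliary vectors, smallness as
    required by \<open>perturbed_bound\<close>, and an error of at most \<open>\<epsilon>\<close>.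
    The added ones avoid division by zero. Only finitely many \<open>e\<close> below
    \<open>m\<close> are degenerate.\<close>
  define m where "m = min \<delta> (min (1 / (b + 1)) (\<epsilon> / (C + 1)))"
  have "m > 0" using \<delta> \<epsilon> b C by (simp add: m_def)
  then have "infinite {0<..<m}" by simp
  then have "{0<..<m} - degenerate \<noteq> {}"
    using finite_degenerate by (metis Diff_eq_empty_iff finite_subset)
  then obtain e where "e \<in> {0<..<m} - degenerate" by blast
  then have e: "0 < e" "e < m" "e \<notin> degenerate" by simp_all
  have "e * b \<le> 1"
  proof -
    have "e * (b + 1) \<le> 1" using e b by (simp add: m_def pos_less_divide_eq)
    then show ?thesis using e by (simp add: algebra_simps)
  qed
  then have "2 * (\<Sum>s=1..k. lam s) \<le> (\<Sum>i<n. \<Sum>j<n. of_bool (adj i j)) + real (k * (k + 1)) + e * C"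
    unfolding C_def by (intro perturbed_bound \<delta>) (use e in \<open>auto simp: b_def m_def mult_ac\<close>)
  moreover have "e * C \<le> \<epsilon>"
  proof -
    have "e * (C + 1) \<le> \<epsilon>" using e C by (simp add: m_def pos_less_divide_eq)
    then show ?thesis using e by (simp add: algebra_simps)
  qed
  ultimately show "2 * (\<Sum>s=1..k. lam s) \<le> (\<Sum>i<n. \<Sum>j<n. of_bool (adj i j)) + real (k * (k + 1)) + \<epsilon>"
    by linarith
qed

end

subsection \<open>A Gerzon-type bound\<close>

text \<open>By the Schur test the Gram matrix of the \<open>v \<sigma>\<close> has norm at most its
  largest absolute row sum, and this norm is the squared norm of the map taking
  \<open>\<theta>\<close> to its inner products with the \<open>v \<sigma>\<close>.\<close>

lemma bessel_row_sum:
  fixes v :: "'s \<Rightarrow> 'i \<Rightarrow> real" and \<theta> :: "'i \<Rightarrow> real"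
  assumes fin: "finite S" and L: "\<Lambda> > 0"
    and gram: "\<And>\<sigma>. \<sigma> \<in> S \<Longrightarrow> (\<Sum>\<sigma>'\<in>S. \<bar>\<Sum>i\<in>I. v \<sigma> i * v \<sigma>' i\<bar>) \<le> \<Lambda>"
  shows "(\<Sum>\<sigma>\<in>S. (\<Sum>i\<in>I. \<theta> i * v \<sigma> i)\<^sup>2) \<le> \<Lambda> * (\<Sum>i\<in>I. (\<theta> i)\<^sup>2)"
proof -
  define t where "t \<sigma> = (\<Sum>i\<in>I. \<theta> i * v \<sigma> i)" for \<sigma>
  define G where "G \<sigma> \<sigma>' = (\<Sum>i\<in>I. v \<sigma> i * v \<sigma>' i)" for \<sigma> \<sigma>'
  define T where "T = (\<Sum>\<sigma>\<in>S. (t \<sigma>)\<^sup>2)"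
  have G_sym: "G \<sigma> \<sigma>' = G \<sigma>' \<sigma>" for \<sigma> \<sigma>' by (simp add: G_def mult.commute)
  have cross: "(\<Sum>i\<in>I. \<theta> i * (\<Sum>\<sigma>\<in>S. t \<sigma> * v \<sigma> i)) = T"
  proof -
    have "(\<Sum>i\<in>I. \<theta> i * (\<Sum>\<sigma>\<in>S. t \<sigma> * v \<sigma> i)) = (\<Sum>\<sigma>\<in>S. t \<sigma> * (\<Sum>i\<in>I. \<theta> i * v \<sigma> i))"
      unfolding sum_distrib_left by (subst sum.swap) (simp add: mult_ac)
    then show ?thesis by (simp add: T_def t_def power2_eq_square)
  qed
  have "(\<Sum>i\<in>I. (\<Sum>\<sigma>\<in>S. t \<sigma> * v \<sigma> i)\<^sup>2) = (\<Sum>i\<in>I. \<Sum>\<sigma>\<in>S. \<Sum>\<sigma>'\<in>S. t \<sigma> * t \<sigma>' * (v \<sigma> i * v \<sigma>' i))"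
    by (simp add: power2_eq_square sum_product mult_ac)
  also have "\<dots> = (\<Sum>\<sigma>\<in>S. \<Sum>i\<in>I. \<Sum>\<sigma>'\<in>S. t \<sigma> * t \<sigma>' * (v \<sigma> i * v \<sigma>' i))" by (rule sum.swap)
  also have "\<dots> = (\<Sum>\<sigma>\<in>S. \<Sum>\<sigma>'\<in>S. \<Sum>i\<in>I. t \<sigma> * t \<sigma>' * (v \<sigma> i * v \<sigma>' i))"
    by (rule sum.cong[OF refl], rule sum.swap)
  also have "\<dots> = (\<Sum>\<sigma>\<in>S. \<Sum>\<sigma>'\<in>S. t \<sigma> * t \<sigma>' * G \<sigma> \<sigma>')" by (simp add: G_def sum_distrib_left)
  also have "\<dots> \<le> (\<Sum>\<sigma>\<in>S. \<Sum>\<sigma>'\<in>S. (t \<sigma>)\<^sup>2 / 2 * \<bar>G \<sigma> \<sigma>'\<bar> + (t \<sigma>')\<^sup>2 / 2 * \<bar>G \<sigma> \<sigma>'\<bar>)"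
  proof (intro sum_mono)
    fix \<sigma> \<sigma>'
    have "2 * \<bar>t \<sigma> * t \<sigma>'\<bar> \<le> (t \<sigma>)\<^sup>2 + (t \<sigma>')\<^sup>2"
      using sum_squares_bound[of "\<bar>t \<sigma>\<bar>" "\<bar>t \<sigma>'\<bar>"] by (simp add: abs_mult)
    then have "\<bar>t \<sigma> * t \<sigma>'\<bar> * \<bar>G \<sigma> \<sigma>'\<bar> \<le> ((t \<sigma>)\<^sup>2 / 2 + (t \<sigma>')\<^sup>2 / 2) * \<bar>G \<sigma> \<sigma>'\<bar>"
      by (intro mult_right_mono) auto
    moreover have "t \<sigma> * t \<sigma>' * G \<sigma> \<sigma>' \<le> \<bar>t \<sigma> * t \<sigma>'\<bar> * \<bar>G \<sigma> \<sigma>'\<bar>"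
      using abs_ge_self[of "t \<sigma> * t \<sigma>' * G \<sigma> \<sigma>'"] by (simp add: abs_mult)
    ultimately show "t \<sigma> * t \<sigma>' * G \<sigma> \<sigma>' \<le> (t \<sigma>)\<^sup>2 / 2 * \<bar>G \<sigma> \<sigma>'\<bar> + (t \<sigma>')\<^sup>2 / 2 * \<bar>G \<sigma> \<sigma>'\<bar>"
      by (simp add: distrib_right)
  qed
  also have "\<dots> = (\<Sum>\<sigma>\<in>S. \<Sum>\<sigma>'\<in>S. (t \<sigma>)\<^sup>2 / 2 * \<bar>G \<sigma> \<sigma>'\<bar>) + (\<Sum>\<sigma>\<in>S. \<Sum>\<sigma>'\<in>S. (t \<sigma>')\<^sup>2 / 2 * \<bar>G \<sigma> \<sigma>'\<bar>)"
    by (simp add: sum.distrib)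
  also have "(\<Sum>\<sigma>\<in>S. \<Sum>\<sigma>'\<in>S. (t \<sigma>')\<^sup>2 / 2 * \<bar>G \<sigma> \<sigma>'\<bar>) = (\<Sum>\<sigma>\<in>S. \<Sum>\<sigma>'\<in>S. (t \<sigma>)\<^sup>2 / 2 * \<bar>G \<sigma> \<sigma>'\<bar>)"
    by (subst sum.swap) (simp only: G_sym)
  also have "(\<Sum>\<sigma>\<in>S. \<Sum>\<sigma>'\<in>S. (t \<sigma>)\<^sup>2 / 2 * \<bar>G \<sigma> \<sigma>'\<bar>) + (\<Sum>\<sigma>\<in>S. \<Sum>\<sigma>'\<in>S. (t \<sigma>)\<^sup>2 / 2 * \<bar>G \<sigma> \<sigma>'\<bar>)
    = (\<Sum>\<sigma>\<in>S. (t \<sigma>)\<^sup>2 * (\<Sum>\<sigma>'\<in>S. \<bar>G \<sigma> \<sigma>'\<bar>))"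
    unfolding sum_distrib_left sum.distrib[symmetric] by (intro sum.cong refl) simp
  also have "\<dots> \<le> (\<Sum>\<sigma>\<in>S. (t \<sigma>)\<^sup>2 * \<Lambda>)"
    by (intro sum_mono mult_left_mono) (use gram in \<open>auto simp: G_def\<close>)
  finally have sq: "(\<Sum>i\<in>I. (\<Sum>\<sigma>\<in>S. t \<sigma> * v \<sigma> i)\<^sup>2) \<le> \<Lambda> * T"
    by (simp add: T_def sum_distrib_left mult.commute)
  \<comment> \<open>Expanding this square with \<open>cross\<close> and \<open>sq\<close> leaves
    \<open>\<Lambda>\<close> times the difference of the two sides of the claim.\<close>
  have "0 \<le> (\<Sum>i\<in>I. (\<Lambda> * \<theta> i - (\<Sum>\<sigma>\<in>S. t \<sigma> * v \<sigma> i))\<^sup>2)" by (intro sum_nonneg) simp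
  also have "\<dots> = (\<Sum>i\<in>I. \<Lambda>\<^sup>2 * (\<theta> i)\<^sup>2 - 2 * \<Lambda> * (\<theta> i * (\<Sum>\<sigma>\<in>S. t \<sigma> * v \<sigma> i)) + (\<Sum>\<sigma>\<in>S. t \<sigma> * v \<sigma> i)\<^sup>2)"
    by (intro sum.cong refl) (simp add: power2_diff power_mult_distrib mult_ac)
  also have "\<dots> = \<Lambda>\<^sup>2 * (\<Sum>i\<in>I. (\<theta> i)\<^sup>2) - 2 * \<Lambda> * T + (\<Sum>i\<in>I. (\<Sum>\<sigma>\<in>S. t \<sigma> * v \<sigma> i)\<^sup>2)"
    by (simp only: sum.distrib sum_subtractf sum_distrib_left[symmetric] cross)
  also have "\<dots> \<le> \<Lambda> * (\<Lambda> * (\<Sum>i\<in>I. (\<theta> i)\<^sup>2) - T)"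
    using sq by (simp add: algebra_simps power2_eq_square)
  finally show ?thesis using L by (simp add: zero_le_mult_iff T_def t_def)
qed

text \<open>The term \<open>l (l + 1) / 2\<close> is the dimension of the space of quadratic forms on the span of the
  \<open>x s\<close>, as in Gerzon's bound for equiangular lines.\<close>

lemma gerzon_eigenvalue_bound:
  fixes \<beta> :: "'s \<Rightarrow> nat \<Rightarrow> real" and x :: "nat \<Rightarrow> nat \<Rightarrow> real"
  assumes fin: "finite S" and L: "\<Lambda> > 0" and q: "q > 0"
    and gram: "\<And>\<sigma>. \<sigma> \<in> S \<Longrightarrow> (\<Sum>\<sigma>'\<in>S. (\<Sum>i<N. \<beta> \<sigma> i * \<beta> \<sigma>' i)\<^sup>2) \<le> \<Lambda>"
    and orth: "\<And>s t. s < l \<Longrightarrow> t < l \<Longrightarrow> (\<Sum>i<N. x s i * x t i) = of_bool (s = t)"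
  shows "(\<Sum>s<l. \<Sum>\<sigma>\<in>S. (\<Sum>i<N. x s i * \<beta> \<sigma> i)\<^sup>2) \<le> q / 2 * real (card S) + \<Lambda> * (real l * (real l + 1)) / (4 * q)"
proof -
  define c where "c s \<sigma> = (\<Sum>i<N. x s i * \<beta> \<sigma> i)" for s \<sigma>
  define A where "A \<sigma> = (\<Sum>s<l. (c s \<sigma>)\<^sup>2)" for \<sigma>
  let ?I = "{..<N} \<times> {..<N}"
  \<comment> \<open>The tensor squares of the \<open>\<beta> \<sigma>\<close>; their inner products
    are the squares that occur in \<open>gram\<close>.\<close>
  let ?v = "\<lambda>\<sigma> p. \<beta> \<sigma> (fst p) * \<beta> \<sigma> (snd p)"
  have prod_sum: "(\<Sum>p\<in>?I. f (fst p) * g (snd p)) = (\<Sum>i<N. f i) * (\<Sum>i<N. g i)" for f g :: "nat \<Rightarrow> real"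
    by (simp add: sum_product sum.cartesian_product split_def)
  have G: "(\<Sum>p\<in>?I. ?v \<sigma> p * ?v \<sigma>' p) = (\<Sum>i<N. \<beta> \<sigma> i * \<beta> \<sigma>' i)\<^sup>2" for \<sigma> \<sigma>'
    using prod_sum[of "\<lambda>i. \<beta> \<sigma> i * \<beta> \<sigma>' i" "\<lambda>i. \<beta> \<sigma> i * \<beta> \<sigma>' i"]
    by (simp add: power2_eq_square mult_ac)
  have bessel: "(\<Sum>\<sigma>\<in>S. (\<Sum>p\<in>?I. \<theta> p * ?v \<sigma> p)\<^sup>2) \<le> \<Lambda> * (\<Sum>p\<in>?I. (\<theta> p)\<^sup>2)" for \<theta>
    by (rule bessel_row_sum[OF fin L]) (use gram in \<open>simp add: G\<close>)
  have quartic: "(\<Sum>\<sigma>\<in>S. (c s \<sigma>)\<^sup>2 * (c t \<sigma>)\<^sup>2) \<le> \<Lambda> / 2 + (if s = t then \<Lambda> / 2 else 0)"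
    if "s < l" "t < l" for s t
  proof -
    \<comment> \<open>The symmetrised tensor has squared norm 2 for \<open>s \<noteq> t\<close> and
      4 for \<open>s = t\<close>. Symmetrising halves the bound off the diagonal, which yields
      \<open>l (l + 1) / 2\<close> instead of the square of \<open>l\<close>.\<close>
    let ?\<theta> = "\<lambda>p. x s (fst p) * x t (snd p) + x t (fst p) * x s (snd p)"
    have "(\<Sum>p\<in>?I. ?\<theta> p * ?v \<sigma> p) = 2 * (c s \<sigma> * c t \<sigma>)" for \<sigma>
    proof -
      have "(\<Sum>p\<in>?I. ?\<theta> p * ?v \<sigma> p)
        = (\<Sum>p\<in>?I. (x s (fst p) * \<beta> \<sigma> (fst p)) * (x t (snd p) * \<beta> \<sigma> (snd p)))
        + (\<Sum>p\<in>?I. (x t (fst p) * \<beta> \<sigma> (fst p)) * (x s (snd p) * \<beta> \<sigma> (snd p)))"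
        unfolding sum.distrib[symmetric] by (intro sum.cong refl) (simp add: algebra_simps)
      also have "\<dots> = c s \<sigma> * c t \<sigma> + c t \<sigma> * c s \<sigma>"
        unfolding prod_sum[of "\<lambda>i. x s i * \<beta> \<sigma> i" "\<lambda>i. x t i * \<beta> \<sigma> i"]
          prod_sum[of "\<lambda>i. x t i * \<beta> \<sigma> i" "\<lambda>i. x s i * \<beta> \<sigma> i"] by (simp add: c_def)
      finally show ?thesis by simp
    qed
    moreover have "(\<Sum>p\<in>?I. (?\<theta> p)\<^sup>2) = 2 + 2 * of_bool (s = t)"
    proof -
      have "(\<Sum>p\<in>?I. (?\<theta> p)\<^sup>2)
        = (\<Sum>p\<in>?I. (x s (fst p) * x s (fst p)) * (x t (snd p) * x t (snd p)))
        + (\<Sum>p\<in>?I. (x t (fst p) * x t (fst p)) * (x s (snd p) * x s (snd p)))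
        + 2 * (\<Sum>p\<in>?I. (x s (fst p) * x t (fst p)) * (x s (snd p) * x t (snd p)))"
        unfolding sum_distrib_left sum.distrib[symmetric]
        by (intro sum.cong refl) (simp add: power2_eq_square algebra_simps)
      also have "\<dots> = 1 * 1 + 1 * 1 + 2 * (of_bool (s = t) * of_bool (s = t))"
        unfolding prod_sum[of "\<lambda>i. x s i * x s i" "\<lambda>i. x t i * x t i"]
          prod_sum[of "\<lambda>i. x t i * x t i" "\<lambda>i. x s i * x s i"]
          prod_sum[of "\<lambda>i. x s i * x t i" "\<lambda>i. x s i * x t i"]
        using orth that by simp
      finally show ?thesis by simp
    qed
    ultimately have "(\<Sum>\<sigma>\<in>S. (2 * (c s \<sigma> * c t \<sigma>))\<^sup>2) \<le> \<Lambda> * (2 + 2 * of_bool (s = t))"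
      using bessel[of ?\<theta>] by simp
    moreover have "(\<Sum>\<sigma>\<in>S. (2 * (c s \<sigma> * c t \<sigma>))\<^sup>2) = 4 * (\<Sum>\<sigma>\<in>S. (c s \<sigma>)\<^sup>2 * (c t \<sigma>)\<^sup>2)"
      by (simp add: power_mult_distrib sum_distrib_left)
    ultimately show ?thesis by (auto split: if_splits)
  qed
  have "(\<Sum>\<sigma>\<in>S. (A \<sigma>)\<^sup>2) = (\<Sum>\<sigma>\<in>S. \<Sum>s<l. \<Sum>t<l. (c s \<sigma>)\<^sup>2 * (c t \<sigma>)\<^sup>2)"
    by (simp add: A_def power2_eq_square sum_product)
  also have "\<dots> = (\<Sum>s<l. \<Sum>\<sigma>\<in>S. \<Sum>t<l. (c s \<sigma>)\<^sup>2 * (c t \<sigma>)\<^sup>2)" by (rule sum.swap)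
  also have "\<dots> = (\<Sum>s<l. \<Sum>t<l. \<Sum>\<sigma>\<in>S. (c s \<sigma>)\<^sup>2 * (c t \<sigma>)\<^sup>2)"
    by (rule sum.cong[OF refl], rule sum.swap)
  also have "\<dots> \<le> (\<Sum>s<l. \<Sum>t<l. \<Lambda> / 2 + (if s = t then \<Lambda> / 2 else 0))"
    by (intro sum_mono quartic) auto
  also have "\<dots> = \<Lambda> * (real l * (real l + 1)) / 2"
    by (simp add: sum.distrib algebra_simps)
  finally have A2: "(\<Sum>\<sigma>\<in>S. (A \<sigma>)\<^sup>2) \<le> \<Lambda> * (real l * (real l + 1)) / 2" .
  \<comment> \<open>This linearises the quadratic bound \<open>A2\<close>; \<open>q\<close> will be
    \<open>r + 1\<close>, the squared norm of the boundary of an \<open>r\<close>-face.\<close>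
  have "(\<Sum>\<sigma>\<in>S. 2 * q * A \<sigma>) \<le> (\<Sum>\<sigma>\<in>S. (A \<sigma>)\<^sup>2 + q\<^sup>2)"
  proof (rule sum_mono)
    fix \<sigma>
    show "2 * q * A \<sigma> \<le> (A \<sigma>)\<^sup>2 + q\<^sup>2"
      using sum_squares_bound[of q "A \<sigma>"] by (simp add: add.commute)
  qed
  then have "2 * q * (\<Sum>\<sigma>\<in>S. A \<sigma>) \<le> \<Lambda> * (real l * (real l + 1)) / 2 + real (card S) * q\<^sup>2"
    using A2 by (simp add: sum_distrib_left sum.distrib)
  then have "(\<Sum>\<sigma>\<in>S. A \<sigma>) \<le> (\<Lambda> * (real l * (real l + 1)) / 2 + real (card S) * q\<^sup>2) / (2 * q)"
    using q by (simp add: pos_le_divide_eq mult.commute)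
  also have "\<dots> = q / 2 * real (card S) + \<Lambda> * (real l * (real l + 1)) / (4 * q)"
    using q by (simp add: field_simps power2_eq_square)
  also have "(\<Sum>\<sigma>\<in>S. A \<sigma>) = (\<Sum>s<l. \<Sum>\<sigma>\<in>S. (\<Sum>i<N. x s i * \<beta> \<sigma> i)\<^sup>2)"
    unfolding A_def c_def by (rule sum.swap)
  finally show ?thesis .
qed

subsection \<open>Spectral theorem for real symmetric matrices\<close>

lemma real_scalar_prod_self_eq_0:
  fixes v :: "real vec"
  assumes "v \<in> carrier_vec n"
  shows "v \<bullet> v = 0 \<longleftrightarrow> v = 0\<^sub>v n"
  using assms by (auto intro!: eq_vecI simp: scalar_prod_def sum_nonneg_eq_0_iff)

text \<open>A complex eigenvector is split into its real part \<open>a\<close> and imaginary part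
  \<open>b\<close>. Symmetry forces its eigenvalue to be real, and then whichever of
  \<open>a\<close> and \<open>b\<close> is nonzero is an eigenvector.\<close>

lemma real_symmetric_eigenvector:
  fixes A :: "real mat"
  assumes A: "A \<in> carrier_mat n n" and sym: "A\<^sup>T = A" and n: "n > 0"
  obtains v e where "v \<in> carrier_vec n" "v \<bullet> v = 1" "A *\<^sub>v v = e \<cdot>\<^sub>v v"
proof -
  let ?C = "map_mat complex_of_real A"
  have C: "?C \<in> carrier_mat n n" using A by simp
  obtain \<mu> where "\<mu> \<in> spectrum ?C" using spectrum_non_empty[OF C n] by blast
  then obtain z where z: "z \<in> carrier_vec n" "z \<noteq> 0\<^sub>v n" and ev: "?C *\<^sub>v z = \<mu> \<cdot>\<^sub>v z"
    using C unfolding spectrum_def eigenvalue_def eigenvector_def by auto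
  define a where "a = map_vec Re z"
  define b where "b = map_vec Im z"
  have ab: "a \<in> carrier_vec n" "b \<in> carrier_vec n" using z by (auto simp: a_def b_def)
  have comp: "(\<Sum>j<n. complex_of_real (A $$ (i, j)) * z $ j) = \<mu> * z $ i" if "i < n" for i
  proof -
    have "(?C *\<^sub>v z) $ i = (\<mu> \<cdot>\<^sub>v z) $ i" using ev by simp
    then show ?thesis using that A z by (simp add: scalar_prod_def lessThan_atLeast0)
  qed
  have Aa: "A *\<^sub>v a = Re \<mu> \<cdot>\<^sub>v a - Im \<mu> \<cdot>\<^sub>v b"
  proof (rule eq_vecI)
    fix i assume "i < dim_vec (Re \<mu> \<cdot>\<^sub>v a - Im \<mu> \<cdot>\<^sub>v b)"
    then have i: "i < n" using ab by simp
    have "(A *\<^sub>v a) $ i = Re (\<Sum>j<n. complex_of_real (A $$ (i, j)) * z $ j)"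
      using i A z by (simp add: scalar_prod_def lessThan_atLeast0 a_def)
    then show "(A *\<^sub>v a) $ i = (Re \<mu> \<cdot>\<^sub>v a - Im \<mu> \<cdot>\<^sub>v b) $ i"
      unfolding comp[OF i] using i ab z by (simp add: a_def b_def)
  qed (use A ab in auto)
  have Ab: "A *\<^sub>v b = Im \<mu> \<cdot>\<^sub>v a + Re \<mu> \<cdot>\<^sub>v b"
  proof (rule eq_vecI)
    fix i assume "i < dim_vec (Im \<mu> \<cdot>\<^sub>v a + Re \<mu> \<cdot>\<^sub>v b)"
    then have i: "i < n" using ab by simp
    have "(A *\<^sub>v b) $ i = Im (\<Sum>j<n. complex_of_real (A $$ (i, j)) * z $ j)"
      using i A z by (simp add: scalar_prod_def lessThan_atLeast0 b_def)
    then show "(A *\<^sub>v b) $ i = (Im \<mu> \<cdot>\<^sub>v a + Re \<mu> \<cdot>\<^sub>v b) $ i"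
      unfolding comp[OF i] using i ab z by (simp add: a_def b_def)
  qed (use A ab in auto)
  \<comment> \<open>Inserting \<open>Aa\<close> and \<open>Ab\<close>, the terms with the real part
    of the eigenvalue cancel.\<close>
  have "(A *\<^sub>v a) \<bullet> b = a \<bullet> (A *\<^sub>v b)"
    using transpose_vec_mult_scalar[OF A ab(2,1)] sym by simp
  then have "Im \<mu> * (a \<bullet> a + b \<bullet> b) = 0"
    unfolding Aa Ab using ab
    by (simp add: minus_scalar_prod_distrib[of _ n] scalar_prod_add_distrib[of _ n] algebra_simps)
  moreover have nonneg: "v \<bullet> v \<ge> 0" for v :: "real vec" by (simp add: scalar_prod_def sum_nonneg)
  note zero = real_scalar_prod_self_eq_0[THEN iffD1]
  have ne: "a \<noteq> 0\<^sub>v n \<or> b \<noteq> 0\<^sub>v n"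
  proof (rule ccontr)
    assume "\<not> ?thesis"
    then have "Re (z $ i) = 0 \<and> Im (z $ i) = 0" if "i < n" for i
      using that z by (metis a_def b_def carrier_vecD index_map_vec(1) index_zero_vec(1))
    then have "z = 0\<^sub>v n" using z by (intro eq_vecI) (auto simp: complex_eq_iff)
    then show False using z by simp
  qed
  then have "a \<bullet> a + b \<bullet> b \<noteq> 0"
    using zero ab nonneg[of a] nonneg[of b] by (metis add_nonneg_eq_0_iff)
  ultimately have im: "Im \<mu> = 0" by simp
  have "\<exists>v\<in>carrier_vec n. v \<noteq> 0\<^sub>v n \<and> A *\<^sub>v v = Re \<mu> \<cdot>\<^sub>v v"
  proof -
    have "A *\<^sub>v a = Re \<mu> \<cdot>\<^sub>v a" "A *\<^sub>v b = Re \<mu> \<cdot>\<^sub>v b"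
      unfolding Aa Ab im using ab by (auto intro!: eq_vecI)
    then show ?thesis using ne ab by blast
  qed
  then obtain v where v: "v \<in> carrier_vec n" "v \<noteq> 0\<^sub>v n" "A *\<^sub>v v = Re \<mu> \<cdot>\<^sub>v v" by blast
  define w where "w = (1 / sqrt (v \<bullet> v)) \<cdot>\<^sub>v v"
  have "v \<bullet> v > 0" using zero[OF v(1)] v(2) nonneg[of v] by force
  then have "w \<bullet> w = 1" unfolding w_def using v(1) by simp
  moreover have "A *\<^sub>v w = Re \<mu> \<cdot>\<^sub>v w"
    unfolding w_def using mult_mat_vec[OF A v(1)] v by (simp add: smult_smult_assoc mult.commute)
  ultimately show ?thesis using that[of w "Re \<mu>"] v(1) by (simp add: w_def)
qed

text \<open>The reflection in the hyperplane orthogonal to the difference of two unit vectors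
  exchanges them. If they are equal, the identity serves.\<close>

lemma householder:
  fixes v :: "real vec"
  assumes v: "v \<in> carrier_vec n" and n: "n > 0" and unit: "v \<bullet> v = 1"
  obtains H where "H \<in> carrier_mat n n" "H\<^sup>T = H" "H * H = 1\<^sub>m n" "H *\<^sub>v unit_vec n 0 = v"
proof (cases "v = unit_vec n 0")
  case True
  then show ?thesis using that[of "1\<^sub>m n"] by simp
next
  case False
  define w where "w = v - unit_vec n 0"
  have w: "w \<in> carrier_vec n" using v by (simp add: w_def)
  have v0: "v \<bullet> unit_vec n 0 = v $ 0" "unit_vec n 0 \<bullet> v = v $ 0" using v n by auto
  have ww: "w \<bullet> w = 2 - 2 * v $ 0"
    unfolding w_def using v n unit v0
    by (simp add: minus_scalar_prod_distrib[of _ n] scalar_prod_minus_distrib[of _ n])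
  have "w \<noteq> 0\<^sub>v n"
  proof
    assume "w = 0\<^sub>v n"
    then have "v = unit_vec n 0" unfolding w_def using v
      by (intro eq_vecI) (auto simp: vec_eq_iff)
    then show False using False by simp
  qed
  then have wne: "w \<bullet> w \<noteq> 0"
    using real_scalar_prod_self_eq_0[OF w] by simp
  define H where "H = mat n n (\<lambda>(i, j). of_bool (i = j) - 2 * w $ i * w $ j / (w \<bullet> w))"
  have H: "H \<in> carrier_mat n n" by (simp add: H_def)
  have Hx: "(H *\<^sub>v x) $ i = x $ i - 2 * w $ i * (w \<bullet> x) / (w \<bullet> w)" if "i < n" "x \<in> carrier_vec n" for x i
  proof -
    have "(H *\<^sub>v x) $ i = (\<Sum>j<n. (if j = i then x $ j else 0) - 2 * w $ i / (w \<bullet> w) * (w $ j * x $ j))"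
      using that by (auto simp: H_def scalar_prod_def lessThan_atLeast0 algebra_simps intro!: sum.cong)
    also have "\<dots> = x $ i - 2 * w $ i / (w \<bullet> w) * (\<Sum>j<n. w $ j * x $ j)"
      using that by (simp add: sum_subtractf sum_distrib_left)
    also have "(\<Sum>j<n. w $ j * x $ j) = w \<bullet> x" using that by (simp add: scalar_prod_def lessThan_atLeast0)
    finally show ?thesis by simp
  qed
  have wHx: "w \<bullet> (H *\<^sub>v x) = - (w \<bullet> x)" if x: "x \<in> carrier_vec n" for x
  proof -
    have "w \<bullet> (H *\<^sub>v x) = (\<Sum>i<n. w $ i * x $ i - 2 * (w \<bullet> x) / (w \<bullet> w) * (w $ i * w $ i))"
      using x H w by (auto simp: scalar_prod_def[of w "H *\<^sub>v x"] lessThan_atLeast0 Hx algebra_simps simp del: index_mult_mat_vec intro!: sum.cong)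
    also have "\<dots> = (\<Sum>i<n. w $ i * x $ i) - 2 * (w \<bullet> x) / (w \<bullet> w) * (\<Sum>i<n. w $ i * w $ i)"
      by (simp only: sum_subtractf sum_distrib_left)
    also have "(\<Sum>i<n. w $ i * x $ i) = w \<bullet> x" using x by (simp add: scalar_prod_def lessThan_atLeast0)
    also have "(\<Sum>i<n. w $ i * w $ i) = w \<bullet> w" using w by (simp add: scalar_prod_def lessThan_atLeast0)
    finally show ?thesis using wne by simp
  qed
  have "H * H = 1\<^sub>m n"
  proof (rule eq_matI)
    fix i j assume ij: "i < dim_row (1\<^sub>m n)" "j < dim_col (1\<^sub>m n)"
    have "(H * H) $$ (i, j) = (H *\<^sub>v (H *\<^sub>v unit_vec n j)) $ i"
    proof -
      have "H *\<^sub>v (H *\<^sub>v unit_vec n j) = (H * H) *\<^sub>v unit_vec n j"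
        using assoc_mult_mat_vec[OF H H, of "unit_vec n j"] by simp
      moreover have "(M *\<^sub>v unit_vec n j) $ i = M $$ (i, j)" if "M \<in> carrier_mat n n" for M :: "real mat"
        using that ij by simp
      ultimately show ?thesis using H by (metis mult_carrier_mat)
    qed
    also have "\<dots> = 1\<^sub>m n $$ (i, j)"
      using ij H by (simp add: Hx wHx del: index_mult_mat_vec)
    finally show "(H * H) $$ (i, j) = 1\<^sub>m n $$ (i, j)" .
  qed (use H in auto)
  moreover have "H\<^sup>T = H" by (rule eq_matI) (auto simp: H_def)
  moreover have "H *\<^sub>v unit_vec n 0 = v"
  proof (rule eq_vecI)
    fix i assume "i < dim_vec v"
    then have i: "i < n" using v by simp
    have "w \<bullet> unit_vec n 0 = v $ 0 - 1" using w v n by (simp add: w_def)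
    then have "2 * (w \<bullet> unit_vec n 0) = - (w \<bullet> w)" using ww by simp
    then have "w $ i * (2 * (w \<bullet> unit_vec n 0)) / (w \<bullet> w) = - w $ i" using wne by simp
    then have "2 * w $ i * (w \<bullet> unit_vec n 0) / (w \<bullet> w) = - w $ i" by (simp add: mult_ac)
    then show "(H *\<^sub>v unit_vec n 0) $ i = v $ i"
      using Hx[OF i, of "unit_vec n 0"] i v n by (simp add: w_def del: index_mult_mat_vec)
  qed (use v H in auto)
  ultimately show ?thesis using that[of H] H by blast
qed

text \<open>Conjugation by the reflection \<open>H\<close> makes the first unit vector an
  eigenvector. By symmetry the first row and column then vanish off the diagonal, and the induction
  hypothesis applies to the remaining block.\<close>

lemma real_symmetric_eigenbasis:
  fixes A :: "real mat"
  assumes "A \<in> carrier_mat n n" "A\<^sup>T = A"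
  shows "\<exists>x d. (\<forall>i<n. x i \<in> carrier_vec n) \<and> (\<forall>i<n. \<forall>j<n. x i \<bullet> x j = of_bool (i = j))
    \<and> (\<forall>i<n. A *\<^sub>v x i = d i \<cdot>\<^sub>v x i)"
  using assms
proof (induction n arbitrary: A)
  case 0
  then show ?case by simp
next
  case (Suc n)
  note A = Suc.prems
  obtain v e where v: "v \<in> carrier_vec (Suc n)" "v \<bullet> v = 1" "A *\<^sub>v v = e \<cdot>\<^sub>v v"
    using real_symmetric_eigenvector[OF A] by auto
  obtain H where H: "H \<in> carrier_mat (Suc n) (Suc n)" "H\<^sup>T = H" "H * H = 1\<^sub>m (Suc n)"
    and Hv: "H *\<^sub>v unit_vec (Suc n) 0 = v"
    using householder[OF v(1) _ v(2)] by auto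
  have HH: "H *\<^sub>v (H *\<^sub>v y) = y" if "y \<in> carrier_vec (Suc n)" for y
    using assoc_mult_mat_vec[OF H(1,1) that] H(3) that by simp
  define B where "B = H * A * H"
  have B: "B \<in> carrier_mat (Suc n) (Suc n)" using H A by (simp add: B_def)
  have Bsym: "B\<^sup>T = B"
    unfolding B_def using H A
    by (simp add: transpose_mult[of _ "Suc n" "Suc n" _ "Suc n"] assoc_mult_mat[of _ "Suc n" "Suc n" _ "Suc n" _ "Suc n"])
  have Bmul: "B *\<^sub>v y = H *\<^sub>v (A *\<^sub>v (H *\<^sub>v y))" if "y \<in> carrier_vec (Suc n)" for y
    unfolding B_def using that H A
    by (simp add: assoc_mult_mat_vec[of _ "Suc n" "Suc n" _ "Suc n"])
  have B0: "B *\<^sub>v unit_vec (Suc n) 0 = e \<cdot>\<^sub>v unit_vec (Suc n) 0"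
    using Bmul[of "unit_vec (Suc n) 0"] Hv v mult_mat_vec[OF H(1) v(1)] HH[of "unit_vec (Suc n) 0"] by simp
  have col0: "B $$ (i, 0) = e * of_bool (i = 0)" if "i < Suc n" for i
  proof -
    have "B $$ (i, 0) = (B *\<^sub>v unit_vec (Suc n) 0) $ i" using that B by simp
    also have "\<dots> = (e \<cdot>\<^sub>v unit_vec (Suc n) 0) $ i" unfolding B0 ..
    also have "\<dots> = e * of_bool (i = 0)" using that by simp
    finally show ?thesis .
  qed
  have row0: "B $$ (0, i) = e * of_bool (i = 0)" if "i < Suc n" for i
    using col0[OF that] Bsym that B by (metis carrier_matD index_transpose_mat(1) zero_less_Suc)
  define A' where "A' = mat n n (\<lambda>(i, j). B $$ (Suc i, Suc j))"
  have A': "A' \<in> carrier_mat n n" by (simp add: A'_def)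
  have A'sym: "A'\<^sup>T = A'"
    using Bsym B by (intro eq_matI) (auto simp: A'_def, metis Suc_less_eq carrier_matD index_transpose_mat(1))
  obtain y d where y: "\<And>i. i < n \<Longrightarrow> y i \<in> carrier_vec n"
    and yy: "\<And>i j. i < n \<Longrightarrow> j < n \<Longrightarrow> y i \<bullet> y j = of_bool (i = j)"
    and yev: "\<And>i. i < n \<Longrightarrow> A' *\<^sub>v y i = d i \<cdot>\<^sub>v y i"
    using Suc.IH[OF A' A'sym] by blast
  define lift where "lift u = vec (Suc n) (\<lambda>t. if t = 0 then 0 else u $ (t - 1))" for u :: "real vec"
  define z where "z i = (if i = 0 then unit_vec (Suc n) 0 else lift (y (i - 1)))" for i
  define d' where "d' i = (if i = 0 then e else d (i - 1))" for i
  have z: "z i \<in> carrier_vec (Suc n)" for i by (simp add: z_def lift_def)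
  have lift_prod: "lift u \<bullet> lift u' = u \<bullet> u'" if "u' \<in> carrier_vec n" for u u'
    using that by (simp add: lift_def scalar_prod_def sum.atLeast0_lessThan_Suc_shift del: sum.op_ivl_Suc)
  have zz: "z i \<bullet> z j = of_bool (i = j)" if "i < Suc n" "j < Suc n" for i j
  proof -
    have "unit_vec (Suc n) 0 \<bullet> lift u = 0" "lift u \<bullet> unit_vec (Suc n) 0 = 0" for u
      by (simp_all add: lift_def)
    then show ?thesis using that y yy lift_prod by (cases i; cases j) (auto simp: z_def)
  qed
  have zev: "B *\<^sub>v z i = d' i \<cdot>\<^sub>v z i" if "i < Suc n" for i
  proof (cases i)
    case 0
    then show ?thesis using B0 by (simp add: z_def d'_def)
  next
    case (Suc i')
    then have i': "i' < n" using that by simp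
    have "B *\<^sub>v lift (y i') = d i' \<cdot>\<^sub>v lift (y i')"
    proof (rule eq_vecI)
      fix t assume "t < dim_vec (d i' \<cdot>\<^sub>v lift (y i'))"
      then have t: "t < Suc n" by (simp add: lift_def)
      have "(B *\<^sub>v lift (y i')) $ t = (\<Sum>s<Suc n. B $$ (t, s) * lift (y i') $ s)"
        using t B by (simp add: scalar_prod_def lessThan_atLeast0 lift_def del: sum.op_ivl_Suc)
      also have "\<dots> = (\<Sum>s<n. B $$ (t, Suc s) * y i' $ s)"
        unfolding sum.lessThan_Suc_shift by (simp add: lift_def)
      finally have 1: "(B *\<^sub>v lift (y i')) $ t = (\<Sum>s<n. B $$ (t, Suc s) * y i' $ s)" .
      show "(B *\<^sub>v lift (y i')) $ t = (d i' \<cdot>\<^sub>v lift (y i')) $ t"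
      proof (cases t)
        case 0
        then show ?thesis unfolding 1 by (simp add: row0 lift_def)
      next
        case (Suc t')
        then have t': "t' < n" using t by simp
        have "(A' *\<^sub>v y i') $ t' = (\<Sum>s<n. B $$ (t, Suc s) * y i' $ s)"
          using t' y[OF i'] Suc by (simp add: A'_def scalar_prod_def lessThan_atLeast0)
        then show ?thesis unfolding 1 using yev[OF i'] y[OF i'] t' Suc by (simp add: lift_def)
      qed
    qed (use B in \<open>simp add: lift_def\<close>)
    then show ?thesis using Suc by (simp add: z_def d'_def)
  qed
  show ?case
  proof (intro exI[of _ "\<lambda>i. H *\<^sub>v z i"] exI[of _ d'] conjI allI impI)
    show "H *\<^sub>v z i \<in> carrier_vec (Suc n)" for i using H z by simp
    show "(H *\<^sub>v z i) \<bullet> (H *\<^sub>v z j) = of_bool (i = j)" if "i < Suc n" "j < Suc n" for i j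
      using transpose_vec_mult_scalar[OF H(1), of "H *\<^sub>v z j" "z i"] H z HH[OF z] zz[OF that] by simp
    show "A *\<^sub>v (H *\<^sub>v z i) = d' i \<cdot>\<^sub>v (H *\<^sub>v z i)" if "i < Suc n" for i
    proof -
      have "A *\<^sub>v (H *\<^sub>v z i) = H *\<^sub>v (B *\<^sub>v z i)"
        unfolding Bmul[OF z] using HH[of "A *\<^sub>v (H *\<^sub>v z i)"] A H z by simp
      then show ?thesis unfolding zev[OF that] using mult_mat_vec[OF H(1) z] by simp
    qed
  qed
qed

text \<open>Diagonalising \<open>A\<close> factors its characteristic polynomial, so the ordered
  eigenvalues are a permutation of the diagonal entries; the eigenbasis is permuted in the same
  way.\<close>

lemma eigenvalues_desc_eigenbasis:
  fixes A :: "real mat"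
  assumes A: "A \<in> carrier_mat n n" and sym: "A\<^sup>T = A"
  obtains x :: "nat \<Rightarrow> nat \<Rightarrow> real" where "length (eigenvalues_desc A) = n"
    "\<And>i j. i < n \<Longrightarrow> j < n \<Longrightarrow> (\<Sum>t<n. x i t * x j t) = of_bool (i = j)"
    "\<And>i t. i < n \<Longrightarrow> t < n \<Longrightarrow> (\<Sum>s<n. A $$ (t, s) * x i s) = eigenvalues_desc A ! i * x i t"
proof -
  obtain y d where y: "\<And>i. i < n \<Longrightarrow> y i \<in> carrier_vec n"
    and yy: "\<And>i j. i < n \<Longrightarrow> j < n \<Longrightarrow> y i \<bullet> y j = of_bool (i = j)"
    and yev: "\<And>i. i < n \<Longrightarrow> A *\<^sub>v y i = d i \<cdot>\<^sub>v y i"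
    using real_symmetric_eigenbasis[OF A sym] by blast
  define P where "P = mat n n (\<lambda>(i, j). y j $ i)"
  define Q where "Q = mat n n (\<lambda>(i, j). d i * of_bool (i = j))"
  have P: "P \<in> carrier_mat n n" and Q: "Q \<in> carrier_mat n n" by (simp_all add: P_def Q_def)
  have PtP: "P\<^sup>T * P = 1\<^sub>m n"
  proof (rule eq_matI)
    fix i j assume ij: "i < dim_row (1\<^sub>m n)" "j < dim_col (1\<^sub>m n)"
    have "(P\<^sup>T * P) $$ (i, j) = (\<Sum>t<n. y i $ t * y j $ t)"
      using ij by (simp add: P_def scalar_prod_def lessThan_atLeast0)
    also have "\<dots> = y i \<bullet> y j" using y[of j] ij by (simp add: scalar_prod_def lessThan_atLeast0)
    finally show "(P\<^sup>T * P) $$ (i, j) = 1\<^sub>m n $$ (i, j)" using yy[of i j] ij by simp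
  qed (use P in auto)
  then have PPt: "P * P\<^sup>T = 1\<^sub>m n"
    by (rule mat_mult_left_right_inverse[rotated 2]) (use P in auto)
  have AP: "A * P = P * Q"
  proof (rule eq_matI)
    fix i j assume "i < dim_row (P * Q)" "j < dim_col (P * Q)"
    then have ij: "i < n" "j < n" using P Q by auto
    have "(A * P) $$ (i, j) = (A *\<^sub>v y j) $ i"
      using ij A y[OF ij(2)] by (simp add: P_def scalar_prod_def)
    also have "\<dots> = d j * y j $ i" using yev[OF ij(2)] y[OF ij(2)] ij by simp
    also have "\<dots> = (\<Sum>t<n. if t = j then y t $ i * d t else 0)" using ij by simp
    also have "\<dots> = (\<Sum>t<n. y t $ i * (d t * of_bool (t = j)))" by (rule sum.cong) auto
    also have "\<dots> = (P * Q) $$ (i, j)"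
      using ij by (simp add: P_def Q_def scalar_prod_def lessThan_atLeast0)
    finally show "(A * P) $$ (i, j) = (P * Q) $$ (i, j)" .
  qed (use A P Q in auto)
  have "A = A * (P * P\<^sup>T)" using PPt A by simp
  also have "\<dots> = A * P * P\<^sup>T" by (rule assoc_mult_mat[symmetric]) (use A P in auto)
  finally have "A = P * Q * P\<^sup>T" unfolding AP .
  then have "similar_mat A Q"
    using PPt PtP by (intro similar_matI[of A Q P "P\<^sup>T" n]) (use A P Q in auto)
  then have "char_poly A = char_poly Q" by (rule char_poly_similar)
  also have "\<dots> = (\<Prod>a\<leftarrow>diag_mat Q. [:- a, 1:])"
    by (rule char_poly_upper_triangular[OF Q]) (auto simp: Q_def)
  also have "diag_mat Q = map d [0..<n]" by (auto simp: diag_mat_def Q_def)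
  finally have cp: "char_poly A = (\<Prod>a\<leftarrow>map d [0..<n]. [:- a, 1:])" .
  have roots: "proots (\<Prod>a\<leftarrow>xs. [:- a, 1:]) = mset xs" for xs :: "real list"
  proof (induction xs)
    case (Cons a xs)
    have "(\<Prod>a\<leftarrow>xs. [:- a, 1:]) \<noteq> 0" by (auto simp: prod_list_zero_iff)
    then show ?case using Cons by (simp add: proots_mult del: mult_pCons_left)
  qed simp
  have "mset (eigenvalues_desc A) = mset (map d [0..<n])"
    unfolding eigenvalues_desc_def cp roots by simp
  then obtain p where p: "p permutes {..<n}" "permute_list p (map d [0..<n]) = eigenvalues_desc A"
    by (rule mset_eq_permutation) auto
  have len: "length (eigenvalues_desc A) = n" using p(2) by (metis diff_zero length_map length_permute_list length_upt)
  have pn: "p i < n" if "i < n" for i using permutes_in_image[OF p(1), of i] that by simp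
  have nth: "eigenvalues_desc A ! i = d (p i)" if "i < n" for i
    using permute_list_nth[of p "map d [0..<n]" i] p pn[OF that] that by simp
  show ?thesis
  proof (rule that[of "\<lambda>i t. y (p i) $ t"])
    show "length (eigenvalues_desc A) = n" by (rule len)
    show "(\<Sum>t<n. y (p i) $ t * y (p j) $ t) = of_bool (i = j)" if "i < n" "j < n" for i j
    proof -
      have "(\<Sum>t<n. y (p i) $ t * y (p j) $ t) = y (p i) \<bullet> y (p j)"
        using y[OF pn[OF that(2)]] by (simp add: scalar_prod_def lessThan_atLeast0)
      moreover have "p i = p j \<longleftrightarrow> i = j" using permutes_inj[OF p(1)] by (auto simp: inj_def)
      ultimately show ?thesis using yy[OF pn[OF that(1)] pn[OF that(2)]] by simp
    qed
    show "(\<Sum>s<n. A $$ (t, s) * y (p i) $ s) = eigenvalues_desc A ! i * y (p i) $ t" if "i < n" "t < n" for i t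
    proof -
      have "(A *\<^sub>v y (p i)) $ t = (\<Sum>s<n. A $$ (t, s) * y (p i) $ s)"
        using that A y[OF pn[OF that(1)]] by (simp add: scalar_prod_def lessThan_atLeast0)
      then show ?thesis using yev[OF pn[OF that(1)]] y[OF pn[OF that(1)]] that nth by simp
    qed
  qed
qed

subsection \<open>Up-Laplacians\<close>

lemma abstract_simplicial_complex_finite:
  assumes "abstract_simplicial_complex V K"
  shows "finite K" "\<sigma> \<in> K \<Longrightarrow> finite \<sigma>" "finite (faces i K)"
proof -
  have "finite (Pow V)" "K \<subseteq> Pow V" using assms by (auto simp: abstract_simplicial_complex_def)
  then show "finite K" by (rule rev_finite_subset)
  then show "finite (faces i K)" by (simp add: faces_def)
  show "finite \<sigma>" if "\<sigma> \<in> K"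
    using assms that by (auto simp: abstract_simplicial_complex_def intro: finite_subset)
qed

lemma abstract_simplicial_complex_subset:
  assumes "abstract_simplicial_complex V K" "\<sigma> \<in> K" "\<tau> \<subseteq> \<sigma>"
  shows "\<tau> \<in> K"
  using assms by (auto simp: abstract_simplicial_complex_def)

lemma face_list:
  assumes "abstract_simplicial_complex V K"
  shows "distinct (face_list i K)" "set (face_list i K) = faces i K" "length (face_list i K) = num_faces i K"
proof -
  have "\<exists>xs. distinct xs \<and> set xs = faces i K"
    using finite_distinct_list[OF abstract_simplicial_complex_finite(3)[OF assms]] by blast
  then have "distinct (face_list i K) \<and> set (face_list i K) = faces i K"
    unfolding face_list_def by (rule someI_ex)
  then show "distinct (face_list i K)" "set (face_list i K) = faces i K" by auto
  then show "length (face_list i K) = num_faces i K"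
    by (metis distinct_card num_faces_def)
qed

lemma sum_face_list:
  assumes "abstract_simplicial_complex V K"
  shows "(\<Sum>t<num_faces i K. f (face_list i K ! t)) = (\<Sum>\<rho>\<in>faces i K. f \<rho>)"
  using sum.reindex_bij_betw[OF bij_betw_nth[OF face_list(1)[OF assms] refl refl, of i], of f]
    face_list[OF assms, of i] by simp

lemma up_laplacian_entry:
  assumes "abstract_simplicial_complex V K" "s < num_faces i K" "t < num_faces i K"
  shows "up_laplacian i K $$ (s, t) = (\<Sum>\<sigma>\<in>faces (i + 1) K.
    boundary_coeff \<sigma> (face_list i K ! s) * boundary_coeff \<sigma> (face_list i K ! t))"
proof -
  have "up_laplacian i K $$ (s, t) = (\<Sum>b<num_faces (i + 1) K.
    boundary_coeff (face_list (i + 1) K ! b) (face_list i K ! s) * boundary_coeff (face_list (i + 1) K ! b) (face_list i K ! t))"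
    using assms(2,3) by (simp add: up_laplacian_def boundary_matrix_def scalar_prod_def lessThan_atLeast0)
  then show ?thesis
    using sum_face_list[OF assms(1), of "\<lambda>\<sigma>. boundary_coeff \<sigma> (face_list i K ! s) * boundary_coeff \<sigma> (face_list i K ! t)" "i + 1"]
    by simp
qed

lemma up_laplacian_carrier:
  "up_laplacian i K \<in> carrier_mat (num_faces i K) (num_faces i K)"
  by (intro carrier_matI) (simp_all add: up_laplacian_def boundary_matrix_def)

lemma up_laplacian_symmetric:
  assumes "abstract_simplicial_complex V K"
  shows "(up_laplacian i K)\<^sup>T = up_laplacian i K"
proof (rule eq_matI)
  fix s t assume "s < dim_row (up_laplacian i K)" "t < dim_col (up_laplacian i K)"
  then have "s < num_faces i K" "t < num_faces i K" using up_laplacian_carrier[of i K] by auto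
  then show "(up_laplacian i K)\<^sup>T $$ (s, t) = up_laplacian i K $$ (s, t)"
    using up_laplacian_carrier[of i K] by (simp add: up_laplacian_entry[OF assms] mult.commute)
qed (use up_laplacian_carrier[of i K] in auto)

text \<open>The last property is the Rayleigh quotient: for a unit eigenvector \<open>x\<close> of
  \<open>B * B\<^sup>T\<close>, the eigenvalue is the squared norm of \<open>B\<^sup>T x\<close>,
  with one coordinate for each face of the next dimension.\<close>

lemma up_laplacian_eigenbasis:
  assumes K: "abstract_simplicial_complex V K"
  obtains x :: "nat \<Rightarrow> nat \<Rightarrow> real" where
    "\<And>s t. s < num_faces i K \<Longrightarrow> t < num_faces i K \<Longrightarrow> (\<Sum>j<num_faces i K. x s j * x t j) = of_bool (s = t)"
    "\<And>s t. s < num_faces i K \<Longrightarrow> t < num_faces i K \<Longrightarrow>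
      (\<Sum>j<num_faces i K. up_laplacian i K $$ (t, j) * x s j) = up_eigenvalue i (Suc s) K * x s t"
    "\<And>s. s < num_faces i K \<Longrightarrow> up_eigenvalue i (Suc s) K =
      (\<Sum>\<sigma>\<in>faces (i + 1) K. (\<Sum>j<num_faces i K. x s j * boundary_coeff \<sigma> (face_list i K ! j))\<^sup>2)"
proof -
  let ?N = "num_faces i K" and ?A = "up_laplacian i K" and ?c = "\<lambda>\<sigma> j. boundary_coeff \<sigma> (face_list i K ! j)"
  obtain x :: "nat \<Rightarrow> nat \<Rightarrow> real" where
    orth: "\<And>s t. s < ?N \<Longrightarrow> t < ?N \<Longrightarrow> (\<Sum>j<?N. x s j * x t j) = of_bool (s = t)"
    and ev: "\<And>s t. s < ?N \<Longrightarrow> t < ?N \<Longrightarrow> (\<Sum>j<?N. ?A $$ (t, j) * x s j) = eigenvalues_desc ?A ! s * x s t"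
    by (rule eigenvalues_desc_eigenbasis[OF up_laplacian_carrier up_laplacian_symmetric[OF K]]) blast
  have lam: "up_eigenvalue i (Suc s) K = eigenvalues_desc ?A ! s" if "s < ?N" for s
    using that by (simp add: up_eigenvalue_def)
  show ?thesis
  proof (rule that[of x])
    show "(\<Sum>j<?N. x s j * x t j) = of_bool (s = t)" if "s < ?N" "t < ?N" for s t
      by (rule orth[OF that])
    show "(\<Sum>j<?N. ?A $$ (t, j) * x s j) = up_eigenvalue i (Suc s) K * x s t" if "s < ?N" "t < ?N" for s t
      using ev[OF that] lam[OF that(1)] by simp
    show "up_eigenvalue i (Suc s) K = (\<Sum>\<sigma>\<in>faces (i + 1) K. (\<Sum>j<?N. x s j * ?c \<sigma> j)\<^sup>2)" if s: "s < ?N" for s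
    proof -
      have "up_eigenvalue i (Suc s) K = (\<Sum>t<?N. x s t * (eigenvalues_desc ?A ! s * x s t))"
        using orth[OF s s] lam[OF s] by (simp add: mult.left_commute[of _ "eigenvalues_desc ?A ! s"] sum_distrib_left[symmetric])
      also have "\<dots> = (\<Sum>t<?N. \<Sum>j<?N. \<Sum>\<sigma>\<in>faces (i + 1) K. (x s t * ?c \<sigma> t) * (x s j * ?c \<sigma> j))"
      proof (rule sum.cong[OF refl])
        fix t assume "t \<in> {..<?N}"
        then have t: "t < ?N" by simp
        show "x s t * (eigenvalues_desc ?A ! s * x s t) = (\<Sum>j<?N. \<Sum>\<sigma>\<in>faces (i + 1) K. (x s t * ?c \<sigma> t) * (x s j * ?c \<sigma> j))"
          unfolding ev[OF s t, symmetric] sum_distrib_left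
          by (rule sum.cong[OF refl]) (simp add: up_laplacian_entry[OF K t] sum_distrib_left sum_distrib_right mult_ac)
      qed
      also have "\<dots> = (\<Sum>t<?N. \<Sum>\<sigma>\<in>faces (i + 1) K. \<Sum>j<?N. (x s t * ?c \<sigma> t) * (x s j * ?c \<sigma> j))"
        by (rule sum.cong[OF refl], rule sum.swap)
      also have "\<dots> = (\<Sum>\<sigma>\<in>faces (i + 1) K. \<Sum>t<?N. \<Sum>j<?N. (x s t * ?c \<sigma> t) * (x s j * ?c \<sigma> j))"
        by (rule sum.swap)
      finally show ?thesis by (simp add: power2_eq_square sum_product)
    qed
  qed
qed

text \<open>Eigenvalues with an index above the number of faces are 0 by convention, so the sum is
  truncated to those that have an eigenvector.\<close>

lemma sum_up_eigenvalue:
  "(\<Sum>j=1..l. up_eigenvalue i j K) = (\<Sum>s<min l (num_faces i K). up_eigenvalue i (Suc s) K)"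
proof -
  have "(\<Sum>j=1..l. up_eigenvalue i j K) = (\<Sum>s<l. up_eigenvalue i (Suc s) K)"
    using sum.shift_bounds_cl_Suc_ivl[of "\<lambda>j. up_eigenvalue i j K" 0 "l - 1"]
    by (cases l) (simp_all add: sum.atLeast_Suc_atMost_Suc_shift lessThan_Suc_atMost atLeast0AtMost)
  also have "\<dots> = (\<Sum>s<min l (num_faces i K). up_eigenvalue i (Suc s) K)"
    by (rule sum.mono_neutral_right) (auto simp: up_eigenvalue_def)
  finally show ?thesis .
qed

section \<open>Coefficients of the boundary map\<close>

lemma boundary_coeff_facet:
  assumes "finite \<sigma>" "j < card \<sigma>"
  shows "boundary_coeff \<sigma> (\<sigma> - {sorted_list_of_set \<sigma> ! j}) = (-1) ^ j"
proof -
  let ?v = "\<lambda>j. sorted_list_of_set \<sigma> ! j"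
  have mem: "?v j' \<in> \<sigma>" if "j' < card \<sigma>" for j'
    using that assms nth_mem[of j' "sorted_list_of_set \<sigma>"] by simp
  have "\<sigma> - {?v j} = \<sigma> - {?v j'} \<longleftrightarrow> j = j'" if "j' < card \<sigma>" for j'
  proof
    assume "\<sigma> - {?v j} = \<sigma> - {?v j'}"
    then have "?v j = ?v j'" using mem[OF that] mem[OF assms(2)] by blast
    then show "j = j'" using that assms by (simp add: nth_eq_iff_index_eq)
  qed simp
  then have "boundary_coeff \<sigma> (\<sigma> - {?v j}) = (\<Sum>j'<card \<sigma>. if j' = j then (-1) ^ j' else 0)"
    unfolding boundary_coeff_def by (intro sum.cong refl) auto
  then show ?thesis using assms by simp
qed

lemma boundary_coeff_non_facet:
  assumes "finite \<sigma>" "\<And>v. v \<in> \<sigma> \<Longrightarrow> \<tau> \<noteq> \<sigma> - {v}"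
  shows "boundary_coeff \<sigma> \<tau> = 0"
  unfolding boundary_coeff_def
proof (rule sum.neutral, rule ballI)
  fix j assume "j \<in> {..<card \<sigma>}"
  then have "sorted_list_of_set \<sigma> ! j \<in> \<sigma>" using assms nth_mem[of j "sorted_list_of_set \<sigma>"] by simp
  then show "(-1) ^ j * of_bool (\<tau> = \<sigma> - {sorted_list_of_set \<sigma> ! j}) = (0::real)" using assms(2) by simp
qed

lemma abs_boundary_coeff_le:
  assumes "finite \<sigma>"
  shows "\<bar>boundary_coeff \<sigma> \<tau>\<bar> \<le> of_bool (\<exists>v\<in>\<sigma>. \<tau> = \<sigma> - {v})"
proof (cases "\<exists>v\<in>\<sigma>. \<tau> = \<sigma> - {v}")
  case True
  then obtain v where v: "v \<in> \<sigma>" "\<tau> = \<sigma> - {v}" by blast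
  then obtain j where "j < card \<sigma>" "sorted_list_of_set \<sigma> ! j = v"
    using assms by (metis in_set_conv_nth set_sorted_list_of_set length_sorted_list_of_set)
  then show ?thesis using boundary_coeff_facet[OF assms, of j] v by auto
next
  case False
  then show ?thesis using boundary_coeff_non_facet[OF assms, of \<tau>] by auto
qed

lemma boundary_coeff_edge:
  assumes "a < b"
  shows "boundary_coeff {a, b} \<tau> = of_bool (\<tau> = {b}) - of_bool (\<tau> = {a})"
proof -
  have "sorted_list_of_set {a, b} = [a, b]" using assms by (subst sorted_list_of_set_insert) auto
  moreover have "card {a, b} = 2" "{a, b} - {a} = {b}" "{a, b} - {b} = {a}" using assms by auto
  ultimately show ?thesis unfolding boundary_coeff_def by (simp add: numeral_2_eq_2)
qed

lemma choose_two_real: "real (m choose 2) = real m * (real m - 1) / 2"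
  by (cases m) (simp_all add: choose_two real_of_nat_div algebra_simps)

lemma facesD:
  assumes "\<sigma> \<in> faces (int m) K"
  shows "\<sigma> \<in> K" "card \<sigma> = Suc m" "finite \<sigma>"
proof -
  have "int (card \<sigma>) = int m + 1" using assms by (simp add: faces_def)
  then show "card \<sigma> = Suc m" by linarith
  then show "finite \<sigma>" by (metis card.infinite nat.distinct(1))
  show "\<sigma> \<in> K" using assms by (simp add: faces_def)
qed

text \<open>Equal cardinality rules out proper containment, so \<open>v'\<close> is a new vertex and
  the shared facet is the whole intersection.\<close>

lemma common_facet:
  assumes "finite \<sigma>" "finite \<sigma>'" "card \<sigma> = card \<sigma>'" "\<sigma> \<noteq> \<sigma>'" "v \<in> \<sigma>" "v' \<in> \<sigma>'"
    and "\<sigma> - {v} = \<sigma>' - {v'}"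
  shows "\<sigma> - {v} = \<sigma> \<inter> \<sigma>'" "v' \<notin> \<sigma>" "\<sigma>' = insert v' (\<sigma> - {v})"
proof -
  show 1: "\<sigma>' = insert v' (\<sigma> - {v})" using assms by blast
  show "v' \<notin> \<sigma>"
  proof
    assume "v' \<in> \<sigma>"
    then have "\<sigma>' \<subseteq> \<sigma>" using 1 by blast
    then show False using assms card_subset_eq by metis
  qed
  then show "\<sigma> - {v} = \<sigma> \<inter> \<sigma>'" using 1 assms by blast
qed

text \<open>A neighbouring \<open>r\<close>-face is \<open>\<sigma> - {v} \<union> {w}\<close>, so the number of neighbours is at most
  \<open>(r + 1) |W|\<close>, and each \<open>w \<in> W\<close> contributes at least \<open>r (r - 1) / 2\<close> faces of dimension \<open>r - 2\<close>.\<close>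

lemma gram_row_bound:
  fixes K :: "'a::linorder set set"
  assumes K: "abstract_simplicial_complex V K" and r: "r \<ge> 2" and \<sigma>: "\<sigma> \<in> faces (int r) K"
  shows "(\<Sum>\<sigma>'\<in>faces (int r) K. (\<Sum>\<rho>\<in>faces (int r - 1) K. boundary_coeff \<sigma> \<rho> * boundary_coeff \<sigma>' \<rho>)\<^sup>2)
    \<le> 2 * (real r + 1) / real r * real (num_faces (int r - 2) K)"
proof -
  note fin = abstract_simplicial_complex_finite[OF K]
  define ip where "ip \<sigma>' = (\<Sum>\<rho>\<in>faces (int r - 1) K. boundary_coeff \<sigma> \<rho> * boundary_coeff \<sigma>' \<rho>)" for \<sigma>'
  define W where "W = {w \<in> V - \<sigma>. \<exists>u\<in>\<sigma>. insert w (\<sigma> - {u}) \<in> K}"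
  have finW: "finite W" using K by (simp add: W_def abstract_simplicial_complex_def)
  have cs: "card \<sigma> = Suc r" "finite \<sigma>" "\<sigma> \<in> K" using facesD[OF \<sigma>] by auto
  have ip_le: "\<bar>ip \<sigma>'\<bar> \<le> real (card {\<rho>. (\<exists>v\<in>\<sigma>. \<rho> = \<sigma> - {v}) \<and> (\<exists>v\<in>\<sigma>'. \<rho> = \<sigma>' - {v})})"
    if "\<sigma>' \<in> faces (int r) K" for \<sigma>'
  proof -
    let ?C = "{\<rho>. (\<exists>v\<in>\<sigma>. \<rho> = \<sigma> - {v}) \<and> (\<exists>v\<in>\<sigma>'. \<rho> = \<sigma>' - {v})}"
    have finC: "finite ?C" by (rule finite_subset[of _ "(\<lambda>v. \<sigma> - {v}) ` \<sigma>"]) (use cs in auto)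
    have "\<bar>ip \<sigma>'\<bar> \<le> (\<Sum>\<rho>\<in>faces (int r - 1) K. of_bool (\<rho> \<in> ?C))"
      unfolding ip_def
    proof (rule order_trans[OF sum_abs], rule sum_mono)
      fix \<rho>
      have "\<bar>boundary_coeff \<sigma> \<rho>\<bar> * \<bar>boundary_coeff \<sigma>' \<rho>\<bar>
        \<le> of_bool (\<exists>v\<in>\<sigma>. \<rho> = \<sigma> - {v}) * of_bool (\<exists>v\<in>\<sigma>'. \<rho> = \<sigma>' - {v})"
        by (intro mult_mono abs_boundary_coeff_le) (use cs facesD[OF that] in auto)
      then show "\<bar>boundary_coeff \<sigma> \<rho> * boundary_coeff \<sigma>' \<rho>\<bar> \<le> of_bool (\<rho> \<in> ?C)"
        by (simp add: abs_mult of_bool_conj)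
    qed
    also have "\<dots> = real (card (faces (int r - 1) K \<inter> ?C))"
      using fin(3) by (simp add: of_bool_def sum.If_cases)
    also have "\<dots> \<le> real (card ?C)" using finC by (simp add: card_mono)
    finally show ?thesis .
  qed
  have ip_self: "(ip \<sigma>)\<^sup>2 \<le> (real r + 1)\<^sup>2"
  proof -
    have "{\<rho>. (\<exists>v\<in>\<sigma>. \<rho> = \<sigma> - {v}) \<and> (\<exists>v\<in>\<sigma>. \<rho> = \<sigma> - {v})} = (\<lambda>v. \<sigma> - {v}) ` \<sigma>" by auto
    then have "\<bar>ip \<sigma>\<bar> \<le> real (card ((\<lambda>v. \<sigma> - {v}) ` \<sigma>))" using ip_le[OF \<sigma>] by simp
    also have "\<dots> \<le> real (card \<sigma>)" using card_image_le[OF cs(2), of "\<lambda>v. \<sigma> - {v}"] by simp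
    finally show ?thesis using cs by (simp add: abs_le_square_iff[symmetric])
  qed
  define N where "N = (\<lambda>(v, w). insert w (\<sigma> - {v})) ` (\<sigma> \<times> W)"
  have finN: "finite N" using finW cs by (simp add: N_def)
  \<comment> \<open>Two distinct faces of equal dimension share at most one facet, so at most one
    product is nonzero, and it is 1 or -1.\<close>
  have ip_other: "(ip \<sigma>')\<^sup>2 \<le> of_bool (\<sigma>' \<in> N)" if \<sigma>': "\<sigma>' \<in> faces (int r) K" "\<sigma>' \<noteq> \<sigma>" for \<sigma>'
  proof -
    let ?C = "{\<rho>. (\<exists>v\<in>\<sigma>. \<rho> = \<sigma> - {v}) \<and> (\<exists>v\<in>\<sigma>'. \<rho> = \<sigma>' - {v})}"
    note cs' = facesD[OF \<sigma>'(1)]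
    have *: "\<rho> = \<sigma> \<inter> \<sigma>' \<and> \<sigma>' \<in> N" if "\<rho> \<in> ?C" for \<rho>
    proof -
      obtain v v' where v: "v \<in> \<sigma>" "\<rho> = \<sigma> - {v}" "v' \<in> \<sigma>'" "\<rho> = \<sigma>' - {v'}" using \<open>\<rho> \<in> ?C\<close> by blast
      have c: "\<sigma> - {v} = \<sigma> \<inter> \<sigma>'" "v' \<notin> \<sigma>" "\<sigma>' = insert v' (\<sigma> - {v})"
        using common_facet[of \<sigma> \<sigma>' v v'] v cs cs' \<sigma>'(2) by auto
      have "v' \<in> V" using cs'(1) v(3) K by (auto simp: abstract_simplicial_complex_def)
      then have "v' \<in> W" unfolding W_def using c v cs'(1) by auto
      then show ?thesis unfolding N_def using c v by auto
    qed
    have "\<bar>ip \<sigma>'\<bar> \<le> of_bool (\<sigma>' \<in> N)"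
    proof (cases "?C = {}")
      case True
      then show ?thesis using ip_le[OF \<sigma>'(1)] by (simp only: card.empty) simp
    next
      case False
      then obtain \<rho> where "\<rho> \<in> ?C" by blast
      then have N: "\<sigma>' \<in> N" using * by blast
      have "?C \<subseteq> {\<sigma> \<inter> \<sigma>'}" using * by blast
      then have "card ?C \<le> card {\<sigma> \<inter> \<sigma>'}" by (intro card_mono) auto
      then have "real (card ?C) \<le> 1" by simp
      then have "\<bar>ip \<sigma>'\<bar> \<le> 1" using ip_le[OF \<sigma>'(1)] by linarith
      then show ?thesis using N by simp
    qed
    then show ?thesis by (auto simp: abs_square_le_1 split: if_splits)
  qed
  have "(\<Sum>\<sigma>'\<in>faces (int r) K. (ip \<sigma>')\<^sup>2) = (ip \<sigma>)\<^sup>2 + (\<Sum>\<sigma>'\<in>faces (int r) K - {\<sigma>}. (ip \<sigma>')\<^sup>2)"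
    by (rule sum.remove[OF fin(3) \<sigma>])
  also have "\<dots> \<le> (real r + 1)\<^sup>2 + (\<Sum>\<sigma>'\<in>faces (int r) K - {\<sigma>}. of_bool (\<sigma>' \<in> N))"
    by (intro add_mono ip_self sum_mono ip_other) auto
  also have "(\<Sum>\<sigma>'\<in>faces (int r) K - {\<sigma>}. of_bool (\<sigma>' \<in> N)) = real (card ((faces (int r) K - {\<sigma>}) \<inter> N))"
    using fin(3) by (simp add: of_bool_def sum.If_cases)
  also have "\<dots> \<le> real (card N)" using finN by (simp add: card_mono)
  also have "card N \<le> card (\<sigma> \<times> W)" unfolding N_def using cs finW by (intro card_image_le) simp
  finally have gram: "(\<Sum>\<sigma>'\<in>faces (int r) K. (ip \<sigma>')\<^sup>2) \<le> (real r + 1)\<^sup>2 + (real r + 1) * real (card W)"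
    using cs by (simp add: card_cartesian_product algebra_simps)
  have "\<forall>w\<in>W. \<exists>u. u \<in> \<sigma> \<and> insert w (\<sigma> - {u}) \<in> K" by (auto simp: W_def)
  then obtain u where u: "\<And>w. w \<in> W \<Longrightarrow> u w \<in> \<sigma> \<and> insert w (\<sigma> - {u w}) \<in> K" by metis
  define T0 where "T0 = {\<tau>. \<tau> \<subseteq> \<sigma> \<and> card \<tau> = r - 1}"
  \<comment> \<open>For each \<open>w\<close> one neighbour is fixed, and its
    \<open>(r - 2)\<close>-faces through \<open>w\<close> are taken; these have \<open>r - 1\<close>
    vertices, of which \<open>r - 2\<close> are in \<open>\<sigma>\<close>. Each meets the
    complement of \<open>\<sigma>\<close> in \<open>{w}\<close> only, so the families are disjoint
    from each other and from \<open>T0\<close>.\<close>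
  define T where "T w = insert w ` {\<kappa>. \<kappa> \<subseteq> \<sigma> - {u w} \<and> card \<kappa> = r - 2}" for w
  have r2: "int r - 2 + 1 = int (r - 1)" using r by simp
  have T0: "T0 \<subseteq> faces (int r - 2) K"
    unfolding T0_def faces_def r2 using abstract_simplicial_complex_subset[OF K cs(3)] by auto
  have wn: "w \<notin> \<sigma>" if "w \<in> W" for w using that by (simp add: W_def)
  have T: "T w \<subseteq> faces (int r - 2) K" if w: "w \<in> W" for w
  proof
    fix \<tau> assume "\<tau> \<in> T w"
    then obtain \<kappa> where \<kappa>: "\<kappa> \<subseteq> \<sigma> - {u w}" "card \<kappa> = r - 2" "\<tau> = insert w \<kappa>" unfolding T_def by blast
    have "\<tau> \<in> K" using abstract_simplicial_complex_subset[OF K, of "insert w (\<sigma> - {u w})" \<tau>] u[OF w] \<kappa> by auto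
    moreover have "finite \<kappa>" "w \<notin> \<kappa>" using \<kappa>(1) cs wn[OF w] by (auto intro: finite_subset)
    ultimately show "\<tau> \<in> faces (int r - 2) K" unfolding faces_def r2 using \<kappa> r by simp
  qed
  have cT0: "card T0 = Suc r choose 2"
  proof -
    have "card T0 = Suc r choose (r - 1)" unfolding T0_def using n_subsets[OF cs(2), of "r - 1"] cs by simp
    also have "\<dots> = Suc r choose (Suc r - (r - 1))" by (rule binomial_symmetric) simp
    also have "Suc r - (r - 1) = 2" using r by simp
    finally show ?thesis .
  qed
  have cT: "card (T w) = r choose 2" if w: "w \<in> W" for w
  proof -
    have "inj_on (insert w) {\<kappa>. \<kappa> \<subseteq> \<sigma> - {u w} \<and> card \<kappa> = r - 2}"
      using wn[OF w] by (auto simp: inj_on_def)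
    then have "card (T w) = card {\<kappa>. \<kappa> \<subseteq> \<sigma> - {u w} \<and> card \<kappa> = r - 2}" unfolding T_def by (rule card_image)
    also have "\<dots> = card (\<sigma> - {u w}) choose (r - 2)" using cs by (intro n_subsets) simp
    also have "card (\<sigma> - {u w}) = r" using cs u[OF w] by simp
    also have "r choose (r - 2) = r choose (r - (r - 2))" by (rule binomial_symmetric) simp
    also have "r - (r - 2) = 2" using r by simp
    finally show ?thesis .
  qed
  have meet: "\<tau> - \<sigma> = {w}" if "\<tau> \<in> T w" "w \<in> W" for \<tau> w
    using that wn unfolding T_def by auto
  have disj: "T w \<inter> T w' = {}" if "w \<in> W" "w' \<in> W" "w \<noteq> w'" for w w'
  proof (rule equals0I)
    fix \<tau> assume "\<tau> \<in> T w \<inter> T w'"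
    then have "\<tau> - \<sigma> = {w}" "\<tau> - \<sigma> = {w'}" using meet that by blast+
    then show False using that(3) by simp
  qed
  have disj0: "T0 \<inter> (\<Union>w\<in>W. T w) = {}"
  proof (rule equals0I)
    fix \<tau> assume "\<tau> \<in> T0 \<inter> (\<Union>w\<in>W. T w)"
    then obtain w where w: "w \<in> W" "\<tau> \<in> T w" and "\<tau> \<subseteq> \<sigma>" unfolding T0_def by blast
    then have "\<tau> - \<sigma> = {}" by blast
    then show False using meet[OF w(2,1)] by simp
  qed
  have finF: "finite (faces (int r - 2) K)" by (rule fin(3))
  have "card T0 + (\<Sum>w\<in>W. card (T w)) = card (T0 \<union> (\<Union>w\<in>W. T w))"
    using T0 T disj disj0 finW finite_subset[OF _ finF]
    by (subst card_Un_disjoint) (auto simp: card_UN_disjoint)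
  also have "\<dots> \<le> num_faces (int r - 2) K"
    unfolding num_faces_def by (rule card_mono[OF finF]) (use T0 T in auto)
  finally have "(Suc r choose 2) + card W * (r choose 2) \<le> num_faces (int r - 2) K"
    using cT0 cT by simp
  then have F: "real (Suc r choose 2) + real (card W) * real (r choose 2) \<le> real (num_faces (int r - 2) K)"
    by (metis of_nat_add of_nat_le_iff of_nat_mult)
  have rpos: "real r > 0" using r by simp
  \<comment> \<open>Here \<open>r \<ge> 2\<close> enters, as \<open>r - 1 \<ge> 1\<close>: for
    \<open>r = 1\<close> a vertex \<open>w\<close> would contribute \<open>r choose 2 = 0\<close>
    faces.\<close>
  have "(real r + 1)\<^sup>2 + (real r + 1) * real (card W)
    \<le> (real r + 1)\<^sup>2 + (real r + 1) * (real (card W) * (real r - 1))"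
    using r by (intro add_left_mono mult_left_mono) (simp_all add: mult_le_cancel_left1)
  also have "\<dots> = 2 * (real r + 1) / real r * (real (Suc r choose 2) + real (card W) * real (r choose 2))"
    unfolding choose_two_real using rpos by (simp add: field_simps power2_eq_square)
  also have "\<dots> \<le> 2 * (real r + 1) / real r * real (num_faces (int r - 2) K)"
    using F rpos by (intro mult_left_mono) auto
  finally show ?thesis using gram unfolding ip_def by linarith
qed

text \<open>In \<open>gerzon_eigenvalue_bound\<close>, taking \<open>q = r + 1\<close> produces the
  first term and cancels the factor \<open>r + 1\<close> of the row-sum bound
  \<open>\<Lambda>\<close> in the second.\<close>

lemma higher_dimensional_bound:
  fixes K :: "'a::linorder set set"
  assumes K: "abstract_simplicial_complex V K" and r: "r \<ge> 2"
  shows "(\<Sum>i=1..l. up_eigenvalue (int r - 1) i K)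
    \<le> (real r + 1) / 2 * real (num_faces (int r) K)
      + real (num_faces (int r - 2) K) / real r * real ((l + 1) choose 2)"
proof -
  let ?N = "num_faces (int r - 1) K" and ?F = "num_faces (int r - 2) K"
  let ?c = "\<lambda>\<sigma> j. boundary_coeff \<sigma> (face_list (int r - 1) K ! j)"
  define \<Lambda> where "\<Lambda> = 2 * (real r + 1) / real r * real ?F"
  define l' where "l' = min l ?N"
  have dim: "int r - 1 + 1 = int r" by simp
  obtain x :: "nat \<Rightarrow> nat \<Rightarrow> real" where
    orth: "\<And>s t. s < ?N \<Longrightarrow> t < ?N \<Longrightarrow> (\<Sum>j<?N. x s j * x t j) = of_bool (s = t)"
    and lam': "\<And>s. s < ?N \<Longrightarrow> up_eigenvalue (int r - 1) (Suc s) K =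
      (\<Sum>\<sigma>\<in>faces (int r - 1 + 1) K. (\<Sum>j<?N. x s j * ?c \<sigma> j)\<^sup>2)"
    by (rule up_laplacian_eigenbasis[OF K, of "int r - 1"]) blast
  note lam = lam'[unfolded dim]
  have eq: "(\<Sum>i=1..l. up_eigenvalue (int r - 1) i K)
    = (\<Sum>s<l'. \<Sum>\<sigma>\<in>faces (int r) K. (\<Sum>j<?N. x s j * ?c \<sigma> j)\<^sup>2)"
    unfolding sum_up_eigenvalue l'_def by (intro sum.cong refl lam) auto
  have cancel: "2 * q / R * F * L / (4 * q) = F / R * (L / 2)" if "q > 0" "R > 0" for q R F L :: real
    using that by (simp add: field_simps)
  have nonneg: "0 \<le> real ?F / real r * real ((l + 1) choose 2)" by simp
  show ?thesis
  proof (cases "?F = 0")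
    case True
    \<comment> \<open>This case is separate because the Gerzon bound needs
      \<open>\<Lambda> > 0\<close>. Every \<open>r\<close>-face contains an
      \<open>(r - 2)\<close>-face, so there are none and the left-hand side is 0.\<close>
    have "faces (int r) K = {}"
    proof (rule ccontr)
      assume "faces (int r) K \<noteq> {}"
      then obtain \<sigma> where \<sigma>: "\<sigma> \<in> faces (int r) K" by blast
      have "r - 1 \<le> card \<sigma>" using facesD(2)[OF \<sigma>] by simp
      then obtain \<tau> where \<tau>: "\<tau> \<subseteq> \<sigma>" "card \<tau> = r - 1"
        by (rule obtain_subset_with_card_n)
      then have "\<tau> \<in> faces (int r - 2) K"
        using abstract_simplicial_complex_subset[OF K facesD(1)[OF \<sigma>]] r by (auto simp: faces_def)
      then show False using True abstract_simplicial_complex_finite(3)[OF K] by (auto simp: num_faces_def)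
    qed
    then show ?thesis unfolding eq using nonneg by simp
  next
    case False
    then have L: "\<Lambda> > 0" using r by (simp add: \<Lambda>_def)
    have "(\<Sum>s<l'. \<Sum>\<sigma>\<in>faces (int r) K. (\<Sum>j<?N. x s j * ?c \<sigma> j)\<^sup>2)
      \<le> (real r + 1) / 2 * real (card (faces (int r) K)) + \<Lambda> * (real l' * (real l' + 1)) / (4 * (real r + 1))"
    proof (rule gerzon_eigenvalue_bound)
      show "(\<Sum>\<sigma>'\<in>faces (int r) K. (\<Sum>j<?N. ?c \<sigma> j * ?c \<sigma>' j)\<^sup>2) \<le> \<Lambda>" if "\<sigma> \<in> faces (int r) K" for \<sigma>
        using gram_row_bound[OF K r that]
          sum_face_list[OF K, of "\<lambda>\<rho>. boundary_coeff \<sigma> \<rho> * boundary_coeff \<sigma>' \<rho>" "int r - 1" for \<sigma>']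
        by (simp add: \<Lambda>_def)
      show "(\<Sum>j<?N. x s j * x t j) = of_bool (s = t)" if "s < l'" "t < l'" for s t
        using orth[of s t] that by (simp add: l'_def)
    qed (use L abstract_simplicial_complex_finite(3)[OF K] in auto)
    also have "\<Lambda> * (real l' * (real l' + 1)) / (4 * (real r + 1)) = real ?F / real r * (real l' * (real l' + 1) / 2)"
      unfolding \<Lambda>_def by (rule cancel) (use r in auto)
    also have "real ?F / real r * (real l' * (real l' + 1) / 2) \<le> real ?F / real r * (real l * (real l + 1) / 2)"
      by (intro mult_left_mono divide_right_mono mult_mono) (auto simp: l'_def)
    also have "real l * (real l + 1) / 2 = real ((l + 1) choose 2)"
      unfolding choose_two_real by simp
    finally show ?thesis unfolding eq by (simp add: num_faces_def)
  qed
qed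

text \<open>The up-Laplacian in dimension 0 is the Laplacian of the graph formed by the vertices and
  edges of \<open>K\<close>, so the positive eigenvalues among the first \<open>l\<close> fall under
  \<open>graph_eigenvectors\<close>.\<close>

lemma graph_bound:
  fixes K :: "'a::linorder set set"
  assumes K: "abstract_simplicial_complex V K"
  shows "(\<Sum>i=1..l. up_eigenvalue 0 i K) \<le> real (num_faces 1 K) + real ((l + 1) choose 2)"
proof -
  let ?N = "num_faces 0 K"
  let ?c = "\<lambda>\<sigma> j. boundary_coeff \<sigma> (face_list 0 K ! j)" and ?A = "up_laplacian 0 K"
  note fin = abstract_simplicial_complex_finite[OF K]
  obtain x :: "nat \<Rightarrow> nat \<Rightarrow> real" where
    orth: "\<And>s t. s < ?N \<Longrightarrow> t < ?N \<Longrightarrow> (\<Sum>j<?N. x s j * x t j) = of_bool (s = t)"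
    and ev: "\<And>s t. s < ?N \<Longrightarrow> t < ?N \<Longrightarrow> (\<Sum>j<?N. ?A $$ (t, j) * x s j) = up_eigenvalue 0 (Suc s) K * x s t"
    and lam: "\<And>s. s < ?N \<Longrightarrow> up_eigenvalue 0 (Suc s) K = (\<Sum>\<sigma>\<in>faces (0 + 1) K. (\<Sum>j<?N. x s j * ?c \<sigma> j)\<^sup>2)"
    by (rule up_laplacian_eigenbasis[OF K]) blast
  have lam0: "up_eigenvalue 0 (Suc s) K \<ge> 0" if "s < ?N" for s
    unfolding lam[OF that] by (intro sum_nonneg) simp
  have edge: "\<exists>a b. a < b \<and> \<sigma> = {a, b}" if "\<sigma> \<in> faces 1 K" for \<sigma>
  proof -
    have "card \<sigma> = 2" using facesD(2)[of \<sigma> 1 K] that by simp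
    then obtain a b where "\<sigma> = {a, b}" "a \<noteq> b" by (auto simp: card_2_iff)
    then show ?thesis by (metis insert_commute neqE)
  qed
  have vertex: "\<exists>v. face_list 0 K ! t = {v} \<and> {v} \<in> K" if "t < ?N" for t
  proof -
    have "face_list 0 K ! t \<in> faces 0 K" using that face_list[OF K, of 0] nth_mem by metis
    then show ?thesis using facesD[of "face_list 0 K ! t" 0 K] by (auto simp: card_Suc_eq)
  qed
  have pair_sum: "(\<Sum>\<rho>\<in>faces 0 K. of_bool (\<rho> = {b}) - of_bool (\<rho> = {a})) = (0::real)"
    "(\<Sum>\<rho>\<in>faces 0 K. (of_bool (\<rho> = {b}) - of_bool (\<rho> = {a}))\<^sup>2) = (2::real)"
    if "a < b" "{a, b} \<in> K" for a b
  proof -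
    have mem: "{a} \<in> faces 0 K" "{b} \<in> faces 0 K"
      using abstract_simplicial_complex_subset[OF K that(2)] by (auto simp: faces_def)
    have s: "(\<Sum>\<rho>\<in>faces 0 K. of_bool (\<rho> = {v})) = (1::real)" if "{v} \<in> faces 0 K" for v
      using that fin(3) by (simp add: of_bool_def)
    show "(\<Sum>\<rho>\<in>faces 0 K. of_bool (\<rho> = {b}) - of_bool (\<rho> = {a})) = (0::real)"
      unfolding sum_subtractf s[OF mem(1)] s[OF mem(2)] by simp
    have "(\<Sum>\<rho>\<in>faces 0 K. (of_bool (\<rho> = {b}) - of_bool (\<rho> = {a}))\<^sup>2)
      = (\<Sum>\<rho>\<in>faces 0 K. of_bool (\<rho> = {b}) + of_bool (\<rho> = {a}) :: real)"
      using that(1) by (intro sum.cong refl) (auto simp: of_bool_def)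
    also have "\<dots> = 2" unfolding sum.distrib s[OF mem(1)] s[OF mem(2)] by simp
    finally show "(\<Sum>\<rho>\<in>faces 0 K. (of_bool (\<rho> = {b}) - of_bool (\<rho> = {a}))\<^sup>2) = (2::real)" .
  qed
  have csum: "(\<Sum>j<?N. ?c \<sigma> j) = 0" "(\<Sum>j<?N. (?c \<sigma> j)\<^sup>2) = 2" if \<sigma>: "\<sigma> \<in> faces 1 K" for \<sigma>
  proof -
    obtain a b where ab: "a < b" "\<sigma> = {a, b}" using edge[OF \<sigma>] by blast
    have "{a, b} \<in> K" using \<sigma> ab by (simp add: faces_def)
    note ps = pair_sum[OF ab(1) this]
    show "(\<Sum>j<?N. ?c \<sigma> j) = 0"
      using ps(1) sum_face_list[OF K, of "boundary_coeff \<sigma>" 0] by (simp add: ab boundary_coeff_edge)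
    show "(\<Sum>j<?N. (?c \<sigma> j)\<^sup>2) = 2"
      using ps(2) sum_face_list[OF K, of "\<lambda>\<rho>. (boundary_coeff \<sigma> \<rho>)\<^sup>2" 0] by (simp add: ab boundary_coeff_edge)
  qed
  have entry: "?A $$ (s, t) = (\<Sum>\<sigma>\<in>faces 1 K. ?c \<sigma> s * ?c \<sigma> t)" if "s < ?N" "t < ?N" for s t
    using up_laplacian_entry[OF K that] by simp
  define adj where "adj s t \<longleftrightarrow> s < ?N \<and> t < ?N \<and> s \<noteq> t \<and> face_list 0 K ! s \<union> face_list 0 K ! t \<in> K" for s t
  have sym: "adj s t \<longleftrightarrow> adj t s" for s t by (auto simp: adj_def Un_commute)
  have offdiag: "?A $$ (s, t) = - of_bool (adj s t)" if st: "s < ?N" "t < ?N" "s \<noteq> t" for s t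
  proof -
    obtain v where v: "face_list 0 K ! s = {v}" using vertex[OF st(1)] by blast
    obtain w where w: "face_list 0 K ! t = {w}" using vertex[OF st(2)] by blast
    have vw: "v \<noteq> w"
      using nth_eq_iff_index_eq[OF face_list(1)[OF K, of 0], of s t] st v w
      by (auto simp: face_list(3)[OF K])
    have prd: "?c \<sigma> s * ?c \<sigma> t = (if \<sigma> = {v, w} then - 1 else 0)" if \<sigma>: "\<sigma> \<in> faces 1 K" for \<sigma>
    proof -
      obtain a b where "a < b" "\<sigma> = {a, b}" using edge[OF \<sigma>] by blast
      then show ?thesis using vw unfolding v w by (auto simp: boundary_coeff_edge doubleton_eq_iff)
    qed
    have "?A $$ (s, t) = (\<Sum>\<sigma>\<in>faces 1 K. if \<sigma> = {v, w} then - 1 else 0)"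
      unfolding entry[OF st(1,2)] by (rule sum.cong[OF refl prd])
    also have "\<dots> = (if {v, w} \<in> faces 1 K then - 1 else 0)" using fin(3) by simp
    also have "{v, w} \<in> faces 1 K \<longleftrightarrow> adj s t"
      using vw st v w by (simp add: faces_def adj_def insert_commute)
    finally show ?thesis by simp
  qed
  have rowsum: "(\<Sum>j<?N. ?A $$ (t, j)) = 0" if t: "t < ?N" for t
  proof -
    have "(\<Sum>j<?N. ?A $$ (t, j)) = (\<Sum>j<?N. \<Sum>\<sigma>\<in>faces 1 K. ?c \<sigma> t * ?c \<sigma> j)"
      by (intro sum.cong refl) (simp add: entry t)
    also have "\<dots> = (\<Sum>\<sigma>\<in>faces 1 K. \<Sum>j<?N. ?c \<sigma> t * ?c \<sigma> j)" by (rule sum.swap)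
    also have "\<dots> = 0" by (simp add: sum_distrib_left[symmetric] csum)
    finally show ?thesis .
  qed
  \<comment> \<open>Vanishing row sums allow \<open>u t\<close> to be subtracted from every
    \<open>u j\<close>, after which the diagonal entry has no effect.\<close>
  have lap: "(\<Sum>j<?N. ?A $$ (t, j) * u j) = (\<Sum>j<?N. of_bool (adj t j) * (u t - u j))" if t: "t < ?N" for t u
  proof -
    have "(\<Sum>j<?N. ?A $$ (t, j) * u j) = (\<Sum>j<?N. ?A $$ (t, j) * u j) - (\<Sum>j<?N. ?A $$ (t, j)) * u t"
      by (simp add: rowsum[OF t])
    also have "\<dots> = (\<Sum>j<?N. ?A $$ (t, j) * u j - ?A $$ (t, j) * u t)"
      unfolding sum_distrib_right sum_subtractf ..
    also have "\<dots> = (\<Sum>j<?N. of_bool (adj t j) * (u t - u j))"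
    proof (rule sum.cong[OF refl])
      fix j assume "j \<in> {..<?N}"
      then show "?A $$ (t, j) * u j - ?A $$ (t, j) * u t = of_bool (adj t j) * (u t - u j)"
        using offdiag[OF t, of j] by (cases "j = t") (auto simp: algebra_simps)
    qed
    finally show ?thesis .
  qed
  \<comment> \<open>The degree of a vertex is its diagonal entry, since row sums vanish; the trace
    counts each edge twice.\<close>
  have count: "(\<Sum>i<?N. \<Sum>j<?N. of_bool (adj i j)) = 2 * real (num_faces 1 K)"
  proof -
    have "(\<Sum>j<?N. of_bool (adj i j)) = ?A $$ (i, i)" if i: "i < ?N" for i
    proof -
      have "0 = ?A $$ (i, i) + (\<Sum>j\<in>{..<?N} - {i}. ?A $$ (i, j))"
        using rowsum[OF i] sum.remove[of "{..<?N}" i "\<lambda>j. ?A $$ (i, j)"] i by simp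
      also have "(\<Sum>j\<in>{..<?N} - {i}. ?A $$ (i, j)) = - (\<Sum>j\<in>{..<?N} - {i}. of_bool (adj i j))"
        unfolding sum_negf[symmetric] using offdiag[OF i] by (intro sum.cong refl) auto
      also have "(\<Sum>j\<in>{..<?N} - {i}. of_bool (adj i j)) = (\<Sum>j<?N. of_bool (adj i j) :: real)"
        by (rule sum.mono_neutral_left) (auto simp: adj_def)
      finally show ?thesis by simp
    qed
    then have "(\<Sum>i<?N. \<Sum>j<?N. of_bool (adj i j)) = (\<Sum>i<?N. \<Sum>\<sigma>\<in>faces 1 K. (?c \<sigma> i)\<^sup>2)"
      by (intro sum.cong refl) (simp add: entry power2_eq_square)
    also have "\<dots> = (\<Sum>\<sigma>\<in>faces 1 K. \<Sum>i<?N. (?c \<sigma> i)\<^sup>2)" by (rule sum.swap)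
    also have "\<dots> = 2 * real (num_faces 1 K)" by (simp add: csum) (simp add: num_faces_def)
    finally show ?thesis .
  qed
  \<comment> \<open>The constant vector is in the kernel of the symmetric matrix, hence orthogonal
    to eigenvectors with nonzero eigenvalue.\<close>
  have zero: "(\<Sum>t<?N. x s t) = 0" if s: "s < ?N" and pos: "up_eigenvalue 0 (Suc s) K > 0" for s
  proof -
    have "up_eigenvalue 0 (Suc s) K * (\<Sum>t<?N. x s t) = (\<Sum>t<?N. \<Sum>j<?N. ?A $$ (t, j) * x s j)"
      unfolding sum_distrib_left by (intro sum.cong refl) (simp add: ev s)
    also have "\<dots> = (\<Sum>j<?N. \<Sum>t<?N. ?A $$ (t, j) * x s j)" by (rule sum.swap)
    also have "\<dots> = (\<Sum>j<?N. \<Sum>t<?N. ?A $$ (j, t) * x s j)"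
      by (intro sum.cong refl) (simp add: entry mult.commute)
    also have "\<dots> = 0" by (simp add: sum_distrib_right[symmetric] rowsum)
    finally show ?thesis using pos by simp
  qed
  \<comment> \<open>Zero eigenvalues add nothing to the sum, and their eigenvectors need not be
    orthogonal to the constants. Dropping them leaves \<open>k \<le> l\<close> eigenvectors, and the
    bound is monotone in \<open>k\<close>.\<close>
  define T where "T = {s. s < min l ?N \<and> up_eigenvalue 0 (Suc s) K > 0}"
  define k where "k = card T"
  have finT: "finite T" by (simp add: T_def)
  have kl: "k \<le> l" unfolding k_def T_def by (rule order_trans[OF card_mono[of "{..<l}"]]) auto
  have sumT: "(\<Sum>i=1..l. up_eigenvalue 0 i K) = (\<Sum>s\<in>T. up_eigenvalue 0 (Suc s) K)"
    unfolding sum_up_eigenvalue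
  proof (rule sum.mono_neutral_right)
    show "\<forall>s\<in>{..<min l ?N} - T. up_eigenvalue 0 (Suc s) K = 0"
      using lam0 by (auto simp: T_def not_less intro: antisym)
  qed (auto simp: T_def)
  have kl2: "real (k * (k + 1)) \<le> real l * (real l + 1)"
  proof -
    have "real k * (real k + 1) \<le> real l * (real l + 1)" by (rule mult_mono) (use kl in auto)
    then show ?thesis by (simp add: algebra_simps)
  qed
  have ch: "real ((l + 1) choose 2) = real l * (real l + 1) / 2" unfolding choose_two_real by simp
  show ?thesis
  proof (cases "k = 0")
    case True
    then have "T = {}" using finT by (simp add: k_def)
    then show ?thesis unfolding sumT by simp
  next
    case False
    obtain f where f: "bij_betw f {1..k} T"
      using finT ex_bij_betw_nat_finite_1[of T] by (auto simp: k_def)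
    have fT: "f s \<in> T" if "s \<in> {1..k}" for s using f that by (rule bij_betwE[THEN bspec])
    have fN: "f s < ?N" "up_eigenvalue 0 (Suc (f s)) K > 0" if "s \<in> {1..k}" for s
      using fT[OF that] by (auto simp: T_def)
    interpret graph_eigenvectors k ?N "\<lambda>i s. x (f s) i" adj "\<lambda>s. up_eigenvalue 0 (Suc (f s)) K"
    proof
      show "k \<ge> 1" using False by simp
      show "(\<Sum>i<?N. x (f s) i * x (f s') i) = of_bool (s = s')" if "s \<in> {1..k}" "s' \<in> {1..k}" for s s'
      proof -
        have "f s = f s' \<longleftrightarrow> s = s'" using inj_on_eq_iff[OF bij_betw_imp_inj_on[OF f] that] .
        then show ?thesis using orth[OF fN(1)[OF that(1)] fN(1)[OF that(2)]] by simp
      qed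
      show "(\<Sum>i<?N. x (f s) i) = 0" if "s \<in> {1..k}" for s by (rule zero[OF fN[OF that]])
      show "adj i j \<longleftrightarrow> adj j i" for i j by (rule sym)
      show "(\<Sum>j<?N. of_bool (adj i j) * (x (f s) i - x (f s) j)) = up_eigenvalue 0 (Suc (f s)) K * x (f s) i"
        if "i < ?N" "s \<in> {1..k}" for i s
        using lap[OF that(1), of "x (f s)"] ev[OF fN(1)[OF that(2)] that(1)] by simp
    qed
    have "(\<Sum>s\<in>T. up_eigenvalue 0 (Suc s) K) = (\<Sum>s=1..k. up_eigenvalue 0 (Suc (f s)) K)"
      using sum.reindex_bij_betw[OF f, of "\<lambda>s. up_eigenvalue 0 (Suc s) K"] by simp
    then show ?thesis unfolding sumT ch using eigenvalue_sum_bound count kl2 by simp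
  qed
qed

theorem theorem1p6:
  fixes V :: "'a::linorder set" and K :: "'a set set" and r l :: nat
  assumes "r \<ge> 1"
    and "abstract_simplicial_complex V K"
    and "complex_dim K = int r"
    and "l \<ge> 1"
  shows "(\<Sum>i=1..l. up_eigenvalue (int r - 1) i K)
           \<le> (real r + 1) / 2 * real (num_faces (int r) K)
             + real (num_faces (int r - 2) K) / real r * real ((l + 1) choose 2)"
proof (cases "r = 1")
  case True
  \<comment> \<open>For \<open>r = 1\<close> the coefficient of the binomial involves the faces of
    dimension -1, and the empty face is the only one.\<close>
  have "faces (- 1) K = {{}}"
    using assms(2) abstract_simplicial_complex_finite(2)[OF assms(2)]
    by (auto simp: faces_def abstract_simplicial_complex_def)
  then have "num_faces (- 1) K = 1" by (simp add: num_faces_def)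
  then show ?thesis using graph_bound[OF assms(2), of l] True by simp
next
  case False
  then show ?thesis using higher_dimensional_bound[OF assms(2), of r l] assms(1) by simp
qed

end
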